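(* Let $m>3$ be an integer. Assume that $\eta_0\in\mathcal{H}_{DW}$ and $\rho^{1/2}\partial_\theta\eta_0\in H^m(\mathbb{T})$. Then for any $T>0$ there exists a unique classical and odd (in $\theta$) solution $\eta$ on $[0,T]\times\mathbb{T}$ to $$\partial_t\eta+L\eta=0,\qquad \partial_\theta v=H\eta,\qquad \eta(0,\theta)=\eta_0(\theta),\qquad v(t,0)=0,$$ satisfying $\eta\in C([0,T];\mathcal{H}_{DW})$ and $$\rho^{1/2}\partial_\theta\eta\in C([0,T];H^m(\mathbb{T}))\cap C^2([0,T];H^{m-2}(\mathbb{T})).$$
   Context: $\mathbb{T}=[-\pi,\pi]$ is the torus (functions are $2\pi$-periodic); $H^m(\mathbb{T})$ is the periodic Sobolev space. $H$ is the periodic Hilbert transform, $Hf(\theta)=\frac{1}{2\pi}\,\mathrm{P.V.}\int_{-\pi}^{\pi}\cot\frac{\theta-\phi}{2}f(\phi)\,d\phi$, so $H\sin k\theta=-\cos k\theta$ and $H\cos k\theta=\sin k\theta$ for $k\ge1$. Given $\eta$, the function $v$ is determined by $\partial_\theta v=H\eta$ and $v(t,0)=0$, and $$L\eta=\tfrac12\sin2\theta\,\partial_\theta\eta-\cos2\theta\,\eta+\sin2\theta\,H\eta-2\cos2\theta\,v$$ (the linearization around $\omega=-\sin2\theta$ of the De Gregorio model $\partial_t\omega+u\partial_\theta\omega=\omega\partial_\theta u$, $\partial_\theta u=H\omega$). The weight is $\rho=\frac{1}{4\pi\sin^2\theta}$, and $\rho^{1/2}$ denotes $\frac{1}{2\sqrt{\pi}\,\sin\theta}$.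 The space $\mathcal{H}_{DW}=\{\eta\in H^1(\mathbb{T}):\eta\text{ odd},\ \int_{\mathbb{T}}\frac{|\partial_\theta\eta|^2}{\sin^2\theta}\,d\theta<\infty\}$ is a Hilbert space with inner product $\langle\xi,\eta\rangle_\rho=\int_{-\pi}^{\pi}\rho\,\partial_\theta\xi\,\partial_\theta\eta\,d\theta$ and norm $\|\eta\|_{\mathcal{H}_{DW}}=\langle\eta,\eta\rangle_\rho^{1/2}$. *)

theory Defs
  imports "HOL-Analysis.Analysis"
begin

text \<open>Functions on the torus are \<open>2\<pi>\<close>-periodic functions on the real line, and integrals over
  the torus are Lebesgue integrals over \<open>[-\<pi>, \<pi>]\<close>.\<close>

definition periodic :: "(real \<Rightarrow> real) \<Rightarrow> bool" where
  "periodic f \<longleftrightarrow> (\<forall>x. f (x + 2 * pi) = f x)"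

definition odd_fun :: "(real \<Rightarrow> real) \<Rightarrow> bool" where
  "odd_fun f \<longleftrightarrow> (\<forall>x. f (- x) = - f x)"

abbreviation torus :: "real measure" where
  "torus \<equiv> lebesgue_on {-pi..pi}"

section \<open>Periodic Sobolev spaces\<close>

definition test_fun :: "(real \<Rightarrow> real) \<Rightarrow> bool" where
  "test_fun \<phi> \<longleftrightarrow> periodic \<phi> \<and> (\<forall>n x. (deriv ^^ n) \<phi> differentiable (at x))"

definition has_weak_deriv :: "(real \<Rightarrow> real) \<Rightarrow> (real \<Rightarrow> real) \<Rightarrow> bool" where
  "has_weak_deriv f g \<longleftrightarrow>
     periodic f \<and> integrable torus f \<and> periodic g \<and> integrable torus g \<and>
     (\<forall>\<phi>. test_fun \<phi> \<longrightarrow> (LINT x|torus. f x * deriv \<phi> x) = - (LINT x|torus. g x * \<phi> x))"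

text \<open>The weak derivative is determined only up to a null set; \<open>wderiv\<close> picks a representative.
  It is meaningful only when a weak derivative exists.\<close>

definition wderiv :: "(real \<Rightarrow> real) \<Rightarrow> real \<Rightarrow> real" where
  "wderiv f = (SOME g. has_weak_deriv f g)"

definition L2 :: "(real \<Rightarrow> real) set" where
  "L2 = {f. periodic f \<and> f \<in> borel_measurable torus \<and> integrable torus (\<lambda>x. (f x)\<^sup>2)}"

text \<open>Elements of \<open>L2\<close> and \<open>Sob m\<close> are functions rather than classes modulo null sets;
  accordingly \<open>Sob_norm m\<close> vanishes on null functions.\<close>

primrec Sob :: "nat \<Rightarrow> (real \<Rightarrow> real) set" where
  "Sob 0 = L2"
| "Sob (Suc m) = {f \<in> L2. \<exists>g \<in> Sob m. has_weak_deriv f g}"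

definition Sob_norm :: "nat \<Rightarrow> (real \<Rightarrow> real) \<Rightarrow> real" where
  "Sob_norm m f = sqrt (\<Sum>k\<le>m. LINT x|torus. ((wderiv ^^ k) f x)\<^sup>2)"

section \<open>The weighted space\<close>

definition rho :: "real \<Rightarrow> real" where
  "rho \<theta> = 1 / (4 * pi * (sin \<theta>)\<^sup>2)"

text \<open>The signed square root of \<open>rho\<close>: it has the sign of \<open>sin \<theta>\<close>.\<close>

definition rho_half :: "real \<Rightarrow> real" where
  "rho_half \<theta> = 1 / (2 * sqrt pi * sin \<theta>)"

text \<open>Members of \<open>H_DW\<close> are taken to be the continuous representatives of their classes in
  \<open>H\<^sup>1\<close>, so that pointwise evaluation makes sense.\<close>

definition H_DW :: "(real \<Rightarrow> real) set" where
  "H_DW = {\<eta> \<in> Sob 1. continuous_on UNIV \<eta> \<and> odd_fun \<eta> \<and>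
     integrable torus (\<lambda>\<theta>. (wderiv \<eta> \<theta>)\<^sup>2 / (sin \<theta>)\<^sup>2)}"

definition DW_inner :: "(real \<Rightarrow> real) \<Rightarrow> (real \<Rightarrow> real) \<Rightarrow> real" where
  "DW_inner \<xi> \<eta> = (LINT \<theta>|torus. rho \<theta> * wderiv \<xi> \<theta> * wderiv \<eta> \<theta>)"

definition DW_norm :: "(real \<Rightarrow> real) \<Rightarrow> real" where
  "DW_norm \<eta> = sqrt (DW_inner \<eta> \<eta>)"

definition weighted_deriv :: "(real \<Rightarrow> real) \<Rightarrow> real \<Rightarrow> real" where
  "weighted_deriv \<eta> \<theta> = rho_half \<theta> * wderiv \<eta> \<theta>"

section \<open>Curves in function spaces\<close>

text \<open>\<open>C_into k T X N u\<close> says that \<open>u\<close> is in \<open>C\<^sup>k([0,T]; X)\<close>, where the function space \<open>X\<close>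
  carries the norm \<open>N\<close>; derivatives in time are limits of difference quotients with respect
  to \<open>N\<close>, one-sided at the end points.\<close>

primrec C_into :: "nat \<Rightarrow> real \<Rightarrow> (real \<Rightarrow> real) set \<Rightarrow> ((real \<Rightarrow> real) \<Rightarrow> real)
    \<Rightarrow> (real \<Rightarrow> real \<Rightarrow> real) \<Rightarrow> bool" where
  "C_into 0 T X N u \<longleftrightarrow> (\<forall>t\<in>{0..T}. u t \<in> X \<and>
     ((\<lambda>s. N (\<lambda>x. u s x - u t x)) \<longlongrightarrow> 0) (at t within {0..T}))"
| "C_into (Suc k) T X N u \<longleftrightarrow> (\<forall>t\<in>{0..T}. u t \<in> X) \<and>
     (\<exists>u'. (\<forall>t\<in>{0..T}.
         ((\<lambda>s. N (\<lambda>x. (u s x - u t x) / (s - t) - u' t x)) \<longlongrightarrow> 0) (at t within {0..T}))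
       \<and> C_into k T X N u')"

section \<open>The linearized equation\<close>

text \<open>The principal value is taken over the period \<open>[\<theta> - \<pi>, \<theta> + \<pi>]\<close>, in which
  the kernel is singular only at \<open>\<phi> = \<theta>\<close>; for periodic \<open>f\<close> this is the integral over
  \<open>[-\<pi>, \<pi>]\<close>.\<close>

definition hilbert :: "(real \<Rightarrow> real) \<Rightarrow> real \<Rightarrow> real" where
  "hilbert f \<theta> = Lim (at_right 0) (\<lambda>\<epsilon>. 1 / (2 * pi) *
     (LINT \<phi>|lebesgue_on {\<phi>. \<epsilon> \<le> \<bar>\<theta> - \<phi>\<bar> \<and> \<bar>\<theta> - \<phi>\<bar> \<le> pi}. cot ((\<theta> - \<phi>) / 2) * f \<phi>))"

definition L_op :: "(real \<Rightarrow> real) \<Rightarrow> (real \<Rightarrow> real) \<Rightarrow> real \<Rightarrow> real" where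
  "L_op \<eta> v \<theta> = 1 / 2 * sin (2 * \<theta>) * deriv \<eta> \<theta> - cos (2 * \<theta>) * \<eta> \<theta>
     + sin (2 * \<theta>) * hilbert \<eta> \<theta> - 2 * cos (2 * \<theta>) * v \<theta>"

text \<open>A classical solution is continuously differentiable on \<open>[0,T]\<close> times the torus (with
  one-sided time derivatives at \<open>0\<close> and \<open>T\<close>) and satisfies the equations pointwise.\<close>

definition classical_solution :: "real \<Rightarrow> (real \<Rightarrow> real) \<Rightarrow> (real \<Rightarrow> real \<Rightarrow> real) \<Rightarrow> bool" where
  "classical_solution T \<eta>\<^sub>0 \<eta> \<longleftrightarrow>
     (\<forall>t\<in>{0..T}. periodic (\<eta> t)) \<and>
     (\<exists>\<eta>t \<eta>\<theta> v.
        (\<forall>t\<in>{0..T}. \<forall>\<theta>.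
           ((\<lambda>s. \<eta> s \<theta>) has_real_derivative \<eta>t t \<theta>) (at t within {0..T}) \<and>
           (\<eta> t has_real_derivative \<eta>\<theta> t \<theta>) (at \<theta>)) \<and>
        continuous_on ({0..T} \<times> UNIV) (\<lambda>(t, \<theta>). \<eta>t t \<theta>) \<and>
        continuous_on ({0..T} \<times> UNIV) (\<lambda>(t, \<theta>). \<eta>\<theta> t \<theta>) \<and>
        (\<forall>t\<in>{0..T}. \<forall>\<theta>.
           \<eta>t t \<theta> + L_op (\<eta> t) (v t) \<theta> = 0 \<and>
           (v t has_real_derivative hilbert (\<eta> t) \<theta>) (at \<theta>)) \<and>
        (\<forall>t\<in>{0..T}. v t 0 = 0)) \<and>
     (\<forall>\<theta>. \<eta> 0 \<theta> = \<eta>\<^sub>0 \<theta>)"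

definition regular_odd_solution ::
    "nat \<Rightarrow> real \<Rightarrow> (real \<Rightarrow> real) \<Rightarrow> (real \<Rightarrow> real \<Rightarrow> real) \<Rightarrow> bool" where
  "regular_odd_solution m T \<eta>\<^sub>0 \<eta> \<longleftrightarrow>
     classical_solution T \<eta>\<^sub>0 \<eta> \<and>
     (\<forall>t\<in>{0..T}. odd_fun (\<eta> t)) \<and>
     C_into 0 T H_DW DW_norm \<eta> \<and>
     C_into 0 T (Sob m) (Sob_norm m) (\<lambda>t. weighted_deriv (\<eta> t)) \<and>
     C_into 2 T (Sob (m - 2)) (Sob_norm (m - 2)) (\<lambda>t. weighted_deriv (\<eta> t))"

end

theory Submission
  imports Defs
begin

text \<open>Write \<open>\<partial>\<^sub>\<theta>\<eta> = 2 sqrt \<pi> sin \<theta> w\<close> with \<open>w = \<Sum>\<^sub>k c\<^sub>k sin k\<theta>\<close>, so that the weighted norm of \<open>\<eta>\<close> is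
  the \<open>L\<^sup>2\<close> norm of \<open>w\<close>; periodicity of \<open>\<eta>\<close> forces \<open>c\<^sub>1 = 0\<close>. With
  \<open>d\<^sub>k = (k - 2)\<^sup>2 (k + 2) / (4 k\<^sup>2)\<close> the equation becomes
  \<open>c\<^sub>k' = - d\<^sub>k\<^sub>-\<^sub>1 c\<^sub>k\<^sub>-\<^sub>2 - (d\<^sub>k\<^sub>+\<^sub>1 - d\<^sub>k\<^sub>-\<^sub>1) c\<^sub>k + d\<^sub>k\<^sub>+\<^sub>1 c\<^sub>k\<^sub>+\<^sub>2\<close>:
  a skew-symmetric matrix with entries growing linearly in \<open>k\<close> plus a bounded diagonal. Hence energy
  estimates hold in \<open>\<ell>\<^sup>2\<close> with the weights \<open>(k + 1)\<^sup>2\<^sup>s\<close> for every \<open>s\<close>; Galerkin truncation gives a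
  solution continuous in time in each such space that contains the data, with each time derivative
  costing one power of \<open>k\<close>. For uniqueness, the coefficients of any solution satisfy the
  same system, and the boundary terms in the truncated energy identity vanish in the limit
  because \<open>k c\<^sub>k\<close> is bounded.\<close>

section \<open>Weighted sequence spaces\<close>

text \<open>Why the sine coefficients of eta themselves do not suffice: with e k = k times the
  coefficient of sin k\<theta>, the operator L moves an amount \<open>d k * e k\<close> up to index
  k + 2 and the same amount, with opposite sign, down to k - 2. The factor sits at the source index,
  so this matrix is not skew-symmetric. Dividing the derivative of eta by sin \<theta> amounts to
  writing e k = sqrt pi (c (k + 1) - c (k - 1)). After this summation d sits on the link between two
  neighbours of equal parity; that is where skewness comes from, and the diagonal consists of
  increments of d. The system closes at the bottom because d 2 = 0 (sin 2\<theta> lies in the kernel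
  of L): this cuts index 1 off from index 3, so that c 1 = 0 persists. Two obstacles shape the
  proof. The data have no power of k to spare, although truncating the system costs one. And weak
  derivatives are chosen representatives of which nothing is known pointwise, so Sobolev norms are
  always compared with Fourier coefficients, which do not see null sets.\<close>

definition wsq :: "nat \<Rightarrow> (nat \<Rightarrow> real) \<Rightarrow> nat \<Rightarrow> real" where
  "wsq s c k = (real k + 1) ^ (2 * s) * (c k)\<^sup>2"

text \<open>Continuity of a curve into the weighted sequence space, the counterpart of
  \<open>C_into 0\<close> on coefficients. The squared norm is kept because it is a series of
  nonnegative terms.\<close>

definition hcont :: "nat \<Rightarrow> real \<Rightarrow> (real \<Rightarrow> nat \<Rightarrow> real) \<Rightarrow> bool" where
  "hcont s T c \<longleftrightarrow> (\<forall>t\<in>{0..T}. summable (wsq s (c t)) \<and>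
     ((\<lambda>r. \<Sum>k. wsq s (\<lambda>k. c r k - c t k) k) \<longlongrightarrow> 0) (at t within {0..T}))"

text \<open>On each parity class a tridiagonal matrix, with \<open>q k\<close> on the link between k
  and k + 2. Rows 0 and 1 are zero, so that the flow leaves these two components at rest.\<close>

definition jac :: "(nat \<Rightarrow> real) \<Rightarrow> (nat \<Rightarrow> real) \<Rightarrow> nat \<Rightarrow> real" where
  "jac q c k = (if k < 2 then 0 else q (k - 2) * c (k - 2) + (q k - q (k - 2)) * c k - q k * c (k + 2))"

lemma wsq_nonneg [simp]: "0 \<le> wsq s c k"
  by (simp add: wsq_def)

lemma wsq_scale: "wsq s (\<lambda>k. a * c k) k = a\<^sup>2 * wsq s c k"
  by (simp add: wsq_def power_mult_distrib)

lemma sq_add_le: "(x + y)\<^sup>2 \<le> 2 * x\<^sup>2 + 2 * (y::real)\<^sup>2"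
  using sum_squares_bound[of x y] by (simp add: power2_sum)

lemma wsq_add_le: "wsq s (\<lambda>k. x k + y k) k \<le> 2 * wsq s x k + 2 * wsq s y k"
proof -
  have "(real k + 1) ^ (2 * s) * (x k + y k)\<^sup>2 \<le> (real k + 1) ^ (2 * s) * (2 * (x k)\<^sup>2 + 2 * (y k)\<^sup>2)"
    by (intro mult_left_mono sq_add_le) simp
  then show ?thesis by (simp add: wsq_def algebra_simps)
qed

lemma summable_wsq_add:
  assumes "summable (wsq s x)" "summable (wsq s y)"
  shows "summable (wsq s (\<lambda>k. x k + y k))"
    and "(\<Sum>k. wsq s (\<lambda>k. x k + y k) k) \<le> 2 * (\<Sum>k. wsq s x k) + 2 * (\<Sum>k. wsq s y k)"
proof -
  have S: "summable (\<lambda>k. 2 * wsq s x k + 2 * wsq s y k)"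
    using assms by (intro summable_add summable_mult)
  show 1: "summable (wsq s (\<lambda>k. x k + y k))"
    by (rule summable_comparison_test'[OF S]) (use wsq_add_le in auto)
  have "(\<Sum>k. wsq s (\<lambda>k. x k + y k) k) \<le> (\<Sum>k. 2 * wsq s x k + 2 * wsq s y k)"
    by (intro suminf_le wsq_add_le 1 S)
  also have "\<dots> = 2 * (\<Sum>k. wsq s x k) + 2 * (\<Sum>k. wsq s y k)"
    using assms by (simp add: suminf_add[symmetric] summable_mult suminf_mult)
  finally show "(\<Sum>k. wsq s (\<lambda>k. x k + y k) k) \<le> 2 * (\<Sum>k. wsq s x k) + 2 * (\<Sum>k. wsq s y k)" .
qed

lemma summable_wsq_diff:
  assumes "summable (wsq s x)" "summable (wsq s y)"
  shows "summable (wsq s (\<lambda>k. x k - y k))"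
    and "(\<Sum>k. wsq s (\<lambda>k. x k - y k) k) \<le> 2 * (\<Sum>k. wsq s x k) + 2 * (\<Sum>k. wsq s y k)"
proof -
  have e: "wsq s (\<lambda>k. - y k) = wsq s y" by (rule ext) (simp add: wsq_def)
  show "summable (wsq s (\<lambda>k. x k - y k))"
   "(\<Sum>k. wsq s (\<lambda>k. x k - y k) k) \<le> 2 * (\<Sum>k. wsq s x k) + 2 * (\<Sum>k. wsq s y k)"
    using summable_wsq_add[of s x "\<lambda>k. - y k"] assms e by simp_all
qed

lemma summable_wsq_scale:
  assumes "summable (wsq s x)"
  shows "summable (wsq s (\<lambda>k. a * x k))"
proof -
  have "wsq s (\<lambda>k. a * x k) = (\<lambda>k. a\<^sup>2 * wsq s x k)" by (rule ext) (rule wsq_scale)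
  then show ?thesis using assms by (simp add: summable_mult)
qed

lemma wsq_mono: "s \<le> s' \<Longrightarrow> wsq s c k \<le> wsq s' c k"
  unfolding wsq_def by (intro mult_right_mono power_increasing) auto

lemma summable_wsq_mono: "summable (wsq s' c) \<Longrightarrow> s \<le> s' \<Longrightarrow> summable (wsq s c)"
  by (rule summable_comparison_test'[of "wsq s' c" 0]) (auto simp: wsq_mono)

lemma hcont_mono:
  assumes "hcont s' T c" "s \<le> s'"
  shows "hcont s T c"
  unfolding hcont_def
proof (intro ballI conjI)
  fix t assume t: "t \<in> {0..T}"
  then show "summable (wsq s (c t))"
    using assms summable_wsq_mono unfolding hcont_def by blast
  have L: "((\<lambda>r. \<Sum>k. wsq s' (\<lambda>k. c r k - c t k) k) \<longlongrightarrow> 0) (at t within {0..T})"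
    using assms t unfolding hcont_def by blast
  have D: "summable (wsq s' (\<lambda>k. c r k - c t k))" if "r \<in> {0..T}" for r
    using assms t that unfolding hcont_def by (intro summable_wsq_diff) auto
  show "((\<lambda>r. \<Sum>k. wsq s (\<lambda>k. c r k - c t k) k) \<longlongrightarrow> 0) (at t within {0..T})"
  proof (rule tendsto_sandwich[OF _ _ tendsto_const L])
    show "\<forall>\<^sub>F r in at t within {0..T}. 0 \<le> (\<Sum>k. wsq s (\<lambda>k. c r k - c t k) k)"
      unfolding eventually_at_filter
      using D assms(2) by (intro always_eventually allI impI suminf_nonneg) (auto intro: summable_wsq_mono)
    show "\<forall>\<^sub>F r in at t within {0..T}. (\<Sum>k. wsq s (\<lambda>k. c r k - c t k) k) \<le> (\<Sum>k. wsq s' (\<lambda>k. c r k - c t k) k)"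
      unfolding eventually_at_filter
      using D assms(2) by (intro always_eventually allI impI suminf_le) (auto intro: summable_wsq_mono wsq_mono)
  qed
qed

text \<open>Truncated subtraction lets \<open>f (k - 2)\<close> meet \<open>f 0\<close> three times
  and \<open>f (k - 1)\<close> twice, so the five shifted series add up to 5 * suminf f + f 0 - f 1.
  The factor 8 is a convenient upper bound.\<close>

lemma shift_comparison:
  fixes f g :: "nat \<Rightarrow> real"
  assumes f: "\<And>k. 0 \<le> f k" "summable f" and g: "\<And>k. 0 \<le> g k"
    and le: "\<And>k. g k \<le> C * (f (k - 2) + f (k - 1) + f k + f (k + 1) + f (k + 2))" and C: "0 \<le> C"
  shows "summable g" "suminf g \<le> 8 * C * suminf f"
proof -
  have s1: "(\<lambda>k. f (k - 1)) sums (suminf f + f 0)"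
    using sums_Suc[of "\<lambda>k. f (k - 1)" "suminf f"] summable_sums[OF f(2)] by simp
  have s2: "(\<lambda>k. f (k - 2)) sums (suminf f + f 0 + f 0)"
    using sums_Suc[of "\<lambda>k. f (k - 2)" "suminf f + f 0"] s1 by (simp add: numeral_2_eq_2)
  have t1: "(\<lambda>k. f (k + 1)) sums (suminf f - f 0)"
    using sums_split_initial_segment[OF summable_sums[OF f(2)], of 1] by simp
  have t2: "(\<lambda>k. f (k + 2)) sums (suminf f - (f 0 + f 1))"
    using sums_split_initial_segment[OF summable_sums[OF f(2)], of 2] by (simp add: numeral_2_eq_2)
  have S: "(\<lambda>k. C * (f (k - 2) + f (k - 1) + f k + f (k + 1) + f (k + 2))) sums
     (C * ((suminf f + f 0 + f 0) + (suminf f + f 0) + suminf f + (suminf f - f 0) + (suminf f - (f 0 + f 1))))"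
    by (intro sums_mult sums_add s1 s2 t1 t2 summable_sums f)
  show 1: "summable g"
    by (rule summable_comparison_test'[OF sums_summable[OF S], of 0]) (use le g in auto)
  have "suminf g \<le> C * ((suminf f + f 0 + f 0) + (suminf f + f 0) + suminf f + (suminf f - f 0) + (suminf f - (f 0 + f 1)))"
    unfolding sums_unique[OF S] by (intro suminf_le le 1 sums_summable[OF S])
  also have "\<dots> = C * (5 * suminf f + f 0 - f 1)" by (simp add: algebra_simps)
  also have "\<dots> \<le> C * (8 * suminf f)"
  proof (intro mult_left_mono C)
    have "f 0 \<le> suminf f" using sum_le_suminf[OF f(2), of "{0}"] f by simp
    moreover have "0 \<le> suminf f" using f by (intro suminf_nonneg)
    ultimately show "5 * suminf f + f 0 - f 1 \<le> 8 * suminf f" using f(1)[of 1] by linarith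
  qed
  finally show "suminf g \<le> 8 * C * suminf f" by simp
qed

text \<open>A linear map whose output at k is controlled by the entries within distance two is
  bounded between the weighted spaces; applied to differences, the same bound gives continuity. All
  operators on coefficients that occur later are of this kind.\<close>

lemma hcont_map:
  assumes c: "hcont s' T c"
    and lin: "\<And>x y k. \<Phi> (\<lambda>k. x k - y k) k = \<Phi> x k - \<Phi> y k"
    and bd: "\<And>x k. wsq s (\<Phi> x) k \<le> C * (wsq s' x (k - 2) + wsq s' x (k - 1) + wsq s' x k + wsq s' x (k + 1) + wsq s' x (k + 2))"
    and C: "0 \<le> C"
  shows "hcont s T (\<lambda>t. \<Phi> (c t))"
  unfolding hcont_def
proof (intro ballI conjI)
  fix t assume t: "t \<in> {0..T}"
  then show "summable (wsq s (\<Phi> (c t)))"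
    using c by (intro shift_comparison(1)[OF _ _ _ bd C]) (auto simp: hcont_def)
  have L: "((\<lambda>r. 8 * C * (\<Sum>k. wsq s' (\<lambda>k. c r k - c t k) k)) \<longlongrightarrow> 8 * C * 0) (at t within {0..T})"
    using c t unfolding hcont_def by (intro tendsto_mult tendsto_const) blast
  have D: "summable (wsq s' (\<lambda>k. c r k - c t k))" if "r \<in> {0..T}" for r
    using c t that unfolding hcont_def by (intro summable_wsq_diff) auto
  have lin': "(\<lambda>k. \<Phi> (c r) k - \<Phi> (c t) k) = \<Phi> (\<lambda>k. c r k - c t k)" for r
    by (rule ext) (simp add: lin)
  show "((\<lambda>r. \<Sum>k. wsq s (\<lambda>k. \<Phi> (c r) k - \<Phi> (c t) k) k) \<longlongrightarrow> 0) (at t within {0..T})"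
    unfolding lin'
  proof (rule tendsto_sandwich[OF _ _ tendsto_const])
    show "((\<lambda>r. 8 * C * (\<Sum>k. wsq s' (\<lambda>k. c r k - c t k) k)) \<longlongrightarrow> 0) (at t within {0..T})"
      using L by simp
    show "\<forall>\<^sub>F r in at t within {0..T}. 0 \<le> (\<Sum>k. wsq s (\<Phi> (\<lambda>k. c r k - c t k)) k)"
      unfolding eventually_at_filter
      using D by (intro always_eventually allI impI suminf_nonneg shift_comparison(1)[OF _ _ _ bd C]) auto
    show "\<forall>\<^sub>F r in at t within {0..T}. (\<Sum>k. wsq s (\<Phi> (\<lambda>k. c r k - c t k)) k) \<le> 8 * C * (\<Sum>k. wsq s' (\<lambda>k. c r k - c t k) k)"
      unfolding eventually_at_filter
      using D by (intro always_eventually allI impI shift_comparison(2)[OF _ _ _ bd C]) auto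
  qed
qed

section \<open>Differentiability of curves of sequences\<close>

lemma mvt_within:
  fixes f f' :: "real \<Rightarrow> real"
  assumes "a < b" and S: "{a..b} \<subseteq> S" and d: "\<And>x. x \<in> {a..b} \<Longrightarrow> (f has_real_derivative f' x) (at x within S)"
  shows "\<exists>x\<in>{a<..<b}. f b - f a = (b - a) * f' x"
proof -
  have "\<exists>x\<in>{a<..<b}. f b - f a = f' x * (b - a)"
    using assms(1) has_field_derivative_subset[OF d S] unfolding has_field_derivative_def
    by (intro mvt_simple[where f' = "\<lambda>x. (*) (f' x)"]) auto
  then show ?thesis by (simp add: mult.commute)
qed

text \<open>The error y of the difference quotient is paired with itself. Freezing one copy of y as
  a weight leaves a scalar function of time, to which the mean value theorem applies: the square of
  y equals the pairing of y with b u - b t for an intermediate u, hence is at most the square of b u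
  - b t.\<close>

lemma hcont_strong_derivative:
  assumes der: "\<And>t k. t \<in> {0..T} \<Longrightarrow> ((\<lambda>r. c r k) has_real_derivative b t k) (at t within {0..T})"
    and b: "hcont s T b" and c: "\<And>t. t \<in> {0..T} \<Longrightarrow> summable (wsq s (c t))" and t: "t \<in> {0..T}"
  shows "((\<lambda>r. \<Sum>k. wsq s (\<lambda>k. (c r k - c t k) / (r - t) - b t k) k) \<longlongrightarrow> 0) (at t within {0..T})"
proof (rule tendstoI)
  fix e :: real assume e: "e > 0"
  have L: "((\<lambda>r. \<Sum>k. wsq s (\<lambda>k. b r k - b t k) k) \<longlongrightarrow> 0) (at t within {0..T})"
    using b t unfolding hcont_def by blast
  have bs: "summable (wsq s (b r))" if "r \<in> {0..T}" for r using b that unfolding hcont_def by blast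
  from tendstoD[OF L, of "e/2"] e obtain d where d: "d > 0" and dd: "\<And>r. r \<in> {0..T} \<Longrightarrow> r \<noteq> t \<Longrightarrow> dist r t < d \<Longrightarrow> dist (\<Sum>k. wsq s (\<lambda>k. b r k - b t k) k) 0 < e/2"
    unfolding eventually_at by auto
  have dd': "(\<Sum>k. wsq s (\<lambda>k. b r k - b t k) k) \<le> e/2" if "r \<in> {0..T}" "dist r t < d" for r
    using dd[OF that(1)] that e by (cases "r = t") (auto simp: wsq_def)
  have "dist (\<Sum>k. wsq s (\<lambda>k. (c r k - c t k) / (r - t) - b t k) k) 0 < e"
    if r: "r \<in> {0..T}" "r \<noteq> t" "dist r t < d" for r
  proof -
    define y where "y = (\<lambda>k. (c r k - c t k) / (r - t) - b t k)"
    have sy: "summable (wsq s y)"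
    proof -
      have "summable (wsq s (\<lambda>k. (1 / (r - t)) * (c r k - c t k) - b t k))"
        using r t c bs by (intro summable_wsq_diff summable_wsq_scale) auto
      then show ?thesis by (simp add: y_def)
    qed
    \<comment> \<open>Cutting the sum at K makes \<open>f\<close> differentiable term by term; the
      resulting bound does not depend on K.\<close>
    have "(\<Sum>k<K. wsq s y k) \<le> e/2" for K
    proof -
      define p where "p k = (real k + 1) ^ (2 * s)" for k
      define f where "f u = (\<Sum>k<K. p k * y k * c u k)" for u
      have fd: "(f has_real_derivative (\<Sum>k<K. p k * y k * b u k)) (at u within {0..T})" if "u \<in> {0..T}" for u
        unfolding f_def by (auto intro!: derivative_eq_intros der that sum.cong simp: mult_ac)
      obtain u where u: "u \<in> {min r t..max r t}" and fu: "f r - f t = (r - t) * (\<Sum>k<K. p k * y k * b u k)"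
      proof (cases "r < t")
        case True
        have "\<exists>x\<in>{r<..<t}. f t - f r = (t - r) * (\<Sum>k<K. p k * y k * b x k)"
          using True r t by (intro mvt_within[of _ _ "{0..T}"] fd) auto
        then obtain x where "x \<in> {r<..<t}" "f t - f r = (t - r) * (\<Sum>k<K. p k * y k * b x k)" by blast
        then show ?thesis using True by (intro that[of x]) (auto simp: algebra_simps)
      next
        case False
        with r have lt: "t < r" by auto
        have "\<exists>x\<in>{t<..<r}. f r - f t = (r - t) * (\<Sum>k<K. p k * y k * b x k)"
          using lt r t by (intro mvt_within[of _ _ "{0..T}"] fd) auto
        then obtain x where "x \<in> {t<..<r}" "f r - f t = (r - t) * (\<Sum>k<K. p k * y k * b x k)" by blast
        then show ?thesis using lt by (intro that[of x]) (auto simp: algebra_simps)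
      qed
      have uT: "u \<in> {0..T}" "dist u t < d" using u r t by (auto simp: dist_real_def min_def max_def split: if_splits)
      have "(\<Sum>k<K. wsq s y k) = (\<Sum>k<K. p k * y k * ((c r k - c t k) / (r - t) - b t k))"
        by (simp add: wsq_def p_def y_def power2_eq_square mult.assoc)
      also have "\<dots> = (f r - f t) / (r - t) - (\<Sum>k<K. p k * y k * b t k)"
        unfolding f_def by (simp add: sum_subtractf[symmetric] sum_divide_distrib algebra_simps diff_divide_distrib)
      also have "\<dots> = (\<Sum>k<K. p k * y k * b u k) - (\<Sum>k<K. p k * y k * b t k)"
        using fu r by simp
      also have "\<dots> = (\<Sum>k<K. p k * (y k * (b u k - b t k)))"
        by (simp add: sum_subtractf[symmetric] algebra_simps)
      also have "\<dots> \<le> (\<Sum>k<K. wsq s y k / 2 + wsq s (\<lambda>k. b u k - b t k) k / 2)"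
      proof (rule sum_mono)
        fix k
        have "p k * (y k * (b u k - b t k)) \<le> p k * ((y k)\<^sup>2 / 2 + (b u k - b t k)\<^sup>2 / 2)"
          using sum_squares_bound[of "y k" "b u k - b t k"] by (intro mult_left_mono) (auto simp: p_def)
        then show "p k * (y k * (b u k - b t k)) \<le> wsq s y k / 2 + wsq s (\<lambda>k. b u k - b t k) k / 2"
          by (simp add: wsq_def p_def algebra_simps)
      qed
      also have "\<dots> = (\<Sum>k<K. wsq s y k) / 2 + (\<Sum>k<K. wsq s (\<lambda>k. b u k - b t k) k) / 2"
        by (simp add: sum.distrib sum_divide_distrib)
      finally have "(\<Sum>k<K. wsq s y k) \<le> (\<Sum>k<K. wsq s (\<lambda>k. b u k - b t k) k)" by simp
      also have "\<dots> \<le> (\<Sum>k. wsq s (\<lambda>k. b u k - b t k) k)"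
        using uT t bs by (intro sum_le_suminf summable_wsq_diff) auto
      also have "\<dots> \<le> e/2" using dd'[OF uT] .
      finally show ?thesis .
    qed
    then have "suminf (wsq s y) \<le> e/2" by (intro suminf_le_const sy)
    moreover have "0 \<le> suminf (wsq s y)" by (intro suminf_nonneg sy) auto
    ultimately show ?thesis using e unfolding y_def by simp
  qed
  then show "\<forall>\<^sub>F r in at t within {0..T}. dist (\<Sum>k. wsq s (\<lambda>k. (c r k - c t k) / (r - t) - b t k) k) 0 < e"
    unfolding eventually_at using d by blast
qed

section \<open>Jacobi systems\<close>

text \<open>By convexity the power lies below its chord between x = 0 and x = 1.\<close>

lemma power_growth_aux:
  fixes x :: real assumes "0 \<le> x" "x \<le> 1"
  shows "(1 + 2 * x) ^ n - 1 \<le> x * (3 ^ n - 1)"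
proof (induction n)
  case (Suc n)
  have "(1 + 2 * x) ^ Suc n - 1 = (1 + 2 * x) * ((1 + 2 * x) ^ n - 1) + 2 * x"
    by (simp add: algebra_simps)
  also have "\<dots> \<le> (1 + 2 * x) * (x * (3 ^ n - 1)) + 2 * x"
    using Suc assms by (intro add_right_mono mult_left_mono) auto
  also have "\<dots> \<le> 3 * (x * (3 ^ n - 1)) + 2 * x"
    using assms by (intro add_right_mono mult_right_mono mult_nonneg_nonneg) auto
  finally show ?case by (simp add: algebra_simps)
qed simp

lemma weight_shift_le: "(real k + 3) ^ (2 * s) \<le> 9 ^ s * (real k + 1) ^ (2 * s)"
proof -
  have "(real k + 3) ^ (2 * s) \<le> (3 * (real k + 1)) ^ (2 * s)" by (intro power_mono) auto
  also have "\<dots> = 9 ^ s * (real k + 1) ^ (2 * s)" unfolding power_mult_distrib by (simp add: power_mult)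
  finally show ?thesis .
qed

text \<open>Over two steps the weight grows by a factor 1 + O(1/k), and the gain 1/k compensates a
  coupling that grows like k. With y = k + 1 one has k + 3 = y (1 + 2/y), which is
  \<open>power_growth_aux\<close> at x = 1/y.\<close>

lemma weight_increment_le:
  "((real k + 3) ^ (2 * s) - (real k + 1) ^ (2 * s)) * (real k + 1) \<le> 9 ^ s * (real k + 1) ^ (2 * s)"
proof -
  define y where "y = real k + 1"
  have y: "y \<ge> 1" by (simp add: y_def)
  have e: "(real k + 3) = y * (1 + 2 * (1 / y))" using y by (simp add: y_def field_simps)
  have "((real k + 3) ^ (2 * s) - y ^ (2 * s)) * y = y ^ (2 * s) * (((1 + 2 * (1 / y)) ^ (2 * s) - 1) * y)"
    unfolding e power_mult_distrib by (simp add: algebra_simps)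
  also have "\<dots> \<le> y ^ (2 * s) * ((1 / y * (3 ^ (2 * s) - 1)) * y)"
    using y by (intro mult_left_mono mult_right_mono power_growth_aux) auto
  also have "\<dots> \<le> y ^ (2 * s) * 9 ^ s"
    using y by (intro mult_left_mono) (auto simp: power_mult)
  finally show ?thesis unfolding y_def by (simp add: mult.commute)
qed

text \<open>Apart from its diagonal, \<^term>\<open>jac q\<close> is skew-symmetric, so only increments of the weight
  and boundary terms survive.\<close>

lemma jac_energy_identity:
  fixes p q z :: "nat \<Rightarrow> real"
  assumes "z 0 = 0" "z 1 = 0"
  shows "(\<Sum>k\<le>Suc N. p k * z k * jac q z k) =
    (\<Sum>k\<le>Suc N. if k < 2 then 0 else p k * (q k - q (k - 2)) * (z k)\<^sup>2)
    + (\<Sum>k\<le>Suc N. (p (k + 2) - p k) * q k * z k * z (k + 2))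
    - p (N + 3) * q (N + 1) * z (N + 1) * z (N + 3) - p (N + 2) * q N * z N * z (N + 2)"
proof (induction N)
  case 0
  then show ?case using assms by simp
next
  case (Suc N)
  define a where "a k = (if k < 2 then 0 else p k * (q k - q (k - 2)) * (z k)\<^sup>2)" for k
  define b where "b k = (p (k + 2) - p k) * q k * z k * z (k + 2)" for k
  have n4: "N + 4 = Suc (Suc (Suc (Suc N)))" "N + 2 = Suc (Suc N)" by simp_all
  have j: "jac q z (N + 2) = q N * z N + (q (N + 2) - q N) * z (N + 2) - q (N + 2) * z (N + 4)"
    by (simp add: jac_def n4)
  \<comment> \<open>The new row N + 2 cancels the boundary product of N and N + 2 and creates that
    of N + 2 and N + 4, up to a weight increment; the boundary product of N + 1 and N + 3 is carried
    along.\<close>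
  have "(\<Sum>k\<le>Suc (Suc N). p k * z k * jac q z k) = (\<Sum>k\<le>Suc N. p k * z k * jac q z k) + p (N + 2) * z (N + 2) * jac q z (N + 2)"
    by (subst sum.atMost_Suc) simp
  also have "\<dots> = sum a {..Suc N} + sum b {..Suc N} - p (N + 3) * q (N + 1) * z (N + 1) * z (N + 3) - p (N + 2) * q N * z N * z (N + 2)
      + p (N + 2) * z (N + 2) * jac q z (N + 2)"
    unfolding Suc.IH a_def b_def by simp
  also have "\<dots> = (sum a {..Suc N} + p (N + 2) * (q (N + 2) - q N) * (z (N + 2))\<^sup>2) + (sum b {..Suc N} + (p (N + 4) - p (N + 2)) * q (N + 2) * z (N + 2) * z (N + 4))
      - p (N + 4) * q (N + 2) * z (N + 2) * z (N + 4) - p (N + 3) * q (N + 1) * z (N + 1) * z (N + 3)"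
    unfolding j by algebra
  also have "\<dots> = sum a {..Suc (Suc N)} + sum b {..Suc (Suc N)} - p (Suc N + 3) * q (Suc N + 1) * z (Suc N + 1) * z (Suc N + 3) - p (Suc N + 2) * q (Suc N) * z (Suc N) * z (Suc N + 2)"
  proof -
    have "sum a {..Suc (Suc N)} = sum a {..Suc N} + p (N + 2) * (q (N + 2) - q N) * (z (N + 2))\<^sup>2"
      by (subst sum.atMost_Suc) (simp add: a_def)
    moreover have "sum b {..Suc (Suc N)} = sum b {..Suc N} + (p (N + 4) - p (N + 2)) * q (N + 2) * z (N + 2) * z (N + 4)"
      by (subst sum.atMost_Suc) (simp add: b_def n4)
    moreover have "Suc N + 3 = N + 4" "Suc N + 1 = N + 2" "Suc N + 2 = N + 3" "N + 1 = Suc N" by simp_all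
    ultimately show ?thesis by (simp only:)
  qed
  finally show ?case unfolding a_def b_def .
qed

section \<open>Gronwall's inequality and the energy estimate\<close>

lemma gronwall:
  fixes E :: "real \<Rightarrow> real"
  assumes der: "\<And>t. t \<in> {0..T} \<Longrightarrow> (E has_real_derivative E' t) (at t within {0..T})"
    and le: "\<And>t. t \<in> {0..T} \<Longrightarrow> E' t \<le> K * E t + \<delta>"
    and K: "0 \<le> K" and d: "0 \<le> \<delta>" and t: "t \<in> {0..T}"
  shows "E t \<le> exp (K * t) * (E 0 + \<delta> * t)"
proof -
  \<comment> \<open>\<open>G\<close> is nonincreasing, since exp (- K u) is at most 1 for u >=
    0.\<close>
  define G where "G u = exp (- K * u) * E u - \<delta> * u" for u
  have Gd: "(G has_real_derivative (exp (- K * u) * E' u - K * exp (- K * u) * E u - \<delta>)) (at u within {0..T})" if "u \<in> {0..T}" for u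
    unfolding G_def using that by (auto intro!: derivative_eq_intros der)
  have "G t \<le> G 0"
  proof (cases "t = 0")
    case False
    with t have t0: "0 < t" by auto
    have "\<exists>x\<in>{0<..<t}. G t - G 0 = (t - 0) * (exp (- K * x) * E' x - K * exp (- K * x) * E x - \<delta>)"
      using t t0 by (intro mvt_within[of _ _ "{0..T}"] Gd) auto
    then obtain x where x: "x \<in> {0<..<t}" and Gx: "G t - G 0 = t * (exp (- K * x) * E' x - K * exp (- K * x) * E x - \<delta>)" by auto
    have "exp (- K * x) * E' x - K * exp (- K * x) * E x - \<delta> \<le> exp (- K * x) * (K * E x + \<delta>) - K * exp (- K * x) * E x - \<delta>"
      using x t le[of x] by (intro diff_right_mono mult_left_mono) auto
    also have "\<dots> = \<delta> * (exp (- K * x) - 1)" by (simp add: algebra_simps)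
    also have "\<dots> \<le> 0" using d K x by (intro mult_nonneg_nonpos) auto
    finally have "t * (exp (- K * x) * E' x - K * exp (- K * x) * E x - \<delta>) \<le> 0"
      using t0 by (intro mult_nonneg_nonpos) auto
    then show ?thesis using Gx by linarith
  qed simp
  then have "exp (- K * t) * E t \<le> E 0 + \<delta> * t" by (simp add: G_def)
  then have "exp (K * t) * (exp (- K * t) * E t) \<le> exp (K * t) * (E 0 + \<delta> * t)" by (intro mult_left_mono) auto
  then show ?thesis by (simp add: exp_minus field_simps)
qed

text \<open>Linear growth and bounded increments are what the analysis of the flow rests on. The
  constants leave room: the coupling of the equation grows like k / 4.\<close>

definition jac_coupling :: "(nat \<Rightarrow> real) \<Rightarrow> bool" where
  "jac_coupling q \<longleftrightarrow> (\<forall>k. 0 \<le> q k \<and> q k \<le> real k + 1 \<and> \<bar>q (k + 2) - q k\<bar> \<le> 2)"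

lemma jac_couplingD:
  assumes "jac_coupling q"
  shows "0 \<le> q k" "q k \<le> real k + 1" "\<bar>q (k + 2) - q k\<bar> \<le> 2"
proof -
  have "0 \<le> q k \<and> q k \<le> real k + 1 \<and> \<bar>q (k + 2) - q k\<bar> \<le> 2"
    by (rule spec[OF assms[unfolded jac_coupling_def]])
  then show "0 \<le> q k" "q k \<le> real k + 1" "\<bar>q (k + 2) - q k\<bar> \<le> 2" by blast+
qed

lemma jac_coupling_diff:
  assumes "jac_coupling q" "k \<ge> 2"
  shows "\<bar>q k - q (k - 2)\<bar> \<le> 2"
proof -
  obtain j where "k = j + 2" using assms(2) by (metis add.commute le_Suc_ex)
  then show ?thesis using jac_couplingD(3)[OF assms(1), of j] by simp
qed

text \<open>Finite support removes the boundary terms of the identity. The diagonal contributes 2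
  through the increments of q, the weight increments contribute 9 ^ s.\<close>

lemma jac_energy_le:
  assumes q: "jac_coupling q" and z: "z 0 = 0" "z 1 = 0" and supp: "\<And>k. k > M \<Longrightarrow> z k = 0"
  shows "\<bar>\<Sum>k\<le>M. (real k + 1) ^ (2 * s) * z k * jac q z k\<bar> \<le> (2 + 9 ^ s) * (\<Sum>k\<le>M. wsq s z k)"
proof -
  define p where "p k = (real k + 1) ^ (2 * s)" for k
  have p0: "p k > 0" for k by (simp add: p_def add_pos_pos)
  have "(\<Sum>k\<le>M. p k * z k * jac q z k) = (\<Sum>k\<le>Suc M. p k * z k * jac q z k)" using supp by simp
  also have "\<dots> = (\<Sum>k\<le>Suc M. if k < 2 then 0 else p k * (q k - q (k - 2)) * (z k)\<^sup>2)
    + (\<Sum>k\<le>Suc M. (p (k + 2) - p k) * q k * z k * z (k + 2))"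
    unfolding jac_energy_identity[OF z] using supp by simp
  finally have "\<bar>\<Sum>k\<le>M. p k * z k * jac q z k\<bar> \<le>
     \<bar>\<Sum>k\<le>Suc M. if k < 2 then 0 else p k * (q k - q (k - 2)) * (z k)\<^sup>2\<bar> + \<bar>\<Sum>k\<le>Suc M. (p (k + 2) - p k) * q k * z k * z (k + 2)\<bar>"
    by linarith
  also have "\<bar>\<Sum>k\<le>Suc M. if k < 2 then 0 else p k * (q k - q (k - 2)) * (z k)\<^sup>2\<bar> \<le> (\<Sum>k\<le>Suc M. 2 * wsq s z k)"
  proof (rule order_trans[OF sum_abs], rule sum_mono)
    fix k
    show "\<bar>if k < 2 then 0 else p k * (q k - q (k - 2)) * (z k)\<^sup>2\<bar> \<le> 2 * wsq s z k"
    proof (cases "k < 2")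
      case False
      then have "p k * \<bar>q k - q (k - 2)\<bar> * (z k)\<^sup>2 \<le> p k * 2 * (z k)\<^sup>2"
        using jac_coupling_diff[OF q, of k] p0[of k] by (intro mult_right_mono mult_left_mono) auto
      then show ?thesis using False p0[of k] by (simp add: wsq_def p_def abs_mult)
    qed simp
  qed
  also have "\<bar>\<Sum>k\<le>Suc M. (p (k + 2) - p k) * q k * z k * z (k + 2)\<bar> \<le> (\<Sum>k\<le>Suc M. 9 ^ s / 2 * (wsq s z k + wsq s z (k + 2)))"
  proof (rule order_trans[OF sum_abs], rule sum_mono)
    fix k
    have m: "0 \<le> p (k + 2) - p k" unfolding p_def by (simp add: power_mono)
    have "\<bar>(p (k + 2) - p k) * q k * z k * z (k + 2)\<bar> = ((p (k + 2) - p k) * q k) * \<bar>z k * z (k + 2)\<bar>"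
      using m jac_couplingD(1,2)[OF q, of k] by (simp add: abs_mult)
    also have "\<dots> \<le> ((p (k + 2) - p k) * (real k + 1)) * \<bar>z k * z (k + 2)\<bar>"
      using m jac_couplingD(1,2)[OF q, of k] by (intro mult_right_mono mult_left_mono) auto
    also have "\<dots> \<le> (9 ^ s * p k) * \<bar>z k * z (k + 2)\<bar>"
      using weight_increment_le[of k s] unfolding p_def by (intro mult_right_mono) (auto simp: algebra_simps)
    also have "\<dots> \<le> (9 ^ s * p k) * ((z k)\<^sup>2 / 2 + (z (k + 2))\<^sup>2 / 2)"
    proof (rule mult_left_mono)
      show "\<bar>z k * z (k + 2)\<bar> \<le> (z k)\<^sup>2 / 2 + (z (k + 2))\<^sup>2 / 2"
        using sum_squares_bound[of "\<bar>z k\<bar>" "\<bar>z (k+2)\<bar>"] by (simp add: abs_mult)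
    qed (use p0[of k] in simp)
    also have "\<dots> \<le> 9 ^ s / 2 * (wsq s z k + wsq s z (k + 2))"
    proof -
      have "p k * (z (k + 2))\<^sup>2 \<le> p (k + 2) * (z (k + 2))\<^sup>2" using m by (intro mult_right_mono) auto
      then have "9 ^ s / 2 * (p k * (z k)\<^sup>2 + p k * (z (k + 2))\<^sup>2) \<le> 9 ^ s / 2 * (p k * (z k)\<^sup>2 + p (k + 2) * (z (k + 2))\<^sup>2)"
        by (intro mult_left_mono add_left_mono) auto
      then show ?thesis unfolding wsq_def p_def by (simp add: algebra_simps)
    qed
    finally show "\<bar>(p (k + 2) - p k) * q k * z k * z (k + 2)\<bar> \<le> 9 ^ s / 2 * (wsq s z k + wsq s z (k + 2))" .
  qed
  also have "(\<Sum>k\<le>Suc M. 2 * wsq s z k) = 2 * (\<Sum>k\<le>M. wsq s z k)"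
    using supp[of "Suc M"] by (simp add: sum_distrib_left wsq_def)
  also have "(\<Sum>k\<le>Suc M. 9 ^ s / 2 * (wsq s z k + wsq s z (k + 2))) \<le> 9 ^ s * (\<Sum>k\<le>M. wsq s z k)"
  proof -
    have w0: "wsq s z k = 0" if "k > M" for k using supp[OF that] by (simp add: wsq_def)
    have "(\<Sum>k\<le>Suc M. wsq s z (k + 2)) = (\<Sum>k\<in>{2..M+3}. wsq s z k)"
      by (rule sum.reindex_bij_witness[of _ "\<lambda>k. k - 2" "\<lambda>k. k + 2"]) auto
    also have "\<dots> \<le> (\<Sum>k\<le>M+3. wsq s z k)" by (intro sum_mono2) auto
    also have "\<dots> = (\<Sum>k\<le>M. wsq s z k)" by (intro sum.mono_neutral_right) (auto simp: w0)
    finally have "(\<Sum>k\<le>Suc M. wsq s z (k + 2)) \<le> (\<Sum>k\<le>M. wsq s z k)" .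
    moreover have "(\<Sum>k\<le>Suc M. wsq s z k) = (\<Sum>k\<le>M. wsq s z k)" by (simp add: w0)
    ultimately have "9 ^ s / 2 * ((\<Sum>k\<le>Suc M. wsq s z k) + (\<Sum>k\<le>Suc M. wsq s z (k + 2))) \<le> 9 ^ s / 2 * ((\<Sum>k\<le>M. wsq s z k) + (\<Sum>k\<le>M. wsq s z k))"
      by (intro mult_left_mono) auto
    moreover have "(\<Sum>k\<le>Suc M. 9 ^ s / 2 * (wsq s z k + wsq s z (k + 2))) = 9 ^ s / 2 * ((\<Sum>k\<le>Suc M. wsq s z k) + (\<Sum>k\<le>Suc M. wsq s z (k + 2)))"
      by (simp only: sum_distrib_left[symmetric] sum.distrib)
    moreover have "9 ^ s / 2 * ((\<Sum>k\<le>M. wsq s z k) + (\<Sum>k\<le>M. wsq s z k)) = 9 ^ s * (\<Sum>k\<le>M. wsq s z k)"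
      by simp
    ultimately show ?thesis by (simp only:)
  qed
  finally show ?thesis unfolding p_def by (simp add: algebra_simps)
qed

section \<open>Solving the Jacobi system by truncation\<close>

lemma jac_sums:
  assumes "\<And>k. (\<lambda>n. x n k) sums f k"
  shows "(\<lambda>n. jac q (x n) k) sums jac q f k"
  unfolding jac_def using assms by (auto intro!: sums_add sums_diff sums_mult)

lemma jac_scale: "jac q (\<lambda>k. a * x k) k = a * jac q x k"
  by (simp add: jac_def algebra_simps)

lemma jac_diff: "jac q (\<lambda>k. x k - y k) k = jac q x k - jac q y k"
  by (simp add: jac_def algebra_simps)

text \<open>A bound in the supremum norm. Its growth in k is harmless because it is applied to rows
  up to a fixed N or to one fixed row.\<close>

lemma jac_bounded_le:
  assumes "jac_coupling q" "\<And>k. \<bar>x k\<bar> \<le> S"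
  shows "\<bar>jac q x k\<bar> \<le> (2 * real k + 4) * S"
proof (cases "k < 2")
  case True
  then show ?thesis using assms(2)[of 0] by (auto simp: jac_def)
next
  case False
  have S: "0 \<le> S" using assms(2)[of 0] by linarith
  have "\<bar>q (k - 2) * x (k - 2)\<bar> \<le> (real k + 1) * S"
    unfolding abs_mult using jac_couplingD(1,2)[OF assms(1), of "k - 2"] assms(2) S by (intro mult_mono) auto
  moreover have "\<bar>(q k - q (k - 2)) * x k\<bar> \<le> 2 * S"
    unfolding abs_mult using jac_coupling_diff[OF assms(1), of k] False assms(2) S by (intro mult_mono) auto
  moreover have "\<bar>q k * x (k + 2)\<bar> \<le> (real k + 1) * S"
    unfolding abs_mult using jac_couplingD(1,2)[OF assms(1), of k] assms(2) S by (intro mult_mono) auto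
  moreover have "(2 * real k + 4) * S = (real k + 1) * S + 2 * S + (real k + 1) * S" by (simp add: algebra_simps)
  moreover have "jac q x k = q (k - 2) * x (k - 2) + (q k - q (k - 2)) * x k - q k * x (k + 2)"
    using False by (simp add: jac_def)
  ultimately show ?thesis by linarith
qed

text \<open>A finite linear system, solved by the exponential series of its matrix. Each coordinate
  is written as a power series in t, so that termwise differentiation is available.\<close>

lemma galerkin_solution:
  assumes q: "jac_coupling q" and c0: "\<And>k. k > N \<Longrightarrow> c0 k = 0"
  obtains c where "c 0 = c0" "\<And>t k. k > N \<Longrightarrow> c t k = 0"
    "\<And>t k. k \<le> N \<Longrightarrow> ((\<lambda>t. c t k) has_real_derivative - jac q (c t) k) (at t)"
proof -
  \<comment> \<open>\<open>B\<close> is minus the truncated matrix, \<open>x n\<close> its n-th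
    power applied to the data, and \<open>M\<close> a bound for it in the supremum norm.\<close>
  define B where "B x k = (if k \<le> N then - jac q x k else 0)" for x k
  define M where "M = 2 * real N + 4"
  define S where "S = (\<Sum>k\<le>N. \<bar>c0 k\<bar>)"
  define x where "x n = (B ^^ n) c0" for n
  have S: "\<bar>c0 k\<bar> \<le> S" for k
  proof (cases "k \<le> N")
    case True
    then show ?thesis unfolding S_def using member_le_sum[of k "{..N}" "\<lambda>k. \<bar>c0 k\<bar>"] by simp
  qed (use c0 in \<open>simp add: S_def sum_nonneg\<close>)
  have S0: "0 \<le> S" by (simp add: S_def sum_nonneg)
  have xS: "\<bar>x n k\<bar> \<le> S * M ^ n" for n k
  proof (induction n arbitrary: k)
    case (Suc n)
    have "\<bar>B (x n) k\<bar> \<le> M * (S * M ^ n)"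
    proof (cases "k \<le> N")
      case True
      have "\<bar>jac q (x n) k\<bar> \<le> (2 * real k + 4) * (S * M ^ n)" by (rule jac_bounded_le[OF q Suc])
      also have "\<dots> \<le> M * (S * M ^ n)"
        using True S0 by (intro mult_right_mono) (auto simp: M_def)
      finally show ?thesis using True by (simp add: B_def)
    qed (use S0 in \<open>simp add: B_def M_def\<close>)
    then show ?case by (simp add: x_def algebra_simps)
  qed (use S in \<open>simp add: x_def\<close>)
  have summ: "summable (\<lambda>n. x n k / fact n * t ^ n)" for t :: real and k
  proof (rule summable_comparison_test'[of "\<lambda>n. S * (inverse (fact n) * (M * \<bar>t\<bar>) ^ n)" 0])
    show "summable (\<lambda>n. S * (inverse (fact n) * (M * \<bar>t\<bar>) ^ n))"
      by (intro summable_mult summable_exp)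
    fix n :: nat
    have "\<bar>x n k\<bar> * \<bar>t\<bar> ^ n / fact n \<le> (S * M ^ n) * \<bar>t\<bar> ^ n / fact n"
      by (intro divide_right_mono mult_right_mono xS) auto
    then show "norm (x n k / fact n * t ^ n) \<le> S * (inverse (fact n) * (M * \<bar>t\<bar>) ^ n)"
      by (simp add: abs_mult power_abs power_mult_distrib field_simps)
  qed
  define c where "c t k = (\<Sum>n. x n k / fact n * t ^ n)" for t k
  show ?thesis
  proof (rule that[of c])
    show "c 0 = c0" unfolding c_def
    proof
      fix k
      show "(\<Sum>n. x n k / fact n * 0 ^ n) = c0 k"
        by (subst powser_zero) (simp add: x_def)
    qed
  next
    fix t :: real and k assume k: "k > N"
    have "x n k = 0" for n by (cases n) (use k c0 in \<open>auto simp: x_def B_def\<close>)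
    then show "c t k = 0" by (simp add: c_def)
  next
    fix t :: real and k assume k: "k \<le> N"
    have D: "((\<lambda>t. \<Sum>n. x n k / fact n * t ^ n) has_field_derivative (\<Sum>n. diffs (\<lambda>n. x n k / fact n) n * t ^ n)) (at t)"
      by (rule termdiffs_strong_converges_everywhere) (rule summ)
    have "(\<lambda>n. jac q (\<lambda>k. x n k / fact n * t ^ n) k) sums jac q (c t) k"
      by (rule jac_sums) (use summ in \<open>auto simp: c_def\<close>)
    moreover have "- jac q (\<lambda>k. x n k / fact n * t ^ n) k = diffs (\<lambda>n. x n k / fact n) n * t ^ n" for n
    proof -
      have "jac q (\<lambda>k. x n k / fact n * t ^ n) k = t ^ n / fact n * jac q (x n) k"
        using jac_scale[of q "t ^ n / fact n" "x n" k] by (simp add: mult.commute)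
      moreover have "x (Suc n) k = - jac q (x n) k" using k by (simp add: x_def B_def)
      ultimately show ?thesis by (simp add: diffs_def field_simps del: of_nat_Suc)
    qed
    ultimately have "(\<lambda>n. diffs (\<lambda>n. x n k / fact n) n * t ^ n) sums - jac q (c t) k"
      using sums_minus by fastforce
    then show "((\<lambda>t. c t k) has_real_derivative - jac q (c t) k) (at t)"
      using D sums_unique[of "\<lambda>n. diffs (\<lambda>n. x n k / fact n) n * t ^ n"] unfolding c_def by simp
  qed
qed

text \<open>Couplings of linear growth cost one power of k, so weight s on the output asks for
  weight s + 1 on the input. Each time derivative of a solution therefore loses one power.\<close>

lemma jac_wsq_le:
  assumes q: "jac_coupling q"
  shows "wsq s (jac q x) k \<le> (3 * 9 ^ s + 12) * (wsq (Suc s) x (k - 2) + wsq (Suc s) x (k - 1) + wsq (Suc s) x k + wsq (Suc s) x (k + 1) + wsq (Suc s) x (k + 2))"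
proof (cases "k < 2")
  case True
  then show ?thesis by (auto simp: jac_def wsq_def intro!: mult_nonneg_nonneg add_nonneg_nonneg)
next
  case False
  then obtain j where k: "k = j + 2" by (metis add.commute le_Suc_ex not_less)
  define p where "p = (real k + 1) ^ (2 * s)"
  have p0: "p \<ge> 0" by (simp add: p_def)
  define A where "A = q j * x j"
  define B where "B = (q k - q j) * x k"
  define D where "D = q k * x (k + 2)"
  have jac: "jac q x k = A + B - D" by (simp add: jac_def k A_def B_def D_def)
  define X where "X = p * (A + B - D)\<^sup>2"
  have "X \<le> p * (3 * A\<^sup>2 + 3 * B\<^sup>2 + 3 * D\<^sup>2)"
    unfolding X_def
  proof (rule mult_left_mono[OF _ p0])
    have "0 \<le> (A - B)\<^sup>2 + (A + D)\<^sup>2 + (B + D)\<^sup>2" by simp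
    then show "(A + B - D)\<^sup>2 \<le> 3 * A\<^sup>2 + 3 * B\<^sup>2 + 3 * D\<^sup>2" by (simp add: power2_eq_square algebra_simps)
  qed
  moreover have "p * (3 * A\<^sup>2 + 3 * B\<^sup>2 + 3 * D\<^sup>2) = 3 * (p * A\<^sup>2) + 3 * (p * B\<^sup>2) + 3 * (p * D\<^sup>2)"
    by (simp add: algebra_simps)
  moreover have "p * A\<^sup>2 \<le> 9 ^ s * wsq (Suc s) x j"
  proof -
    have "A\<^sup>2 \<le> (real j + 1)\<^sup>2 * (x j)\<^sup>2"
      unfolding A_def power_mult_distrib using jac_couplingD(1,2)[OF q, of j] by (intro mult_right_mono power_mono) auto
    moreover have "p \<le> 9 ^ s * (real j + 1) ^ (2 * s)" using weight_shift_le[of j s] by (simp add: p_def k add.commute)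
    ultimately have "p * A\<^sup>2 \<le> (9 ^ s * (real j + 1) ^ (2 * s)) * ((real j + 1)\<^sup>2 * (x j)\<^sup>2)"
      by (intro mult_mono) auto
    then show ?thesis by (simp add: wsq_def power_add power2_eq_square mult_ac)
  qed
  moreover have "p * B\<^sup>2 \<le> 4 * wsq (Suc s) x k"
  proof -
    have "\<bar>q k - q j\<bar> \<le> 2" using jac_couplingD(3)[OF q, of j] k by simp
    then have "(q k - q j)\<^sup>2 \<le> 2\<^sup>2" by (metis abs_le_square_iff abs_numeral)
    then have "B\<^sup>2 \<le> 4 * (x k)\<^sup>2"
      unfolding B_def power_mult_distrib by (intro mult_right_mono) auto
    then have "p * B\<^sup>2 \<le> p * (4 * (x k)\<^sup>2)" using p0 by (rule mult_left_mono)
    also have "\<dots> = 4 * wsq s x k" by (simp add: p_def wsq_def)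
    also have "\<dots> \<le> 4 * wsq (Suc s) x k" by (simp add: wsq_mono)
    finally show ?thesis .
  qed
  moreover have "p * D\<^sup>2 \<le> wsq (Suc s) x (k + 2)"
  proof -
    have "D\<^sup>2 \<le> (real k + 1)\<^sup>2 * (x (k + 2))\<^sup>2"
      unfolding D_def power_mult_distrib using jac_couplingD(1,2)[OF q, of k] by (intro mult_right_mono power_mono) auto
    then have "p * D\<^sup>2 \<le> p * ((real k + 1)\<^sup>2 * (x (k + 2))\<^sup>2)" using p0 by (rule mult_left_mono)
    also have "\<dots> = (real k + 1) ^ (2 * Suc s) * (x (k + 2))\<^sup>2" by (simp add: p_def power_add power2_eq_square mult_ac)
    also have "\<dots> \<le> (real (k + 2) + 1) ^ (2 * Suc s) * (x (k + 2))\<^sup>2"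
      by (intro mult_right_mono power_mono) auto
    finally show ?thesis by (simp add: wsq_def)
  qed
  ultimately have "wsq s (jac q x) k \<le> 3 * (9 ^ s * wsq (Suc s) x j) + 3 * (4 * wsq (Suc s) x k) + 3 * wsq (Suc s) x (k + 2)"
    unfolding wsq_def[of s "jac q x"] jac p_def[symmetric] X_def[symmetric] by linarith
  also have "\<dots> \<le> (3 * 9 ^ s + 12) * wsq (Suc s) x j + (3 * 9 ^ s + 12) * wsq (Suc s) x k + (3 * 9 ^ s + 12) * wsq (Suc s) x (k + 2)"
  proof (intro add_mono)
    show "3 * (9 ^ s * wsq (Suc s) x j) \<le> (3 * 9 ^ s + 12) * wsq (Suc s) x j" by (simp add: algebra_simps)
    show "3 * (4 * wsq (Suc s) x k) \<le> (3 * 9 ^ s + 12) * wsq (Suc s) x k" by (simp add: algebra_simps)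
    have "(3::real) \<le> 3 * 9 ^ s + 12" by (simp add: add_increasing)
    then show "3 * wsq (Suc s) x (k + 2) \<le> (3 * 9 ^ s + 12) * wsq (Suc s) x (k + 2)" by (intro mult_right_mono) auto
  qed
  also have "\<dots> = (3 * 9 ^ s + 12) * (wsq (Suc s) x (k - 2) + wsq (Suc s) x k + wsq (Suc s) x (k + 2))"
    by (simp add: k algebra_simps)
  also have "\<dots> \<le> (3 * 9 ^ s + 12) * (wsq (Suc s) x (k - 2) + wsq (Suc s) x (k - 1) + wsq (Suc s) x k + wsq (Suc s) x (k + 1) + wsq (Suc s) x (k + 2))"
    using wsq_nonneg[of "Suc s" x "k - 1"] wsq_nonneg[of "Suc s" x "k + 1"]
    by (intro mult_left_mono) (linarith, simp)
  finally show ?thesis .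
qed

lemma hcont_jac:
  assumes "jac_coupling q" "hcont (Suc s) T c"
  shows "hcont s T (\<lambda>t. jac q (c t))"
  by (rule hcont_map[OF assms(2) jac_diff jac_wsq_le[OF assms(1)]]) simp

lemma hcont_uminus: "hcont s T c \<Longrightarrow> hcont s T (\<lambda>t k. - c t k)"
proof (rule hcont_map[where \<Phi> = "\<lambda>x k. - x k" and C = 1])
  fix x k show "wsq s (\<lambda>k. - x k) k \<le> 1 * (wsq s x (k - 2) + wsq s x (k - 1) + wsq s x k + wsq s x (k + 1) + wsq s x (k + 2))"
    using wsq_nonneg[of s x "k - 2"] wsq_nonneg[of s x "k - 1"] wsq_nonneg[of s x "k + 1"] wsq_nonneg[of s x "k + 2"]
    by (simp add: wsq_def)
qed auto

lemma energy_derivative: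
  assumes "\<And>k. k \<le> M \<Longrightarrow> ((\<lambda>t. z t k) has_real_derivative z' k) (at t within S)"
  shows "((\<lambda>t. \<Sum>k\<le>M. wsq s (z t) k) has_real_derivative (\<Sum>k\<le>M. 2 * ((real k + 1) ^ (2 * s) * z t k * z' k))) (at t within S)"
  unfolding wsq_def using assms by (auto intro!: derivative_eq_intros sum.cong)

text \<open>The forcing enters through 2 z r <= z^2 + r^2, which adds 1 to twice the constant of
  \<open>jac_energy_le\<close>: 5 + 2 * 9 ^ s = 2 * (2 + 9 ^ s) + 1. It serves both for one
  approximation, with r = 0, and for the difference of two.\<close>

lemma jac_flow_energy:
  assumes q: "jac_coupling q" and T: "t \<in> {0..T}"
    and z01: "\<And>t. t \<in> {0..T} \<Longrightarrow> z t 0 = 0" "\<And>t. t \<in> {0..T} \<Longrightarrow> z t 1 = 0"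
    and supp: "\<And>t k. t \<in> {0..T} \<Longrightarrow> k > M \<Longrightarrow> z t k = 0"
    and der: "\<And>t k. t \<in> {0..T} \<Longrightarrow> k \<le> M \<Longrightarrow> ((\<lambda>t. z t k) has_real_derivative - jac q (z t) k + r t k) (at t within {0..T})"
    and r: "\<And>t. t \<in> {0..T} \<Longrightarrow> (\<Sum>k\<le>M. wsq s (r t) k) \<le> \<delta>"
  shows "(\<Sum>k\<le>M. wsq s (z t) k) \<le> exp ((5 + 2 * 9 ^ s) * T) * ((\<Sum>k\<le>M. wsq s (z 0) k) + \<delta> * T)"
proof -
  define E where "E t = (\<Sum>k\<le>M. wsq s (z t) k)" for t
  define E' where "E' t = (\<Sum>k\<le>M. 2 * ((real k + 1) ^ (2 * s) * z t k * (- jac q (z t) k + r t k)))" for t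
  have E0: "0 \<le> E t" for t by (simp add: E_def sum_nonneg)
  have d0: "0 \<le> \<delta>" using r[OF T] sum_nonneg[of "{..M}" "wsq s (r t)"] by fastforce
  have le: "E' t \<le> (5 + 2 * 9 ^ s) * E t + \<delta>" if t: "t \<in> {0..T}" for t
  proof -
    have "E' t = - 2 * (\<Sum>k\<le>M. (real k + 1) ^ (2 * s) * z t k * jac q (z t) k) + (\<Sum>k\<le>M. (real k + 1) ^ (2 * s) * (2 * z t k * r t k))"
      unfolding E'_def sum_distrib_left sum.distrib[symmetric] by (intro sum.cong) (auto simp: algebra_simps)
    also have "\<dots> \<le> 2 * ((2 + 9 ^ s) * E t) + (\<Sum>k\<le>M. wsq s (z t) k + wsq s (r t) k)"
    proof (rule add_mono)
      show "- 2 * (\<Sum>k\<le>M. (real k + 1) ^ (2 * s) * z t k * jac q (z t) k) \<le> 2 * ((2 + 9 ^ s) * E t)"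
      proof -
        have "\<bar>\<Sum>k\<le>M. (real k + 1) ^ (2 * s) * z t k * jac q (z t) k\<bar> \<le> (2 + 9 ^ s) * E t"
          unfolding E_def by (rule jac_energy_le[OF q z01(1)[OF t] z01(2)[OF t]]) (rule supp[OF t])
        then show ?thesis by linarith
      qed
      show "(\<Sum>k\<le>M. (real k + 1) ^ (2 * s) * (2 * z t k * r t k)) \<le> (\<Sum>k\<le>M. wsq s (z t) k + wsq s (r t) k)"
        unfolding wsq_def distrib_left[symmetric]
        by (intro sum_mono mult_left_mono sum_squares_bound) auto
    qed
    also have "\<dots> \<le> (5 + 2 * 9 ^ s) * E t + \<delta>"
      using r[OF t] by (simp add: sum.distrib E_def algebra_simps)
    finally show ?thesis .
  qed
  have "E t \<le> exp ((5 + 2 * 9 ^ s) * t) * (E 0 + \<delta> * t)"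
  proof (rule gronwall[OF _ le _ d0 T])
    fix t assume "t \<in> {0..T}"
    then show "(E has_real_derivative E' t) (at t within {0..T})"
      unfolding E_def E'_def by (intro energy_derivative der)
  qed auto
  also have "\<dots> \<le> exp ((5 + 2 * 9 ^ s) * T) * (E 0 + \<delta> * T)"
  proof (rule mult_mono)
    have "(5 + 2 * 9 ^ s) * t \<le> (5 + 2 * 9 ^ s) * T" using T by (intro mult_left_mono add_nonneg_nonneg) auto
    then show "exp ((5 + 2 * 9 ^ s) * t) \<le> exp ((5 + 2 * 9 ^ s) * T)" by simp
    show "E 0 + \<delta> * t \<le> E 0 + \<delta> * T" using T d0 by (intro add_left_mono mult_left_mono) auto
  qed (use T d0 E0[of 0] in auto)
  finally show ?thesis unfolding E_def .
qed

text \<open>The approximations solve the system truncated at level \<open>(n + 1)\<^sup>3\<close> from data truncated at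
  level \<open>n\<close>: truncating the system much later than the data makes the truncation error small,
  although the data only lie in the weighted space itself.\<close>

lemma jac_solution_exists:
  assumes q: "jac_coupling q" and c0: "summable (wsq s c0)" "c0 0 = 0" "c0 1 = 0" and T: "0 \<le> T"
  obtains c where "c 0 = c0" "\<And>t. t \<in> {0..T} \<Longrightarrow> c t 0 = 0 \<and> c t 1 = 0" "hcont s T c"
    "\<And>t k. t \<in> {0..T} \<Longrightarrow> ((\<lambda>r. c r k) has_real_derivative - jac q (c t) k) (at t within {0..T})"
proof -
  \<comment> \<open>Any exponent above 2 would do: the squared residual of the truncated system is
    of order (n + 1)^4 / (N n)^2, here (n + 1)^(-2).\<close>
  define N where "N n = (n + 1) ^ 3" for n :: nat
  define init where "init n k = (if k \<le> n then c0 k else 0)" for n k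
  have Nn: "n < N n" for n
  proof -
    have "n + 1 \<le> (n + 1) ^ 3" by (rule self_le_power) auto
    then show ?thesis by (simp add: N_def)
  qed
  have Nmono: "n \<le> n' \<Longrightarrow> N n \<le> N n'" for n n' unfolding N_def by (intro power_mono) auto
  have "\<exists>c. c 0 = init n \<and> (\<forall>t. \<forall>k>N n. c t k = 0) \<and>
     (\<forall>t. \<forall>k\<le>N n. ((\<lambda>t. c t k) has_real_derivative - jac q (c t) k) (at t))" for n
  proof -
    have i0: "init n k = 0" if "k > N n" for k using that Nn[of n] by (simp add: init_def)
    from galerkin_solution[OF q, of "N n" "init n", OF i0] obtain c where
      "c 0 = init n" "\<And>t k. k > N n \<Longrightarrow> c t k = 0" "\<And>t k. k \<le> N n \<Longrightarrow> ((\<lambda>t. c t k) has_real_derivative - jac q (c t) k) (at t)"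
      by blast
    then show ?thesis by blast
  qed
  then obtain u where u0: "\<And>n. u n 0 = init n" and us: "\<And>n t k. k > N n \<Longrightarrow> u n t k = 0"
    and ud: "\<And>n t k. k \<le> N n \<Longrightarrow> ((\<lambda>t. u n t k) has_real_derivative - jac q (u n t) k) (at t)"
    by metis
  have u01: "u n t k = 0" if k: "k < 2" for n t k
  proof -
    have "k \<le> N n" using k Nn[of n] by (cases n) (auto simp: N_def)
    from ud[OF this] have "\<And>t. ((\<lambda>t. u n t k) has_real_derivative 0) (at t)" using k by (simp add: jac_def)
    then have "u n t k = u n 0 k" by (intro DERIV_isconst_all) auto
    then show ?thesis using k c0 u0[of n] less_2_cases[OF k] by (auto simp: init_def)
  qed
  have udw: "((\<lambda>t. u n t k) has_real_derivative - jac q (u n t) k) (at t within {0..T})" if "k \<le> N n" for n t k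
    using ud[OF that] by (rule has_field_derivative_at_within)
  define S where "S = suminf (wsq s c0)"
  have S0: "0 \<le> S" unfolding S_def by (intro suminf_nonneg c0) auto
  \<comment> \<open>On data supported up to n, two extra powers of the weight cost (n + 1)^2, which
    appears squared.\<close>
  have init_le: "(\<Sum>k\<le>N n. wsq (s + 2) (init n) k) \<le> (real n + 1) ^ 4 * S" for n
  proof -
    have "(\<Sum>k\<le>N n. wsq (s + 2) (init n) k) \<le> (\<Sum>k\<le>N n. (real n + 1) ^ 4 * wsq s c0 k)"
    proof (rule sum_mono)
      fix k
      show "wsq (s + 2) (init n) k \<le> (real n + 1) ^ 4 * wsq s c0 k"
      proof (cases "k \<le> n")
        case True
        then have "(real k + 1) ^ 4 * wsq s c0 k \<le> (real n + 1) ^ 4 * wsq s c0 k"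
          by (intro mult_right_mono power_mono) auto
        then show ?thesis using True by (simp add: wsq_def init_def power_add power4_eq_xxxx mult_ac)
      qed (simp add: init_def wsq_def)
    qed
    also have "\<dots> = (real n + 1) ^ 4 * (\<Sum>k\<le>N n. wsq s c0 k)" by (simp add: sum_distrib_left)
    also have "\<dots> \<le> (real n + 1) ^ 4 * S"
      unfolding S_def using c0 by (intro mult_left_mono sum_le_suminf) auto
    finally show ?thesis .
  qed
  define C where "C = 8 * 9 ^ s * exp ((5 + 2 * 9 ^ (s + 2)) * T) * S"
  define \<delta> where "\<delta> n = C / (real n + 1)\<^sup>2" for n
  define tail where "tail n = S - (\<Sum>k\<le>n. wsq s c0 k)" for n
  define \<epsilon> where "\<epsilon> n = exp ((5 + 2 * 9 ^ s) * T) * (tail n + \<delta> n * T)" for n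
  have high: "(\<Sum>k\<le>N n. wsq (s + 2) (u n t) k) \<le> exp ((5 + 2 * 9 ^ (s + 2)) * T) * ((real n + 1) ^ 4 * S)"
    if t: "t \<in> {0..T}" for n t
  proof -
    have "(\<Sum>k\<le>N n. wsq (s + 2) (u n t) k) \<le> exp ((5 + 2 * 9 ^ (s + 2)) * T) * ((\<Sum>k\<le>N n. wsq (s + 2) (u n 0) k) + 0 * T)"
      by (rule jac_flow_energy[OF q t, where r = "\<lambda>_ _. 0"]) (use u01 us udw in \<open>auto simp: wsq_def\<close>)
    also have "\<dots> \<le> exp ((5 + 2 * 9 ^ (s + 2)) * T) * ((real n + 1) ^ 4 * S)"
      using init_le[of n] by (simp add: u0)
    finally show ?thesis .
  qed
  \<comment> \<open>Only rows \<open>N n + 1\<close> and \<open>N n + 2\<close> of the residual can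
    be nonzero: there the full matrix acts on a vector cut off at \<open>N n\<close>.\<close>
  define r where "r n t k = (if k \<le> N n then 0 else - jac q (u n t) k)" for n t k
  have r_le: "(\<Sum>k\<le>M. wsq s (r n t) k) \<le> \<delta> n" if t: "t \<in> {0..T}" for n t M
  proof -
    define f where "f = wsq (s + 2) (u n t)"
    have fs: "summable f" "suminf f = (\<Sum>k\<le>N n. f k)"
    proof -
      have f0: "f k = 0" if "k \<notin> {..N n}" for k using that us[where n = n] by (simp add: f_def wsq_def not_le)
      show "summable f" by (rule summable_finite[of "{..N n}"]) (use f0 in auto)
      show "suminf f = (\<Sum>k\<le>N n. f k)" by (rule suminf_finite) (use f0 in auto)
    qed
    have N1: "1 \<le> real (N n)" using Nn[of n] by simp
    define D where "D = 9 ^ s / (real (N n))\<^sup>2"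
    have D0: "D \<ge> 0" by (simp add: D_def)
    have bd: "wsq s (r n t) k \<le> D * (f (k - 2) + f (k - 1) + f k + f (k + 1) + f (k + 2))" for k
    proof (cases "k \<le> N n")
      case True
      then show ?thesis using D0 by (simp add: r_def wsq_def f_def)
    next
      case False
      then have "k \<ge> 2" using N1 by linarith
      then obtain j where k: "k = j + 2" by (metis add.commute le_Suc_ex)
      have rk: "r n t k = - (q j * u n t j)" using False by (simp add: r_def jac_def k us)
      \<comment> \<open>Of the two extra powers of j + 1, one pays for the coupling
        \<open>q j\<close>, and the other, being at least N n, is turned into the gain 1 / N
        n.\<close>
      have Nj: "real (N n) \<le> real j + 1" using False k by linarith
      have "wsq s (r n t) k = (real j + 3) ^ (2 * s) * ((q j)\<^sup>2 * (u n t j)\<^sup>2)"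
        unfolding wsq_def rk by (simp add: k power_mult_distrib add.commute)
      also have "\<dots> \<le> (9 ^ s * (real j + 1) ^ (2 * s)) * ((real j + 1)\<^sup>2 * (u n t j)\<^sup>2)"
        using jac_couplingD(1,2)[OF q, of j]
        by (intro mult_mono weight_shift_le power_mono mult_right_mono mult_nonneg_nonneg) auto
      also have "\<dots> = 9 ^ s / (real (N n))\<^sup>2 * ((real j + 1) ^ (2 * s) * (real j + 1)\<^sup>2 * (u n t j)\<^sup>2 * (real (N n))\<^sup>2)"
        using N1 by (simp add: field_simps)
      also have "\<dots> \<le> 9 ^ s / (real (N n))\<^sup>2 * ((real j + 1) ^ (2 * s) * (real j + 1)\<^sup>2 * (u n t j)\<^sup>2 * (real j + 1)\<^sup>2)"
        using Nj by (intro mult_left_mono power_mono) auto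
      also have "\<dots> = D * f (k - 2)" by (simp add: D_def f_def wsq_def k power_add power2_eq_square power4_eq_xxxx mult_ac)
      also have "\<dots> \<le> D * (f (k - 2) + f (k - 1) + f k + f (k + 1) + f (k + 2))"
        using D0 by (intro mult_left_mono) (auto simp: f_def add_nonneg_nonneg)
      finally show ?thesis .
    qed
    note sc = shift_comparison[of f "wsq s (r n t)" D, OF _ fs(1) _ bd D0]
    have "(\<Sum>k\<le>M. wsq s (r n t) k) \<le> suminf (wsq s (r n t))"
      by (intro sum_le_suminf sc) (auto simp: f_def)
    also have "\<dots> \<le> 8 * D * suminf f" by (intro sc) (auto simp: f_def)
    also have "\<dots> \<le> 8 * D * (exp ((5 + 2 * 9 ^ (s + 2)) * T) * ((real n + 1) ^ 4 * S))"
      unfolding fs(2) using high[OF t, of n] D0 by (intro mult_left_mono) (auto simp: f_def)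
    also have "\<dots> = \<delta> n"
    proof -
      define y where "y = real n + 1"
      have "y > 0" by (simp add: y_def)
      have N6: "(real (N n))\<^sup>2 = y ^ 4 * y\<^sup>2"
        by (simp add: N_def y_def add.commute flip: power_mult power_add)
      have "8 * (a / (y ^ 4 * y\<^sup>2)) * (b * (y ^ 4 * S)) = 8 * a * b * S / y\<^sup>2" for a b
        using \<open>y > 0\<close> by (simp add: divide_simps)
      then show ?thesis unfolding D_def \<delta>_def C_def y_def[symmetric] N6 .
    qed
    finally show ?thesis .
  qed
  \<comment> \<open>The difference of two approximations solves the larger truncated system, with
    the residual of the smaller one as forcing and the data between n and n' as initial
    value.\<close>
  have cauchy: "(\<Sum>k<L. wsq s (\<lambda>k. u n' t k - u n t k) k) \<le> \<epsilon> n" if t: "t \<in> {0..T}" and nn: "n \<le> n'" for n n' t L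
  proof -
    define z where "z = (\<lambda>t k. u n' t k - u n t k)"
    have zs: "z t k = 0" if "k > N n'" for t k using us that Nmono[OF nn] by (simp add: z_def)
    have zd: "((\<lambda>t. z t k) has_real_derivative - jac q (z t) k + r n t k) (at t within {0..T})" if k: "k \<le> N n'" for t k
    proof -
      have j: "jac q (z t) k = jac q (u n' t) k - jac q (u n t) k"
        using jac_diff[of q "u n' t" "u n t" k] by (simp add: z_def)
      show ?thesis
      proof (cases "k \<le> N n")
        case True
        have "((\<lambda>t. z t k) has_real_derivative - jac q (u n' t) k - (- jac q (u n t) k)) (at t within {0..T})"
          unfolding z_def by (intro DERIV_diff udw True k)
        then show ?thesis using True by (simp add: j r_def)
      next
        case False
        then have "(\<lambda>t. z t k) = (\<lambda>t. u n' t k)" by (auto simp: z_def us)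
        then show ?thesis using udw[OF k, of t] False by (simp add: j r_def)
      qed
    qed
    have "(\<Sum>k\<le>N n'. wsq s (z t) k) \<le> exp ((5 + 2 * 9 ^ s) * T) * ((\<Sum>k\<le>N n'. wsq s (z 0) k) + \<delta> n * T)"
      by (rule jac_flow_energy[OF q t, where r = "r n"]) (use u01 zs zd r_le in \<open>auto simp: z_def\<close>)
    also have "(\<Sum>k\<le>N n'. wsq s (z 0) k) \<le> tail n"
    proof -
      have "(\<Sum>k\<le>N n'. wsq s (z 0) k) = (\<Sum>k\<in>{..n'}-{..n}. wsq s c0 k)"
        using nn Nn[of n'] by (intro sum.mono_neutral_cong_right) (auto simp: z_def u0 init_def wsq_def)
      also have "\<dots> = (\<Sum>k\<le>n'. wsq s c0 k) - (\<Sum>k\<le>n. wsq s c0 k)" using nn by (intro sum_diff) auto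
      also have "\<dots> \<le> tail n" unfolding tail_def S_def using c0 by (intro diff_right_mono sum_le_suminf) auto
      finally show ?thesis .
    qed
    finally have "(\<Sum>k\<le>N n'. wsq s (z t) k) \<le> \<epsilon> n" by (simp add: \<epsilon>_def)
    moreover have "(\<Sum>k<L. wsq s (z t) k) \<le> (\<Sum>k\<in>{..N n'} \<union> {..<L}. wsq s (z t) k)"
      by (intro sum_mono2) auto
    moreover have "\<dots> = (\<Sum>k\<le>N n'. wsq s (z t) k)"
      by (intro sum.mono_neutral_right) (auto simp: zs wsq_def)
    ultimately show ?thesis by (simp add: z_def)
  qed
  have e_lim: "\<epsilon> \<longlonglongrightarrow> 0"
  proof -
    have "tail \<longlonglongrightarrow> S - S" unfolding tail_def
      using summable_LIMSEQ'[OF c0(1)] by (intro tendsto_diff tendsto_const) (simp add: S_def)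
    moreover have "\<delta> \<longlonglongrightarrow> 0"
    proof -
      have "(\<lambda>n. C * (inverse (real (Suc n)))\<^sup>2) \<longlonglongrightarrow> C * 0\<^sup>2"
        by (intro tendsto_intros LIMSEQ_inverse_real_of_nat)
      then show ?thesis unfolding \<delta>_def by (simp add: divide_inverse power_inverse add.commute)
    qed
    ultimately have "\<epsilon> \<longlonglongrightarrow> exp ((5 + 2 * 9 ^ s) * T) * ((S - S) + 0 * T)"
      unfolding \<epsilon>_def by (intro tendsto_intros)
    then show ?thesis by simp
  qed
  have e0: "0 \<le> \<epsilon> n" for n using cauchy[of 0 n n 0] T by simp
  have coord: "\<bar>u n' t k - u n t k\<bar> \<le> sqrt (\<epsilon> n)" if t: "t \<in> {0..T}" and nn: "n \<le> n'" for n n' t k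
  proof -
    have "1 * (u n' t k - u n t k)\<^sup>2 \<le> wsq s (\<lambda>k. u n' t k - u n t k) k"
      unfolding wsq_def by (intro mult_right_mono) auto
    also have "\<dots> \<le> (\<Sum>k<Suc k. wsq s (\<lambda>k. u n' t k - u n t k) k)" by (intro member_le_sum) auto
    also have "\<dots> \<le> \<epsilon> n" by (rule cauchy[OF t nn])
    finally show ?thesis using real_le_rsqrt real_sqrt_abs by (metis mult_1 real_sqrt_le_iff)
  qed
  have se_lim: "(\<lambda>n. sqrt (\<epsilon> n)) \<longlonglongrightarrow> 0" using tendsto_real_sqrt[OF e_lim] by simp
  define c where "c t k = lim (\<lambda>n. u n t k)" for t k
  have clim: "(\<lambda>n. u n t k) \<longlonglongrightarrow> c t k" if t: "t \<in> {0..T}" for t k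
  proof -
    have "Cauchy (\<lambda>n. u n t k)"
    proof (rule metric_CauchyI)
      fix e :: real assume "e > 0"
      then have "\<forall>\<^sub>F n in sequentially. sqrt (\<epsilon> n) < e / 2" using order_tendstoD(2)[OF se_lim, of "e/2"] by simp
      then obtain n where n: "sqrt (\<epsilon> n) < e / 2" by (auto simp: eventually_sequentially)
      have "dist (u a t k) (u b t k) < e" if "a \<ge> n" "b \<ge> n" for a b
        using coord[OF t that(1), of k] coord[OF t that(2), of k] n unfolding dist_real_def by linarith
      then show "\<exists>M. \<forall>m\<ge>M. \<forall>n\<ge>M. dist (u m t k) (u n t k) < e" by blast
    qed
    then show ?thesis unfolding c_def by (simp add: Cauchy_convergent convergent_LIMSEQ_iff[symmetric])
  qed
  have lim_fin: "(\<Sum>k<L. wsq s (\<lambda>k. c t k - u n t k) k) \<le> \<epsilon> n" if t: "t \<in> {0..T}" for t n L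
  proof (rule LIMSEQ_le_const2)
    show "(\<lambda>n'. \<Sum>k<L. wsq s (\<lambda>k. u n' t k - u n t k) k) \<longlonglongrightarrow> (\<Sum>k<L. wsq s (\<lambda>k. c t k - u n t k) k)"
      unfolding wsq_def by (intro tendsto_intros clim t)
    show "\<exists>N. \<forall>n'\<ge>N. (\<Sum>k<L. wsq s (\<lambda>k. u n' t k - u n t k) k) \<le> \<epsilon> n" using cauchy[OF t] by blast
  qed
  have csum: "summable (wsq s (\<lambda>k. c t k - u n t k))" "suminf (wsq s (\<lambda>k. c t k - u n t k)) \<le> \<epsilon> n" if t: "t \<in> {0..T}" for t n
  proof -
    show 1: "summable (wsq s (\<lambda>k. c t k - u n t k))"
      by (rule bounded_imp_summable[where B = "\<epsilon> n"]) (use lim_fin[OF t, of _ "Suc _"] in \<open>auto simp: lessThan_Suc_atMost\<close>)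
    show "suminf (wsq s (\<lambda>k. c t k - u n t k)) \<le> \<epsilon> n" by (rule suminf_le_const[OF 1 lim_fin[OF t]])
  qed
  have usum: "summable (wsq s (u n t))" for n t
    by (rule summable_finite[of "{..N n}"]) (auto simp: us wsq_def not_le)
  have hs: "summable (wsq s (c t))" if t: "t \<in> {0..T}" for t
    using summable_wsq_add(1)[OF csum(1)[OF t, of 0] usum[of 0 t]] by simp
  have ccoord: "\<bar>c t k - u n t k\<bar> \<le> sqrt (\<epsilon> n)" if t: "t \<in> {0..T}" for t n k
  proof (rule LIMSEQ_le_const2)
    show "(\<lambda>n'. \<bar>u n' t k - u n t k\<bar>) \<longlonglongrightarrow> \<bar>c t k - u n t k\<bar>" by (intro tendsto_intros clim t)
    show "\<exists>N. \<forall>n'\<ge>N. \<bar>u n' t k - u n t k\<bar> \<le> sqrt (\<epsilon> n)" using coord[OF t] by blast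
  qed
  show ?thesis
  proof (rule that[of c])
    show "c 0 = c0"
    proof
      fix k
      have "(\<lambda>n. u n 0 k) \<longlonglongrightarrow> c0 k"
        by (rule tendsto_eventually) (auto simp: u0 init_def eventually_sequentially intro!: exI[of _ k])
      then show "c 0 k = c0 k" unfolding c_def by (rule limI)
    qed
    show "c t 0 = 0 \<and> c t 1 = 0" for t by (simp add: c_def u01)
    show "hcont s T c"
      unfolding hcont_def
    proof (intro ballI conjI hs)
      fix t assume t: "t \<in> {0..T}"
      show "((\<lambda>r. \<Sum>k. wsq s (\<lambda>k. c r k - c t k) k) \<longlongrightarrow> 0) (at t within {0..T})"
      proof (rule tendstoI)
        fix e :: real assume e: "e > 0"
        then have "\<forall>\<^sub>F n in sequentially. \<epsilon> n < e / 16" using order_tendstoD(2)[OF e_lim, of "e/16"] by simp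
        then obtain n where n: "\<epsilon> n < e / 16" by (auto simp: eventually_sequentially)
        have "((\<lambda>r. \<Sum>k\<le>N n. wsq s (\<lambda>k. u n r k - u n t k) k) \<longlongrightarrow> (\<Sum>k\<le>N n. wsq s (\<lambda>k. u n t k - u n t k) k)) (at t within {0..T})"
          unfolding wsq_def
          by (intro tendsto_intros) (use udw DERIV_continuous continuous_within in blast)
        then have "((\<lambda>r. \<Sum>k\<le>N n. wsq s (\<lambda>k. u n r k - u n t k) k) \<longlongrightarrow> 0) (at t within {0..T})" by (simp add: wsq_def)
        from order_tendstoD(2)[OF this, of "e/16"] e
        have "\<forall>\<^sub>F r in at t within {0..T}. (\<Sum>k\<le>N n. wsq s (\<lambda>k. u n r k - u n t k) k) < e / 16" by simp
        moreover have "\<forall>\<^sub>F r in at t within {0..T}. r \<in> {0..T}" by (simp add: eventually_at_filter)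
        ultimately show "\<forall>\<^sub>F r in at t within {0..T}. dist (\<Sum>k. wsq s (\<lambda>k. c r k - c t k) k) 0 < e"
        proof eventually_elim
          case (elim r)
          \<comment> \<open>The increment of the limit is split through \<open>u n\<close>. Adding
            the three parts costs factors 4, 4 and 2, so e / 16 for each of them suffices.\<close>
          define a where "a = (\<lambda>k. c r k - u n r k)"
          define b where "b = (\<lambda>k. u n r k - u n t k)"
          define d where "d = (\<lambda>k. c t k - u n t k)"
          have eq: "(\<lambda>k. c r k - c t k) = (\<lambda>k. (a k + b k) - d k)" by (rule ext) (simp add: a_def b_def d_def)
          have sa: "summable (wsq s a)" "suminf (wsq s a) \<le> \<epsilon> n" unfolding a_def using csum elim by auto
          have sd: "summable (wsq s d)" "suminf (wsq s d) \<le> \<epsilon> n" unfolding d_def using csum t by auto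
          have sb: "summable (wsq s b)" unfolding b_def using usum by (intro summable_wsq_diff)
          have "suminf (wsq s b) = (\<Sum>k\<le>N n. wsq s b k)"
            by (rule suminf_finite) (auto simp: b_def us wsq_def not_le)
          then have sb': "suminf (wsq s b) < e / 16" using elim by (simp add: b_def)
          note s1 = summable_wsq_add[OF sa(1) sb]
          note s2 = summable_wsq_diff[OF s1(1) sd(1)]
          have "(\<Sum>k. wsq s (\<lambda>k. c r k - c t k) k) < e"
            unfolding eq using s2(2) s1(2) sa(2) sb' sd(2) n e by linarith
          moreover have "0 \<le> (\<Sum>k. wsq s (\<lambda>k. c r k - c t k) k)" unfolding eq by (intro suminf_nonneg s2) auto
          ultimately show ?case by simp
        qed
      qed
    qed
    fix t k assume t: "t \<in> {0..T}"
    \<comment> \<open>For fixed k the derivatives of the approximations converge uniformly in time.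
      The index is shifted by k so that row k belongs to the truncated system from the
      start.\<close>
    have "\<exists>g. \<forall>x\<in>{0..T}. (\<lambda>n. u (n + k) x k) \<longlonglongrightarrow> g x \<and> (g has_derivative (*) (- jac q (c x) k)) (at x within {0..T})"
    proof (rule has_derivative_sequence)
      show "convex {0..T}" by simp
      show "((\<lambda>x. u (n + k) x k) has_derivative (*) (- jac q (u (n + k) x) k)) (at x within {0..T})" for n x
      proof -
        have "k \<le> N (n + k)" using Nn[of "n + k"] by simp
        then show ?thesis using udw[of k "n + k" x] by (simp add: has_field_derivative_def)
      qed
      show "\<forall>\<^sub>F n in sequentially. \<forall>x\<in>{0..T}. \<forall>h. norm (- jac q (u (n + k) x) k * h - - jac q (c x) k * h) \<le> e * norm h" if e: "e > 0" for e
      proof -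
        have "(\<lambda>n. (2 * real k + 4) * sqrt (\<epsilon> (n + k))) \<longlonglongrightarrow> (2 * real k + 4) * 0"
          by (intro tendsto_intros LIMSEQ_ignore_initial_segment se_lim)
        then have "\<forall>\<^sub>F n in sequentially. (2 * real k + 4) * sqrt (\<epsilon> (n + k)) < e"
          using order_tendstoD(2)[of _ "(2 * real k + 4) * 0" sequentially e] e by simp
        then show ?thesis
        proof eventually_elim
          case (elim n)
          show ?case
          proof (intro ballI allI)
            fix x h assume x: "x \<in> {0..T}"
            have "norm (- jac q (u (n + k) x) k * h - - jac q (c x) k * h) = \<bar>jac q (\<lambda>j. c x j - u (n + k) x j) k\<bar> * norm h"
              unfolding jac_diff by (simp add: abs_mult[symmetric] algebra_simps)
            also have "\<dots> \<le> ((2 * real k + 4) * sqrt (\<epsilon> (n + k))) * norm h"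
              by (intro mult_right_mono jac_bounded_le[OF q] ccoord[OF x]) auto
            also have "\<dots> \<le> e * norm h" using elim by (intro mult_right_mono) auto
            finally show "norm (- jac q (u (n + k) x) k * h - - jac q (c x) k * h) \<le> e * norm h" .
          qed
        qed
      qed
      show "0 \<in> {0..T}" using T by simp
      then show "(\<lambda>n. u (n + k) 0 k) \<longlonglongrightarrow> c 0 k" using clim[of 0 k] by (intro LIMSEQ_ignore_initial_segment) auto
    qed
    then obtain g where g: "\<And>x. x \<in> {0..T} \<Longrightarrow> (\<lambda>n. u (n + k) x k) \<longlonglongrightarrow> g x" "\<And>x. x \<in> {0..T} \<Longrightarrow> (g has_derivative (*) (- jac q (c x) k)) (at x within {0..T})"
      by blast
    have gc: "g x = c x k" if "x \<in> {0..T}" for x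
      using LIMSEQ_unique[OF g(1)[OF that] LIMSEQ_ignore_initial_segment[OF clim[OF that]]] .
    have "(g has_real_derivative - jac q (c t) k) (at t within {0..T})"
      using g(2)[OF t] by (simp add: has_field_derivative_def)
    then show "((\<lambda>r. c r k) has_real_derivative - jac q (c t) k) (at t within {0..T})"
      by (rule has_field_derivative_transform_within[OF _ zero_less_one t]) (simp add: gc)
  qed
qed

section \<open>Trigonometric polynomials\<close>

lemma integrable_torus_continuous: "continuous_on UNIV f \<Longrightarrow> integrable torus f" for f :: "real \<Rightarrow> real"
  by (rule continuous_imp_integrable_real) (rule continuous_on_subset, auto)

lemma measurable_torus_continuous: "continuous_on UNIV f \<Longrightarrow> f \<in> borel_measurable torus" for f :: "real \<Rightarrow> real"
  by (rule borel_measurable_integrable) (rule integrable_torus_continuous)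

lemma continuous_bounded_torus:
  fixes g :: "real \<Rightarrow> real"
  assumes "continuous_on UNIV g"
  obtains B where "0 < B" "\<And>x. x \<in> {-pi..pi} \<Longrightarrow> \<bar>g x\<bar> \<le> B"
proof -
  have "compact (g ` {-pi..pi})"
    by (intro compact_continuous_image continuous_on_subset[OF assms]) auto
  then obtain B where "B > 0" "\<forall>y\<in>g ` {-pi..pi}. norm y \<le> B"
    using compact_imp_bounded bounded_pos by blast
  then show ?thesis by (intro that[of B]) auto
qed

lemma integrable_torus_bounded_mult:
  fixes f g :: "real \<Rightarrow> real"
  assumes f: "integrable torus f" and g: "g \<in> borel_measurable torus" and B: "\<And>x. x \<in> {-pi..pi} \<Longrightarrow> \<bar>g x\<bar> \<le> B"
  shows "integrable torus (\<lambda>x. f x * g x)"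
proof (rule Bochner_Integration.integrable_bound[where f = "\<lambda>x. B * f x"])
  show "integrable torus (\<lambda>x. B * f x)" using f by simp
  show "(\<lambda>x. f x * g x) \<in> borel_measurable torus" using f g by measurable
  have B0: "0 \<le> B" using B[of 0] by simp
  show "AE x in torus. norm (f x * g x) \<le> norm (B * f x)"
  proof (rule AE_I2)
    fix x assume "x \<in> space torus"
    then have "\<bar>g x\<bar> \<le> B" using B by simp
    then have "\<bar>f x\<bar> * \<bar>g x\<bar> \<le> \<bar>f x\<bar> * B" by (intro mult_left_mono) auto
    then show "norm (f x * g x) \<le> norm (B * f x)" using B0 by (simp add: abs_mult mult.commute)
  qed
qed

lemma integrable_torus_mult:
  fixes f g :: "real \<Rightarrow> real"
  assumes f: "integrable torus f" and g: "continuous_on UNIV g"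
  shows "integrable torus (\<lambda>x. f x * g x)"
proof -
  obtain B where "\<And>x. x \<in> {-pi..pi} \<Longrightarrow> \<bar>g x\<bar> \<le> B" using continuous_bounded_torus[OF g] by blast
  then show ?thesis by (rule integrable_torus_bounded_mult[OF f measurable_torus_continuous[OF g]])
qed

text \<open>The phase \<open>p\<close> makes differentiation a shift: \<open>tr 0 k\<close> is \<open>sin k\<theta>\<close>, \<open>tr 1 k\<close> is
  \<open>cos k\<theta>\<close>, and the derivative of \<open>tr p k\<close> is \<open>k\<close> times \<open>tr (p + 1) k\<close>.\<close>

definition tr :: "nat \<Rightarrow> nat \<Rightarrow> real \<Rightarrow> real" where
  "tr p k x = sin (real k * x + real p * (pi / 2))"

lemma tr_0: "tr 0 k x = sin (real k * x)"
  by (simp add: tr_def)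

lemma tr_Suc: "tr (Suc p) k x = cos (real k * x + real p * (pi / 2))"
proof -
  have "tr (Suc p) k x = sin ((real k * x + real p * (pi / 2)) + pi / 2)"
    by (simp add: tr_def algebra_simps add_divide_distrib)
  then show ?thesis by (simp only: sin_add) simp
qed

lemma tr_1: "tr (Suc 0) k x = cos (real k * x)"
  by (simp add: tr_Suc)

lemma tr_Suc_Suc: "tr (Suc (Suc p)) k x = - tr p k x"
proof -
  have "tr (Suc (Suc p)) k x = cos ((real k * x + real p * (pi / 2)) + pi / 2)"
    by (simp add: tr_Suc algebra_simps add_divide_distrib)
  then show ?thesis by (simp only: cos_add tr_def) simp
qed

text \<open>Raising the phase by 2 only changes the sign, so up to sign there are just sine and
  cosine. This reduces statements about all phases to two of them.\<close>

lemma tr_parity: "\<exists>c::real. \<bar>c\<bar> = 1 \<and> (\<forall>k x. tr p k x = c * tr (if even p then 0 else 1) k x)"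
proof (induction p rule: nat_less_induct)
  case (1 p)
  show ?case
  proof (cases "p < 2")
    case True
    then have "p = 0 \<or> p = 1" by auto
    then show ?thesis by (intro exI[of _ 1]) auto
  next
    case False
    then obtain r where r: "p = Suc (Suc r)" by (metis add_2_eq_Suc le_Suc_ex not_less)
    with 1 obtain c :: real where "\<bar>c\<bar> = 1" "\<forall>k x. tr r k x = c * tr (if even r then 0 else 1) k x" by (metis lessI less_SucI)
    then show ?thesis using r by (intro exI[of _ "- c"]) (auto simp: tr_Suc_Suc)
  qed
qed

lemma tr_le_1: "\<bar>tr p k x\<bar> \<le> 1"
  by (simp add: tr_def)

lemma tr_has_derivative: "(tr p k has_real_derivative real k * tr (Suc p) k x) (at x within S)"
proof -
  have "(tr p k has_real_derivative cos (real k * x + real p * (pi / 2)) * real k) (at x within S)"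
    unfolding tr_def[abs_def] by (auto intro!: derivative_eq_intros)
  then show ?thesis by (simp add: tr_Suc mult.commute)
qed

lemma deriv_tr: "deriv (tr p k) x = real k * tr (Suc p) k x"
  by (rule DERIV_imp_deriv tr_has_derivative)+

lemma continuous_on_tr [continuous_intros]: "continuous_on S (tr p k)"
  unfolding tr_def[abs_def] by (intro continuous_intros)

lemma tr_periodic: "tr p k (x + 2 * pi) = tr p k x"
proof -
  have "tr p k (x + 2 * pi) = sin ((real k * x + real p * (pi / 2)) + 2 * real k * pi)"
    unfolding tr_def by (simp add: algebra_simps)
  then show ?thesis by (simp only: sin_add sin_2npi cos_2npi tr_def) simp
qed

lemma deriv_funpow_tr: "(deriv ^^ n) (tr p k) = (\<lambda>x. real k ^ n * tr (p + n) k x)"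
proof (induction n)
  case (Suc n)
  have "deriv (\<lambda>x. real k ^ n * tr (p + n) k x) x = real k ^ n * (real k * tr (Suc (p + n)) k x)" for x
    by (intro DERIV_imp_deriv DERIV_cmult tr_has_derivative)
  then show ?case using Suc by (auto simp: mult_ac)
qed simp

lemma test_fun_tr: "test_fun (tr p k)"
  unfolding test_fun_def periodic_def
proof (intro conjI allI tr_periodic)
  fix n x
  have "((\<lambda>x. real k ^ n * tr (p + n) k x) has_real_derivative real k ^ n * (real k * tr (Suc (p + n)) k x)) (at x)"
    by (intro DERIV_cmult tr_has_derivative)
  then show "(deriv ^^ n) (tr p k) differentiable at x"
    unfolding deriv_funpow_tr using real_differentiable_def by blast
qed

section \<open>Density of trigonometric polynomials\<close>

inductive trigp :: "(real \<Rightarrow> real) \<Rightarrow> bool" where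
  trigp_tr: "trigp (\<lambda>x. a * tr p k x)"
| trigp_add: "trigp f \<Longrightarrow> trigp g \<Longrightarrow> trigp (\<lambda>x. f x + g x)"

lemma trigp_scale: "trigp f \<Longrightarrow> trigp (\<lambda>x. c * f x)"
proof (induction rule: trigp.induct)
  case (trigp_tr a p k)
  then show ?case using trigp.trigp_tr[of "c * a" p k] by (simp add: mult.assoc)
next
  case (trigp_add f g)
  then show ?case using trigp.trigp_add[of "\<lambda>x. c * f x" "\<lambda>x. c * g x"] by (simp add: distrib_left)
qed

lemma trigp_const: "trigp (\<lambda>x. c)"
  using trigp_tr[of c 1 0] by (simp add: tr_Suc)

text \<open>This is sin a sin b = (cos (a - b) - cos (a + b)) / 2. The phase p - p' could be
  negative; p' full turns change it to p + 3 * p', and the additional 1 turns sine into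
  cosine.\<close>

lemma tr_mult: "tr p k x * tr p' k' x = 1/2 * tr (p + 3 * p' + 1) (k - k') x - 1/2 * tr (p + p' + 1) (k + k') x"
  if "k' \<le> k"
proof -
  define a where "a = real k * x + real p * (pi / 2)"
  define b where "b = real k' * x + real p' * (pi / 2)"
  have "tr (p + 3 * p' + 1) (k - k') x = cos ((a - b) + 2 * real p' * pi)"
    unfolding Suc_eq_plus1[symmetric] tr_Suc a_def b_def using that by (simp add: of_nat_diff algebra_simps add_divide_distrib)
  also have "\<dots> = cos (a - b)" by (simp only: cos_add[of "a - b"] sin_2npi cos_2npi mult_1_right mult_zero_right diff_zero)
  finally have 1: "tr (p + 3 * p' + 1) (k - k') x = cos (a - b)" .
  have 2: "tr (p + p' + 1) (k + k') x = cos (a + b)"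
    unfolding Suc_eq_plus1[symmetric] tr_Suc a_def b_def by (simp add: algebra_simps add_divide_distrib)
  have "tr p k x * tr p' k' x = sin a * sin b" by (simp add: tr_def a_def b_def)
  then show ?thesis unfolding 1 2 by (simp add: cos_add cos_diff field_simps)
qed

lemma trigp_tr_mult: "trigp (\<lambda>x. tr p k x * tr p' k' x)"
proof -
  have *: "trigp (\<lambda>x. tr p k x * tr p' k' x)" if "k' \<le> k" for p p' k k'
    unfolding tr_mult[OF that]
    using trigp_add[OF trigp_tr[of "1/2" "p + 3 * p' + 1" "k - k'"] trigp_tr[of "- 1/2" "p + p' + 1" "k + k'"]] by simp
  show ?thesis using *[of k' k p p'] *[of k k' p' p] by (cases "k' \<le> k") (auto simp: mult.commute)
qed

lemma trigp_mult: "trigp f \<Longrightarrow> trigp g \<Longrightarrow> trigp (\<lambda>x. f x * g x)"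
proof (induction rule: trigp.induct)
  case f: (trigp_tr a p k)
  show ?case using f
  proof (induction rule: trigp.induct)
    case (trigp_tr b p' k')
    show ?case using trigp_scale[OF trigp_tr_mult[of p k p' k'], of "a * b"] by (simp add: mult_ac)
  next
    case (trigp_add f g)
    then show ?case using trigp.trigp_add[of "\<lambda>x. a * tr p k x * f x" "\<lambda>x. a * tr p k x * g x"] by (simp add: distrib_left)
  qed
next
  case (trigp_add f h)
  then show ?case using trigp.trigp_add[of "\<lambda>x. f x * g x" "\<lambda>x. h x * g x"] by (simp add: distrib_right)
qed

lemma trigp_continuous: "trigp f \<Longrightarrow> continuous_on S f"
  by (induction rule: trigp.induct) (auto intro!: continuous_intros)

text \<open>On the unit circle both coordinates are trigonometric, so Stone-Weierstrass for
  polynomials on the circle becomes an approximation theorem for periodic functions.\<close>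

lemma trigp_real_polynomial_cis:
  assumes "real_polynomial_function g"
  shows "trigp (\<lambda>x. g (cis x))"
  using assms
proof (induction rule: real_polynomial_function.induct)
  case (linear f)
  interpret bounded_linear f by fact
  have "f (cis x) = f 1 * tr 1 1 x + f \<i> * tr 0 1 x" for x
  proof -
    have "cis x = cos x *\<^sub>R 1 + sin x *\<^sub>R \<i>" by (simp add: complex_eq_iff)
    then show ?thesis by (simp only: add scaleR) (simp add: tr_0 tr_1)
  qed
  then show ?case by (simp only:) (intro trigp_add trigp_tr)
next
  case (mult f g)
  then show ?case by (intro trigp_mult)
next
  case (add f g)
  then show ?case by (intro trigp_add)
qed (rule trigp_const)

lemma periodic_int: "periodic f \<Longrightarrow> f (x + 2 * pi * of_int n) = f x"
proof (induction n rule: int_induct[where k = 0])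
  case (step1 i)
  then show ?case unfolding periodic_def by (metis (no_types, opaque_lifting) add.assoc distrib_left mult.right_neutral of_int_1 of_int_add)
next
  case (step2 i)
  have "f (x + 2 * pi * of_int i) = f ((x + 2 * pi * of_int (i - 1)) + 2 * pi)" by (simp add: algebra_simps)
  also have "\<dots> = f (x + 2 * pi * of_int (i - 1))" using step2 unfolding periodic_def by blast
  finally show ?case using step2 by simp
qed simp

lemma periodic_Arg_cis:
  assumes "periodic f"
  shows "f (Arg (cis x)) = f x"
proof -
  have "cis (Arg (cis x)) = cis x" using cis_Arg[of "cis x"] by (simp add: sgn_div_norm)
  then have "cos (Arg (cis x)) = cos x" "sin (Arg (cis x)) = sin x" by (simp_all add: complex_eq_iff)
  then obtain n :: int where "Arg (cis x) = x + 2 * pi * of_int n"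
    using sin_cos_eq_iff[of "Arg (cis x)" x] by auto
  then show ?thesis using periodic_int[OF assms, of x n] by simp
qed

text \<open>\<open>Arg\<close> jumps across the negative real axis. Near that axis
  \<open>Arg (- w) + pi\<close> is continuous and differs from \<open>Arg w\<close> by a multiple of
  2 pi, which a periodic f does not see.\<close>

lemma continuous_on_periodic_Arg:
  assumes per: "periodic f" and c: "continuous_on UNIV f"
  shows "continuous_on (sphere 0 1) (\<lambda>z. f (Arg z))"
proof (rule continuous_at_imp_continuous_on, rule ballI)
  fix z :: complex assume z: "z \<in> sphere 0 1"
  have cf: "isCont f x" for x using c by (simp add: continuous_on_eq_continuous_at)
  show "isCont (\<lambda>z. f (Arg z)) z"
  proof (cases "z \<in> \<real>\<^sub>\<le>\<^sub>0")
    case False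
    then show ?thesis using continuous_at_Arg[OF False] cf by (intro continuous_intros isCont_o2[of z Arg f])
  next
    case True
    then have "- z \<notin> \<real>\<^sub>\<le>\<^sub>0" using z True by (auto simp: complex_nonpos_Reals_iff cmod_def)
    then have "isCont Arg (- z)" by (rule continuous_at_Arg)
    then have a: "isCont (\<lambda>w. Arg (- w) + pi) z"
      by (intro continuous_intros) (auto intro: isCont_o2[where g = Arg and f = uminus])
    have i: "isCont (\<lambda>w. f (Arg (- w) + pi)) z" by (rule isCont_o2[OF a cf])
    have eq: "f (Arg (- w) + pi) = f (Arg w)" if "w \<noteq> 0" for w
    proof -
      have "f (Arg w + pi + pi) = f (Arg w)" using per unfolding periodic_def by (metis add.assoc mult_2)
      then show ?thesis unfolding Arg_minus[OF that] by simp
    qed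
    have "\<forall>\<^sub>F w in nhds z. w \<noteq> 0" using z by (intro t1_space_nhds) auto
    then have "\<forall>\<^sub>F w in nhds z. f (Arg (- w) + pi) = f (Arg w)" by eventually_elim (rule eq)
    then show ?thesis using i isCont_cong[of _ _ z] by fastforce
  qed
qed

lemma trigp_dense:
  assumes per: "periodic f" and c: "continuous_on UNIV f" and e: "0 < e"
  obtains P where "trigp P" "\<And>x. \<bar>f x - P x\<bar> < e"
proof -
  obtain g where g: "real_polynomial_function g" "\<And>z. z \<in> sphere 0 1 \<Longrightarrow> \<bar>f (Arg z) - g z\<bar> < e"
    using Stone_Weierstrass_real_polynomial_function[OF compact_sphere continuous_on_periodic_Arg[OF per c] e] by blast
  show ?thesis
  proof (rule that[OF trigp_real_polynomial_cis[OF g(1)]])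
    fix x
    show "\<bar>f x - g (cis x)\<bar> < e" using g(2)[of "cis x"] by (simp add: periodic_Arg_cis[OF per])
  qed
qed

lemma trigp_periodic: "trigp f \<Longrightarrow> periodic f"
  by (induction rule: trigp.induct) (auto simp: periodic_def tr_periodic)

section \<open>Completeness of the trigonometric system\<close>

lemma trigp_annihilate:
  assumes f: "integrable torus f" and z: "\<And>p k. (LINT x|torus. f x * tr p k x) = 0" and P: "trigp P"
  shows "(LINT x|torus. f x * P x) = 0"
  using P
proof (induction rule: trigp.induct)
  case (trigp_tr a p k)
  have "(LINT x|torus. f x * (a * tr p k x)) = (LINT x|torus. a * (f x * tr p k x))" by (simp add: mult_ac)
  then show ?case using z by simp
next
  case (trigp_add g h)
  have "(LINT x|torus. f x * (g x + h x)) = (LINT x|torus. f x * g x) + (LINT x|torus. f x * h x)"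
    unfolding distrib_left using f trigp_add trigp_continuous
    by (intro Bochner_Integration.integral_add integrable_torus_mult) auto
  then show ?case using trigp_add by simp
qed

lemma continuous_annihilate:
  assumes f: "integrable torus f" and z: "\<And>p k. (LINT x|torus. f x * tr p k x) = 0"
    and per: "periodic \<phi>" and c: "continuous_on UNIV \<phi>"
  shows "(LINT x|torus. f x * \<phi> x) = 0"
proof (rule ccontr)
  assume ne: "(LINT x|torus. f x * \<phi> x) \<noteq> 0"
  \<comment> \<open>The added 1 keeps \<open>A\<close> positive and makes the final inequality e *
    (A - 1) < e * A strict.\<close>
  define A where "A = (LINT x|torus. \<bar>f x\<bar>) + 1"
  have A: "A > 0" unfolding A_def by (intro add_nonneg_pos integral_nonneg_AE) auto
  define e where "e = \<bar>LINT x|torus. f x * \<phi> x\<bar> / A"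
  have e: "e > 0" using ne A by (simp add: e_def)
  obtain P where P: "trigp P" "\<And>x. \<bar>\<phi> x - P x\<bar> < e" using trigp_dense[OF per c e] by blast
  have "(LINT x|torus. f x * \<phi> x) = (LINT x|torus. f x * \<phi> x) - (LINT x|torus. f x * P x)"
    using trigp_annihilate[OF f z P(1)] by simp
  also have "\<dots> = (LINT x|torus. f x * (\<phi> x - P x))"
    unfolding right_diff_distrib using f c trigp_continuous[OF P(1)]
    by (intro Bochner_Integration.integral_diff[symmetric] integrable_torus_mult) auto
  finally have "\<bar>LINT x|torus. f x * \<phi> x\<bar> \<le> (LINT x|torus. \<bar>f x * (\<phi> x - P x)\<bar>)" by (metis integral_abs_bound)
  also have "\<dots> \<le> (LINT x|torus. e * \<bar>f x\<bar>)"
  proof (rule integral_mono)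
    show "integrable torus (\<lambda>x. \<bar>f x * (\<phi> x - P x)\<bar>)"
      using f c trigp_continuous[OF P(1)] by (intro integrable_abs integrable_torus_mult continuous_on_diff) auto
    show "integrable torus (\<lambda>x. e * \<bar>f x\<bar>)" using f by simp
    show "\<bar>f x * (\<phi> x - P x)\<bar> \<le> e * \<bar>f x\<bar>" for x
      unfolding abs_mult using P(2)[of x] by (subst mult.commute) (intro mult_right_mono, auto)
  qed
  also have "\<dots> = e * (A - 1)" by (simp add: A_def)
  also have "\<dots> < e * A" using e by simp
  also have "\<dots> = \<bar>LINT x|torus. f x * \<phi> x\<bar>" using A by (simp add: e_def)
  finally show False by simp
qed

text \<open>A continuous periodic f may be tested against itself, and then the integral of its
  square vanishes.\<close>

lemma continuous_eq_zero:
  assumes per: "periodic f" and c: "continuous_on UNIV f" and z: "\<And>p k. (LINT x|torus. f x * tr p k x) = 0"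
  shows "f x = 0"
proof -
  have "(LINT x|torus. f x * f x) = 0"
    by (rule continuous_annihilate[OF integrable_torus_continuous[OF c] z per c])
  then have "integral {-pi..pi} (\<lambda>x. f x * f x) = 0"
    using c by (subst lebesgue_integral_eq_integral[symmetric]) (auto intro!: integrable_torus_continuous continuous_intros)
  then have 0: "\<forall>x\<in>{-pi..pi}. f x * f x = 0"
    using c by (subst (asm) integral_eq_0_iff) (auto intro!: continuous_intros intro: continuous_on_subset)
  have "f (Arg (cis x)) = 0" using 0 Arg_bounded[of "cis x"] by auto
  then show ?thesis using periodic_Arg_cis[OF per] by simp
qed

text \<open>The indicator is reached as the dominated limit of the continuous periodic cut-offs min
  1 (n max 0 \<psi>), where \<psi> = cos (x - m) - cos r is positive, within [-pi, pi], exactly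
  between a and b.\<close>

lemma interval_integral_zero:
  assumes f: "integrable torus f" and z: "\<And>p k. (LINT x|torus. f x * tr p k x) = 0"
    and ab: "-pi \<le> a" "a < b" "b \<le> pi"
  shows "(LINT x|torus. f x * indicator {a<..<b} x) = 0"
proof -
  define m where "m = (a + b) / 2"
  define r where "r = (b - a) / 2"
  define \<psi> where "\<psi> x = cos (x - m) - cos r" for x
  have r: "0 < r" "r \<le> pi" using ab by (auto simp: r_def)
  have pos: "\<psi> x > 0 \<longleftrightarrow> x \<in> {a<..<b}" if x: "x \<in> {-pi..pi}" for x
  proof -
    have in_iff: "x \<in> {a<..<b} \<longleftrightarrow> \<bar>x - m\<bar> < r" by (auto simp: m_def r_def abs_less_iff field_simps)
    show ?thesis
    proof (cases "\<bar>x - m\<bar> \<le> pi")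
      case True
      then have "cos r < cos \<bar>x - m\<bar> \<longleftrightarrow> \<bar>x - m\<bar> < r" using r by (intro cos_mono_less_eq) auto
      then show ?thesis unfolding in_iff by (simp add: \<psi>_def)
    next
      case False
      then have n: "\<not> \<bar>x - m\<bar> < r" using r by auto
      \<comment> \<open>Farther than pi from the midpoint the distance has to be measured the other
        way round the circle; that distance \<open>w\<close> is still at least r.\<close>
      have "\<bar>m\<bar> \<le> pi - r" using ab by (auto simp: m_def r_def abs_le_iff field_simps)
      then have u: "\<bar>x - m\<bar> \<le> 2 * pi - r" using x by (auto simp: abs_le_iff)
      define w where "w = 2 * pi - \<bar>x - m\<bar>"
      have w: "r \<le> w" "w \<le> pi" using u False by (auto simp: w_def)
      have "cos w = cos \<bar>x - m\<bar>" unfolding w_def cos_diff[of "2 * pi"] by simp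
      then have "cos (x - m) = cos w" by (simp only: cos_abs_real)
      moreover have "cos w \<le> cos r" using w r by (intro cos_monotone_0_pi_le) auto
      ultimately show ?thesis unfolding in_iff using n by (simp add: \<psi>_def)
    qed
  qed
  define \<phi> where "\<phi> n x = min 1 (real n * max 0 (\<psi> x))" for n x
  have \<phi>c: "continuous_on UNIV (\<phi> n)" for n unfolding \<phi>_def \<psi>_def by (intro continuous_intros)
  have "cos (x + 2 * pi - m) = cos (x - m)" for x
    using cos_periodic[of "x - m"] by (simp add: algebra_simps)
  then have \<phi>p: "periodic (\<phi> n)" for n by (simp add: periodic_def \<phi>_def \<psi>_def)
  have "(\<lambda>n. LINT x|torus. f x * \<phi> n x) \<longlonglongrightarrow> (LINT x|torus. f x * indicator {a<..<b} x)"
  proof (rule integral_dominated_convergence[where w = "\<lambda>x. \<bar>f x\<bar>"])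
    show "integrable torus (\<lambda>x. \<bar>f x\<bar>)" using f by simp
    show "(\<lambda>x. f x * indicator {a<..<b} x) \<in> borel_measurable torus" 
    proof -
      have "(indicator {a<..<b} :: real \<Rightarrow> real) \<in> borel_measurable torus"
        by (intro measurable_restrict_space1 measurable_completion) auto
      then show ?thesis using f by measurable
    qed
    show "(\<lambda>x. f x * \<phi> n x) \<in> borel_measurable torus" for n
      using f measurable_torus_continuous[OF \<phi>c[of n]] by measurable
    show "AE x in torus. norm (f x * \<phi> n x) \<le> \<bar>f x\<bar>" for n
      by (rule AE_I2) (auto simp: abs_mult \<phi>_def intro!: mult_left_le)
    show "AE x in torus. (\<lambda>n. f x * \<phi> n x) \<longlonglongrightarrow> f x * indicator {a<..<b} x"
    proof (rule AE_I2)
      fix x assume "x \<in> space torus"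
      then have x: "x \<in> {-pi..pi}" by simp
      show "(\<lambda>n. f x * \<phi> n x) \<longlonglongrightarrow> f x * indicator {a<..<b} x"
      proof (intro tendsto_mult tendsto_const)
        show "(\<lambda>n. \<phi> n x) \<longlonglongrightarrow> indicator {a<..<b} x"
        proof (cases "x \<in> {a<..<b}")
          case True
          then have p: "\<psi> x > 0" using pos[OF x] by simp
          obtain N where N: "1 / \<psi> x < real N" using reals_Archimedean2 by blast
          have "\<phi> n x = 1" if "n \<ge> N" for n
          proof -
            have "1 < real N * \<psi> x" using N p by (simp add: field_simps)
            also have "\<dots> \<le> real n * \<psi> x" using that p by (intro mult_right_mono) auto
            finally show ?thesis using p by (simp add: \<phi>_def)
          qed
          then show ?thesis using True by (intro tendsto_eventually) (auto simp: eventually_sequentially)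
        next
          case False
          then have "\<not> \<psi> x > 0" using pos[OF x] by simp
          then show ?thesis using False by (simp add: \<phi>_def max_def)
        qed
      qed
    qed
  qed
  moreover have "(LINT x|torus. f x * \<phi> n x) = 0" for n
    by (rule continuous_annihilate[OF f z \<phi>p \<phi>c])
  ultimately show ?thesis using LIMSEQ_unique[OF _ tendsto_const[of 0]] by simp
qed

text \<open>By Lebesgue's differentiation theorem f is almost everywhere the limit of its averages
  over short intervals, and these averages are zero.\<close>

lemma integrable_AE_eq_zero:
  assumes f: "integrable torus f" and z: "\<And>p k. (LINT x|torus. f x * tr p k x) = 0"
  shows "AE x in torus. f x = 0"
proof -
  define f0 where "f0 x = (if x \<in> {-pi..pi} then f x else 0)" for x
  have f0: "integrable lebesgue f0" unfolding f0_def[abs_def] using f Lebesgue_Measure.integrable_restrict_UNIV[of "{-pi..pi}" f] by simp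
  have f0i: "f0 integrable_on cbox a b" for a b
    using f0 by (metis integrable_on_lebesgue integrable_on_subcbox subset_UNIV)
  from integrable_ccontinuous_explicit[OF f0i] obtain N where N: "negligible N" and
    Nd: "\<And>x e. x \<notin> N \<Longrightarrow> 0 < e \<Longrightarrow> \<exists>d>0. \<forall>h. 0 < h \<and> h < d \<longrightarrow> norm (integral (cbox x (x + h *\<^sub>R One)) f0 /\<^sub>R h ^ DIM(real) - f0 x) < e"
    by blast
  have zero: "f x = 0" if x: "x \<in> {-pi<..<pi}" "x \<notin> N" for x
  proof (rule ccontr)
    assume "f x \<noteq> 0"
    then have "0 < \<bar>f x\<bar>" by simp
    from Nd[OF x(2) this] obtain d where d: "d > 0" and dd: "\<And>h. 0 < h \<Longrightarrow> h < d \<Longrightarrow> norm (integral (cbox x (x + h *\<^sub>R One)) f0 /\<^sub>R h ^ DIM(real) - f0 x) < \<bar>f x\<bar>" by blast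
    \<comment> \<open>Short enough for the differentiation theorem, and short enough for the
      interval to stay to the left of pi.\<close>
    define h where "h = min (d / 2) ((pi - x) / 2)"
    have x2: "0 < (pi - x) / 2" using x by simp
    have h1: "h \<le> d / 2" and h2: "h \<le> (pi - x) / 2" unfolding h_def by (rule min.cobounded1, rule min.cobounded2)
    have h3: "0 < h" using d x2 by (simp only: h_def min_less_iff_conj) simp
    have h: "0 < h" "h < d" "x + h < pi" using h1 h2 h3 x2 d by (simp_all add: field_simps)
    have "integral (cbox x (x + h *\<^sub>R One)) f0 = integral {x..x + h} f0" by simp
    also have "\<dots> = integral {x..x+h} f" by (rule integral_cong) (use h x in \<open>auto simp: f0_def\<close>)
    also have "\<dots> = integral {x<..<x+h} f" using integral_open_interval_real[of x "x + h" f] by simp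
    also have "\<dots> = (LINT y|lebesgue_on {x<..<x+h}. f y)"
    proof (rule lebesgue_integral_eq_integral[symmetric])
      show "integrable (lebesgue_on {x<..<x+h}) f"
      proof -
        have "integrable lebesgue (\<lambda>y. indicator {x<..<x+h} y *\<^sub>R f0 y)"
          by (intro integrable_mult_indicator f0) auto
        also have "(\<lambda>y. indicator {x<..<x+h} y *\<^sub>R f0 y) = (\<lambda>y. if y \<in> {x<..<x+h} then f y else 0)"
          using h x by (auto simp: f0_def indicator_def)
        finally show ?thesis by (subst (asm) Lebesgue_Measure.integrable_restrict_UNIV) auto
      qed
    qed auto
    also have "\<dots> = (LINT y|torus. f y * indicator {x<..<x+h} y)"
    proof -
      have "(LINT y|torus. f y * indicator {x<..<x+h} y) = (LINT y|torus. (if y \<in> {x<..<x+h} then f y else 0))"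
        by (intro Bochner_Integration.integral_cong) (auto simp: indicator_def)
      also have "\<dots> = (LINT y|lebesgue_on {x<..<x+h}. f y)"
        using h x by (intro integral_restrict) auto
      finally show ?thesis by simp
    qed
    also have "\<dots> = 0" using h x by (intro interval_integral_zero[OF f z]) auto
    finally have "integral (cbox x (x + h *\<^sub>R One)) f0 = 0" .
    with dd[OF h(1,2)] show False using x by (simp add: f0_def)
  qed
  have "AE x in lebesgue. x \<notin> N \<and> x \<noteq> pi \<and> x \<noteq> - pi"
  proof -
    have "negligible (N \<union> {pi, -pi})" using N by (intro negligible_Un) auto
    then have "N \<union> {pi, -pi} \<in> null_sets lebesgue" by (simp add: negligible_iff_null_sets)
    from AE_not_in[OF this] show ?thesis by eventually_elim auto
  qed
  then have "AE x in torus. x \<notin> N \<and> x \<noteq> pi \<and> x \<noteq> - pi"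
    by (intro AE_restrict_space_iff[THEN iffD2]) auto
  moreover have "AE x in torus. x \<in> {-pi..pi}" by (rule AE_I2) simp
  ultimately show ?thesis by eventually_elim (rule zero, auto)
qed

section \<open>Fourier coefficients\<close>

text \<open>The factor 1 / pi is the normalization for k >= 1; at k = 0 the constant mode would ask
  for 1 / (2 pi).\<close>

definition fcoef :: "nat \<Rightarrow> (real \<Rightarrow> real) \<Rightarrow> nat \<Rightarrow> real" where
  "fcoef p f k = (LINT x|torus. f x * tr p k x) / pi"

lemma ftc_torus:
  fixes f F :: "real \<Rightarrow> real"
  assumes "\<And>x. (F has_real_derivative f x) (at x)" "continuous_on UNIV f"
  shows "(LINT x|torus. f x) = F pi - F (- pi)"
proof -
  have "(f has_integral F pi - F (- pi)) {-pi..pi}"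
    using assms(1) by (intro fundamental_theorem_of_calculus)
      (auto simp: has_real_derivative_iff_has_vector_derivative[symmetric] intro: has_field_derivative_at_within)
  then show ?thesis
    by (subst lebesgue_integral_eq_integral) (auto intro: integrable_torus_continuous[OF assms(2)] integral_unique)
qed

lemma periodic_minus_pi: "periodic f \<Longrightarrow> f pi = f (- pi)"
  unfolding periodic_def by (metis add.commute add_uminus_conv_diff diff_add_cancel mult_2 uminus_add_conv_diff add.assoc)

lemma integral_tr: "k \<noteq> 0 \<Longrightarrow> (LINT x|torus. tr p k x) = 0"
proof -
  assume k: "k \<noteq> 0"
  \<comment> \<open>An antiderivative has phase p + 3, because differentiation raises this to p + 4,
    a full turn beyond p.\<close>
  have "(LINT x|torus. real k * tr (Suc (p + 3)) k x) = tr (p + 3) k pi - tr (p + 3) k (- pi)"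
    by (intro ftc_torus tr_has_derivative continuous_intros)
  also have "\<dots> = 0" using periodic_minus_pi[of "tr (p + 3) k"] tr_periodic by (simp add: periodic_def)
  finally have "(LINT x|torus. tr (Suc (p + 3)) k x) = 0" using k by simp
  moreover have "tr (Suc (p + 3)) k = tr p k" by (rule ext) (simp add: tr_Suc_Suc numeral_eq_Suc)
  ultimately show ?thesis by simp
qed

lemma tr_0_right: "tr p 0 x = sin (real p * (pi / 2))"
  by (simp add: tr_def)

lemma integrable_tr_mult: "integrable torus (\<lambda>x. tr p k x * tr p' k' x)"
  by (intro integrable_torus_continuous continuous_intros)

lemma measure_torus: "measure torus (space torus) = 2 * pi"
  by (simp add: measure_restrict_space)

lemma integral_tr_mult:
  assumes "l \<le> k" "k \<noteq> 0"
  shows "(LINT x|torus. tr p k x * tr p' l x) = (if k = l then pi * sin (real (p + 3 * p' + 1) * (pi / 2)) else 0)"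
proof -
  have "(LINT x|torus. tr p k x * tr p' l x) = (LINT x|torus. 1/2 * tr (p + 3 * p' + 1) (k - l) x - 1/2 * tr (p + p' + 1) (k + l) x)"
    by (simp only: tr_mult[OF assms(1)])
  also have "\<dots> = 1/2 * (LINT x|torus. tr (p + 3 * p' + 1) (k - l) x) - 1/2 * (LINT x|torus. tr (p + p' + 1) (k + l) x)"
    by (subst Bochner_Integration.integral_diff) (auto intro!: integrable_torus_continuous continuous_intros)
  also have "\<dots> = 1/2 * (LINT x|torus. tr (p + 3 * p' + 1) (k - l) x)"
    using assms integral_tr[of "k + l" "p + p' + 1"] by simp
  also have "\<dots> = (if k = l then pi * sin (real (p + 3 * p' + 1) * (pi / 2)) else 0)"
  proof (cases "k = l")
    case True
    then show ?thesis using measure_torus by (simp add: tr_0_right)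
  next
    case False
    then have "k - l \<noteq> 0" using assms by simp
    then show ?thesis using False integral_tr[of "k - l" "p + 3 * p' + 1"] by simp
  qed
  finally show ?thesis .
qed

lemma tr_orthogonal: "k \<noteq> 0 \<Longrightarrow> l \<noteq> 0 \<Longrightarrow> (LINT x|torus. tr p k x * tr p l x) = (if k = l then pi else 0)"
proof -
  assume kl: "k \<noteq> 0" "l \<noteq> 0"
  have s: "sin (real (p + 3 * p + 1) * (pi / 2)) = 1"
  proof -
    have "real (p + 3 * p + 1) * (pi / 2) = pi / 2 + 2 * real p * pi" by (simp add: field_simps)
    then show ?thesis by (simp only: sin_add sin_2npi cos_2npi) simp
  qed
  show ?thesis
  proof (cases "l \<le> k")
    case True
    show ?thesis using integral_tr_mult[OF True kl(1), of p p] by (simp only: s mult_1_right)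
  next
    case False
    then have "(LINT x|torus. tr p l x * tr p k x) = 0" using integral_tr_mult[of k l p p] kl by simp
    then show ?thesis using False by (simp add: mult.commute)
  qed
qed

lemma tr_orthogonal_Suc: "(LINT x|torus. tr p k x * tr (Suc p) l x) = 0"
proof (cases "k = 0 \<and> l = 0")
  case True
  have "tr p 0 x * tr (Suc p) 0 x = 1/2 * sin (real p * pi)" for x
    using sin_double[of "real p * (pi / 2)"] by (simp add: tr_def[of p] tr_Suc)
  then have "(\<lambda>x. tr p 0 x * tr (Suc p) 0 x) = (\<lambda>x. 0)" by (intro ext) simp
  then show ?thesis using True by simp
next
  case False
  have s1: "sin (real (p + 3 * Suc p + 1) * (pi / 2)) = 0"
  proof -
    have "real (p + 3 * Suc p + 1) * (pi / 2) = real (2 * p + 2) * pi" by (simp add: field_simps)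
    then show ?thesis by (simp only: sin_npi)
  qed
  have s2: "sin (real (Suc p + 3 * p + 1) * (pi / 2)) = 0"
  proof -
    have "real (Suc p + 3 * p + 1) * (pi / 2) = real (2 * p + 1) * pi" by (simp add: field_simps)
    then show ?thesis by (simp only: sin_npi)
  qed
  show ?thesis
  proof (cases "l \<le> k")
    case True
    then show ?thesis using integral_tr_mult[of l k p "Suc p"] False by (simp only: s1) auto
  next
    case l: False
    then have "(LINT x|torus. tr (Suc p) l x * tr p k x) = 0"
      using integral_tr_mult[of k l "Suc p" p] False by (simp only: s2) auto
    then show ?thesis by (simp add: mult.commute)
  qed
qed

lemma integral_sum_tr_mult:
  assumes "finite S" "0 \<notin> S"
  shows "(LINT x|torus. (\<Sum>k\<in>S. b k * tr p k x) * tr p l x) = (if l \<in> S then pi * b l else 0)"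
    and "(LINT x|torus. (\<Sum>k\<in>S. b k * tr p k x) * tr (Suc p) l x) = 0"
proof -
  have *: "(LINT x|torus. (\<Sum>k\<in>S. b k * tr p k x) * tr q l x) = (\<Sum>k\<in>S. b k * (LINT x|torus. tr p k x * tr q l x))" for q
    unfolding sum_distrib_right mult.assoc using integrable_tr_mult
    by (subst Bochner_Integration.integral_sum) auto
  show "(LINT x|torus. (\<Sum>k\<in>S. b k * tr p k x) * tr (Suc p) l x) = 0"
    unfolding * by (simp add: tr_orthogonal_Suc)
  show "(LINT x|torus. (\<Sum>k\<in>S. b k * tr p k x) * tr p l x) = (if l \<in> S then pi * b l else 0)"
  proof (cases "l = 0")
    case True
    have "(LINT x|torus. tr p k x * tr p 0 x) = 0" if "k \<in> S" for k
    proof -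
      have "k \<noteq> 0" using that assms by metis
      then show ?thesis by (simp add: tr_0_right integral_tr)
    qed
    then show ?thesis unfolding * using True assms by (simp)
  next
    case False
    have "b k * (LINT x|torus. tr p k x * tr p l x) = (if k = l then pi * b l else 0)" if "k \<in> S" for k
    proof -
      have "k \<noteq> 0" using that assms by metis
      then show ?thesis using False by (simp add: tr_orthogonal)
    qed
    then show ?thesis unfolding * using assms by (simp add: sum.delta)
  qed
qed

lemma continuous_on_sum_tr: "continuous_on A (\<lambda>x. \<Sum>k\<in>S. b k * tr p k x)"
  by (intro continuous_intros)

lemma integral_sum_tr_square:
  assumes "finite S" "0 \<notin> S"
  shows "(LINT x|torus. (\<Sum>k\<in>S. b k * tr p k x)\<^sup>2) = pi * (\<Sum>k\<in>S. (b k)\<^sup>2)"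
proof -
  define g where "g x = (\<Sum>k\<in>S. b k * tr p k x)" for x
  have "(LINT x|torus. (g x)\<^sup>2) = (LINT x|torus. (\<Sum>l\<in>S. b l * (g x * tr p l x)))"
    unfolding power2_eq_square by (subst (2) g_def) (simp add: sum_distrib_left mult_ac)
  also have "\<dots> = (\<Sum>l\<in>S. b l * (LINT x|torus. g x * tr p l x))"
    by (subst Bochner_Integration.integral_sum)
       (auto intro!: integrable_torus_continuous continuous_intros simp: g_def)
  also have "\<dots> = (\<Sum>l\<in>S. b l * (pi * b l))"
    unfolding g_def by (intro sum.cong refl) (simp add: integral_sum_tr_mult[OF assms])
  finally show ?thesis by (simp add: g_def sum_distrib_left power2_eq_square mult_ac)
qed

section \<open>Bessel's inequality and the Riesz-Fischer theorem\<close>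

lemma L2_integrable:
  fixes f :: "real \<Rightarrow> real"
  assumes "f \<in> borel_measurable torus" "integrable torus (\<lambda>x. (f x)\<^sup>2)"
  shows "integrable torus f"
proof (rule Bochner_Integration.integrable_bound[where f = "\<lambda>x. 1 + (f x)\<^sup>2"])
  show "integrable torus (\<lambda>x. 1 + (f x)\<^sup>2)"
    by (rule Bochner_Integration.integrable_add[OF _ assms(2)]) (rule integrable_torus_continuous, auto)
  have "\<bar>y\<bar> \<le> \<bar>1 + y\<^sup>2\<bar>" for y :: real
    using sum_squares_bound[of "\<bar>y\<bar>" 1] by auto
  then show "AE x in torus. norm (f x) \<le> norm (1 + (f x)\<^sup>2)" by auto
qed (use assms in auto)

lemma bessel:
  fixes f :: "real \<Rightarrow> real"
  assumes f: "f \<in> borel_measurable torus" "integrable torus (\<lambda>x. (f x)\<^sup>2)" and S: "finite S" "0 \<notin> S"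
  shows "pi * (\<Sum>k\<in>S. (fcoef p f k)\<^sup>2) \<le> (LINT x|torus. (f x)\<^sup>2)"
proof -
  have fi: "integrable torus f" by (rule L2_integrable[OF f])
  define c where "c = fcoef p f"
  define g where "g x = (\<Sum>k\<in>S. c k * tr p k x)" for x
  have gc: "continuous_on UNIV g" unfolding g_def by (rule continuous_on_sum_tr)
  have fg: "(LINT x|torus. f x * g x) = pi * (\<Sum>k\<in>S. (c k)\<^sup>2)"
  proof -
    have "(LINT x|torus. f x * g x) = (LINT x|torus. (\<Sum>k\<in>S. c k * (f x * tr p k x)))"
      by (simp add: g_def sum_distrib_left mult_ac)
    also have "\<dots> = (\<Sum>k\<in>S. c k * (LINT x|torus. f x * tr p k x))"
      by (subst Bochner_Integration.integral_sum) (auto intro!: integrable_torus_mult fi continuous_intros)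
    also have "\<dots> = (\<Sum>k\<in>S. c k * (pi * c k))" by (simp add: c_def fcoef_def)
    finally show ?thesis by (simp add: sum_distrib_left power2_eq_square mult_ac)
  qed
  have gg: "(LINT x|torus. (g x)\<^sup>2) = pi * (\<Sum>k\<in>S. (c k)\<^sup>2)"
    unfolding g_def by (rule integral_sum_tr_square[OF S])
  have i: "integrable torus (\<lambda>x. f x * g x)" by (rule integrable_torus_mult[OF fi gc])
  have i2: "integrable torus (\<lambda>x. (g x)\<^sup>2)" using gc by (intro integrable_torus_continuous continuous_intros)
  have "0 \<le> (LINT x|torus. (f x - g x)\<^sup>2)" by (intro integral_nonneg_AE) auto
  also have "\<dots> = (LINT x|torus. (f x)\<^sup>2 + (g x)\<^sup>2 - 2 * (f x * g x))"
    by (simp add: power2_diff mult.assoc)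
  also have "\<dots> = (LINT x|torus. (f x)\<^sup>2) + (LINT x|torus. (g x)\<^sup>2) - 2 * (LINT x|torus. f x * g x)"
    using i i2 f by simp
  finally show ?thesis unfolding fg gg c_def by simp
qed

text \<open>By monotone convergence the sum of the absolute values has a finite integral, so it is
  finite almost everywhere.\<close>

lemma AE_summable_integral:
  fixes h :: "nat \<Rightarrow> 'a \<Rightarrow> real"
  assumes h: "\<And>j. integrable M (h j)" and s: "summable (\<lambda>j. LINT x|M. \<bar>h j x\<bar>)"
  shows "AE x in M. summable (\<lambda>j. \<bar>h j x\<bar>)"
proof -
  have [measurable]: "h j \<in> borel_measurable M" for j using h by auto
  have "(\<integral>\<^sup>+x. (\<Sum>j. ennreal \<bar>h j x\<bar>) \<partial>M) = (\<Sum>j. \<integral>\<^sup>+x. ennreal \<bar>h j x\<bar> \<partial>M)"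
    by (rule nn_integral_suminf) measurable
  also have "\<dots> = (\<Sum>j. ennreal (LINT x|M. \<bar>h j x\<bar>))"
    using h by (subst nn_integral_eq_integral) auto
  also have "\<dots> = ennreal (\<Sum>j. LINT x|M. \<bar>h j x\<bar>)" by (rule suminf_ennreal2[OF _ s]) (auto intro: integral_nonneg_AE)
  finally have "(\<integral>\<^sup>+x. (\<Sum>j. ennreal \<bar>h j x\<bar>) \<partial>M) \<noteq> \<infinity>" by simp
  then have "AE x in M. (\<Sum>j. ennreal \<bar>h j x\<bar>) \<noteq> \<infinity>"
    by (rule nn_integral_PInf_AE[rotated]) measurable
  then show ?thesis by eventually_elim (rule summable_suminf_not_top, auto)
qed

text \<open>The series is summed in blocks whose tails decay geometrically, which turns convergence in
  \<open>L\<^sup>2\<close> into convergence almost everywhere.\<close>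

lemma riesz_fischer:
  assumes b: "summable (\<lambda>k. (b k)\<^sup>2)" "b 0 = 0"
  obtains G where "periodic G" "integrable torus G" "integrable torus (\<lambda>x. (G x)\<^sup>2)"
    "(LINT x|torus. (G x)\<^sup>2) \<le> pi * (\<Sum>k. (b k)\<^sup>2)"
    "\<And>k. fcoef p G k = b k" "\<And>k. fcoef (Suc p) G k = 0"
proof -
  have "\<exists>N. \<forall>m\<ge>N. \<forall>n. (\<Sum>k=m..<n. (b k)\<^sup>2) < (1/4) ^ j" for j :: nat
  proof -
    have "(0::real) < (1/4) ^ j" by simp
    then obtain N where N: "\<And>m n. m \<ge> N \<Longrightarrow> norm (\<Sum>k=m..<n. (b k)\<^sup>2) < (1/4) ^ j"
      using b(1) unfolding summable_Cauchy by presburger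
    have "(\<Sum>k=m..<n. (b k)\<^sup>2) < (1/4) ^ j" if "m \<ge> N" for m n
      using N[OF that, of n] by (simp only: real_norm_def abs_less_iff)
    then show ?thesis by blast
  qed
  then obtain r where r: "\<And>j m n. m \<ge> r j \<Longrightarrow> (\<Sum>k=m..<n. (b k)\<^sup>2) < (1/4) ^ j" by metis
  \<comment> \<open>Summing the thresholds plus one gives a strictly increasing \<open>R\<close>
    with \<open>r j \<le> R j\<close> and \<open>j < R j\<close>. The first block starts at 1, which
    keeps the frequency 0 out of all blocks.\<close>
  define R where "R j = (\<Sum>i\<le>j. Suc (r i))" for j
  have Rr: "r j \<le> R j" for j unfolding R_def using member_le_sum[of j "{..j}" "\<lambda>i. Suc (r i)"] by simp
  have RS: "R j < R (Suc j)" for j by (simp add: R_def)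
  have Rj: "j < R j" for j by (induction j) (auto simp: R_def)
  define B where "B j = (case j of 0 \<Rightarrow> {1..<R 0} | Suc i \<Rightarrow> {R i..<R (Suc i)})" for j
  have fB: "finite (B j)" for j by (simp add: B_def split: nat.split)
  have B0: "0 \<notin> B j" for j
  proof (cases j)
    case (Suc i)
    then show ?thesis using Rj[of i] by (simp add: B_def)
  qed (simp add: B_def)
  define h where "h j x = (\<Sum>k\<in>B j. b k * tr p k x)" for j x
  have hc: "continuous_on A (h j)" for A j unfolding h_def by (rule continuous_on_sum_tr)
  have hi: "integrable torus (h j)" for j by (rule integrable_torus_continuous[OF hc])
  have partial: "(\<Sum>j\<le>J. h j x) = (\<Sum>k\<in>{1..<R J}. b k * tr p k x)" for J x
  proof (induction J)
    case 0
    then show ?case by (simp add: h_def B_def)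
  next
    case (Suc J)
    have "1 \<le> R J" "R J \<le> R (Suc J)" using Rj[of J] RS[of J] by auto
    then show ?case using Suc by (simp add: h_def[of "Suc J"] B_def sum.atLeastLessThan_concat)
  qed
  \<comment> \<open>Uses |y| <= 2^j y^2 / 2 + (1/2)^j / 2. The square integral of the block is at
    most pi (1/4)^j, so both terms are of order (1/2)^j.\<close>
  have hL1: "(LINT x|torus. \<bar>h (Suc j) x\<bar>) \<le> 2 * pi * (1/2) ^ j" for j
  proof -
    have "(LINT x|torus. \<bar>h (Suc j) x\<bar>) \<le> (LINT x|torus. 2 ^ j / 2 * (h (Suc j) x)\<^sup>2 + (1/2) ^ j / 2)"
    proof (rule integral_mono)
      show "integrable torus (\<lambda>x. \<bar>h (Suc j) x\<bar>)" using hi by auto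
      show "integrable torus (\<lambda>x. 2 ^ j / 2 * (h (Suc j) x)\<^sup>2 + (1/2) ^ j / 2)"
        by (intro integrable_torus_continuous continuous_intros hc)
      fix x
      define y where "y = \<bar>h (Suc j) x\<bar>"
      have "0 \<le> (2 ^ j * y - 1)\<^sup>2" by simp
      then have "2 * (2 ^ j * y) \<le> (2 ^ j * y)\<^sup>2 + 1" by (simp add: power2_diff)
      then have "(1/2) ^ j * (2 * (2 ^ j * y)) \<le> (1/2) ^ j * ((2 ^ j * y)\<^sup>2 + 1)" by (intro mult_left_mono) auto
      then show "\<bar>h (Suc j) x\<bar> \<le> 2 ^ j / 2 * (h (Suc j) x)\<^sup>2 + (1/2) ^ j / 2"
        unfolding y_def by (simp add: power_one_over field_simps power2_eq_square)
    qed
    also have "\<dots> = 2 ^ j / 2 * (LINT x|torus. (h (Suc j) x)\<^sup>2) + pi * (1/2) ^ j"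
      using hc measure_torus by (subst Bochner_Integration.integral_add) (auto intro!: integrable_torus_continuous continuous_intros)
    also have "(LINT x|torus. (h (Suc j) x)\<^sup>2) = pi * (\<Sum>k\<in>B (Suc j). (b k)\<^sup>2)"
      unfolding h_def by (rule integral_sum_tr_square[OF fB B0])
    also have "2 ^ j / 2 * (pi * (\<Sum>k\<in>B (Suc j). (b k)\<^sup>2)) \<le> 2 ^ j / 2 * (pi * (1/4) ^ j)"
      using r[OF Rr, of j "R (Suc j)"] by (intro mult_left_mono) (auto simp: B_def)
    also have "2 ^ j / 2 * (pi * (1/4) ^ j) + pi * (1/2) ^ j = 3/2 * pi * (1/2) ^ j"
    proof -
      have "(2::real) ^ j * (1/4) ^ j = (1/2) ^ j" by (simp flip: power_mult_distrib)
      then show ?thesis by (simp add: algebra_simps)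
    qed
    also have "\<dots> \<le> 2 * pi * (1/2) ^ j" by (intro mult_right_mono) auto
    finally show ?thesis by simp
  qed
  have hs: "summable (\<lambda>j. LINT x|torus. \<bar>h j x\<bar>)"
  proof (subst summable_Suc_iff[symmetric], rule summable_comparison_test'[where N = 0])
    show "summable (\<lambda>j. 2 * pi * (1/2::real) ^ j)" by (intro summable_mult summable_geometric) auto
    show "norm (LINT x|torus. \<bar>h (Suc j) x\<bar>) \<le> 2 * pi * (1/2) ^ j" for j
      using hL1[of j] by (subst real_norm_def, subst abs_of_nonneg) (auto intro: integral_nonneg_AE)
  qed
  have AEs: "AE x in torus. summable (\<lambda>j. \<bar>h j x\<bar>)" by (rule AE_summable_integral[OF hi hs])
  define G where "G x = (\<Sum>j. h j x)" for x
  have Gi: "integrable torus G" unfolding G_def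
    using AEs hs hi by (intro integrable_suminf) auto
  have Gper: "periodic G" by (simp add: periodic_def G_def h_def tr_periodic)
  have coef: "(\<lambda>j. LINT x|torus. h j x * tr q k x) sums (LINT x|torus. G x * tr q k x)" for q k
  proof -
    have eq: "AE x in torus. (\<Sum>j. h j x * tr q k x) = G x * tr q k x"
      using AEs by eventually_elim (simp add: G_def suminf_mult2 summable_rabs_cancel)
    have ih: "integrable torus (\<lambda>x. h j x * tr q k x)" for j by (intro integrable_torus_continuous continuous_intros hc)
    have "(\<lambda>j. LINT x|torus. h j x * tr q k x) sums (LINT x|torus. (\<Sum>j. h j x * tr q k x))"
    proof (rule sums_integral[OF ih])
      show "AE x in torus. summable (\<lambda>j. norm (h j x * tr q k x))"
        using AEs
      proof eventually_elim
        case (elim x)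
        then show ?case by (simp add: abs_mult summable_mult2)
      qed
      show "summable (\<lambda>j. LINT x|torus. norm (h j x * tr q k x))"
      proof (rule summable_comparison_test'[OF hs, of 0])
        fix j
        have "(LINT x|torus. norm (h j x * tr q k x)) \<le> (LINT x|torus. \<bar>h j x\<bar>)"
        proof (rule integral_mono)
          show "integrable torus (\<lambda>x. norm (h j x * tr q k x))" by (rule integrable_norm[OF ih])
          show "integrable torus (\<lambda>x. \<bar>h j x\<bar>)" using hi by auto
          show "norm (h j x * tr q k x) \<le> \<bar>h j x\<bar>" for x
            by (simp add: abs_mult mult_left_le tr_le_1)
        qed
        moreover have "0 \<le> (LINT x|torus. norm (h j x * tr q k x))" by (intro integral_nonneg_AE) auto
        ultimately show "norm (LINT x|torus. norm (h j x * tr q k x)) \<le> (LINT x|torus. \<bar>h j x\<bar>)"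
          unfolding real_norm_def[of "LINT x|torus. norm (h j x * tr q k x)"] by linarith
      qed
    qed
    also have "(LINT x|torus. (\<Sum>j. h j x * tr q k x)) = (LINT x|torus. G x * tr q k x)"
      using eq Gi ih by (intro integral_cong_AE) (auto intro!: borel_measurable_suminf borel_measurable_integrable integrable_torus_mult continuous_intros)
    finally show ?thesis .
  qed
  have cp: "fcoef p G k = b k" for k
  proof -
    have "(\<lambda>J. \<Sum>j<J. LINT x|torus. h j x * tr p k x) \<longlonglongrightarrow> (LINT x|torus. G x * tr p k x)"
      using coef[of p k] unfolding sums_def .
    then have "(\<lambda>J. \<Sum>j<Suc J. LINT x|torus. h j x * tr p k x) \<longlonglongrightarrow> (LINT x|torus. G x * tr p k x)"
      by (rule LIMSEQ_Suc)
    moreover have "(\<Sum>j<Suc J. LINT x|torus. h j x * tr p k x) = pi * b k" if "J \<ge> k" for J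
    proof -
      have "(\<Sum>j<Suc J. LINT x|torus. h j x * tr p k x) = (LINT x|torus. (\<Sum>j\<le>J. h j x) * tr p k x)"
        unfolding sum_distrib_right lessThan_Suc_atMost
        by (subst Bochner_Integration.integral_sum) (auto intro!: integrable_torus_continuous continuous_intros hc)
      also have "\<dots> = (if k \<in> {1..<R J} then pi * b k else 0)"
        unfolding partial by (rule integral_sum_tr_mult) auto
      also have "\<dots> = pi * b k" using Rj[of J] that b(2) by (cases "k = 0") auto
      finally show ?thesis .
    qed
    then have "(\<lambda>J. \<Sum>j<Suc J. LINT x|torus. h j x * tr p k x) \<longlonglongrightarrow> pi * b k"
      by (intro tendsto_eventually) (auto simp: eventually_sequentially intro!: exI[of _ k])
    ultimately have "(LINT x|torus. G x * tr p k x) = pi * b k" by (rule LIMSEQ_unique)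
    then show ?thesis by (simp add: fcoef_def)
  qed
  have cSp: "fcoef (Suc p) G k = 0" for k
  proof -
    have "(LINT x|torus. h j x * tr (Suc p) k x) = 0" for j
      unfolding h_def by (rule integral_sum_tr_mult(2)[OF fB B0])
    then have "(LINT x|torus. G x * tr (Suc p) k x) = 0"
      using sums_unique[OF coef[of "Suc p" k]] by simp
    then show ?thesis by (simp add: fcoef_def)
  qed
  define s where "s J x = (\<Sum>j\<le>J. h j x)" for J x
  have [measurable]: "G \<in> borel_measurable torus" "s J \<in> borel_measurable torus" for J
    using Gi hc by (auto simp: s_def intro!: measurable_torus_continuous continuous_intros)
  \<comment> \<open>The block sums converge almost everywhere, so Fatou's lemma carries the bound on
    their squares over to \<open>G\<close>.\<close>
  have slim: "AE x in torus. (\<lambda>J. s J x) \<longlonglongrightarrow> G x"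
    using AEs by eventually_elim (simp add: s_def G_def summable_LIMSEQ' summable_rabs_cancel)
  have "(\<integral>\<^sup>+x. ennreal ((G x)\<^sup>2) \<partial>torus) = (\<integral>\<^sup>+x. liminf (\<lambda>J. ennreal ((s J x)\<^sup>2)) \<partial>torus)"
  proof (rule nn_integral_cong_AE)
    show "AE x in torus. ennreal ((G x)\<^sup>2) = liminf (\<lambda>J. ennreal ((s J x)\<^sup>2))"
      using slim
    proof eventually_elim
      case (elim x)
      then have "(\<lambda>J. ennreal ((s J x)\<^sup>2)) \<longlonglongrightarrow> ennreal ((G x)\<^sup>2)" by (intro tendsto_intros)
      then show ?case by (intro lim_imp_Liminf[symmetric]) auto
    qed
  qed
  also have "\<dots> \<le> liminf (\<lambda>J. \<integral>\<^sup>+x. ennreal ((s J x)\<^sup>2) \<partial>torus)" by (rule nn_integral_liminf) measurable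
  also have "\<dots> \<le> ennreal (pi * (\<Sum>k. (b k)\<^sup>2))"
  proof -
    have "(\<integral>\<^sup>+x. ennreal ((s J x)\<^sup>2) \<partial>torus) \<le> ennreal (pi * (\<Sum>k. (b k)\<^sup>2))" for J
    proof -
      have "(\<integral>\<^sup>+x. ennreal ((s J x)\<^sup>2) \<partial>torus) = ennreal (LINT x|torus. (s J x)\<^sup>2)"
        by (rule nn_integral_eq_integral) (auto simp: s_def intro!: integrable_torus_continuous continuous_intros hc)
      also have "(LINT x|torus. (s J x)\<^sup>2) = pi * (\<Sum>k\<in>{1..<R J}. (b k)\<^sup>2)"
        unfolding s_def partial by (rule integral_sum_tr_square) auto
      also have "ennreal \<dots> \<le> ennreal (pi * (\<Sum>k. (b k)\<^sup>2))"
        using b by (intro ennreal_leI mult_left_mono sum_le_suminf) auto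
      finally show ?thesis .
    qed
    then show ?thesis by (intro Liminf_le always_eventually allI) auto
  qed
  finally have fatou: "(\<integral>\<^sup>+x. ennreal ((G x)\<^sup>2) \<partial>torus) \<le> ennreal (pi * (\<Sum>k. (b k)\<^sup>2))" .
  have G2: "integrable torus (\<lambda>x. (G x)\<^sup>2)"
    by (rule integrableI_nonneg) (use fatou in \<open>auto simp: order.strict_trans1\<close>)
  have "ennreal (LINT x|torus. (G x)\<^sup>2) \<le> ennreal (pi * (\<Sum>k. (b k)\<^sup>2))"
    using fatou by (subst nn_integral_eq_integral[symmetric]) (use G2 in auto)
  then have "(LINT x|torus. (G x)\<^sup>2) \<le> pi * (\<Sum>k. (b k)\<^sup>2)"
    using b by (subst (asm) ennreal_le_iff) (auto intro!: suminf_nonneg mult_nonneg_nonneg)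
  then show ?thesis using that[OF Gper Gi G2 _ cp cSp] by blast
qed

section \<open>Weak derivatives and Sobolev norms\<close>

text \<open>By \<open>tr_parity\<close> only the parity of the phase matters, and p and
  \<open>Suc p\<close> represent both parities.\<close>

lemma integral_tr_all_phases:
  assumes p: "\<And>k. (LINT x|torus. f x * tr p k x) = 0" and Sp: "\<And>k. (LINT x|torus. f x * tr (Suc p) k x) = 0"
  shows "(LINT x|torus. f x * tr q k x) = 0"
proof -
  have red: "(LINT x|torus. f x * tr (if even p' then 0 else 1) k x) = 0 \<longleftrightarrow> (LINT x|torus. f x * tr p' k x) = 0" for p' k
  proof -
    obtain c :: real where c: "\<bar>c\<bar> = 1" "\<And>k x. tr p' k x = c * tr (if even p' then 0 else 1) k x"
      using tr_parity[of p'] by blast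
    have "(LINT x|torus. f x * tr p' k x) = (LINT x|torus. c * (f x * tr (if even p' then 0 else 1) k x))"
      by (subst c(2)) (simp add: mult_ac)
    also have "\<dots> = c * (LINT x|torus. f x * tr (if even p' then 0 else 1) k x)" by simp
    finally show ?thesis using c(1) by auto
  qed
  show ?thesis
  proof (cases "even q \<longleftrightarrow> even p")
    case True
    then show ?thesis using red[of p k] red[of q k] p[of k] by simp
  next
    case False
    then show ?thesis using red[of "Suc p" k] red[of q k] Sp[of k] by simp
  qed
qed

lemma AE_eq_if_integrals_eq:
  assumes f: "integrable torus f" and g: "integrable torus g"
    and eq: "\<And>p k. (LINT x|torus. f x * tr p k x) = (LINT x|torus. g x * tr p k x)"
  shows "AE x in torus. f x = g x"
proof -
  have "AE x in torus. f x - g x = 0"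
  proof (rule integrable_AE_eq_zero)
    show "integrable torus (\<lambda>x. f x - g x)" using f g by simp
    fix p k
    have "(LINT x|torus. (f x - g x) * tr p k x) = (LINT x|torus. f x * tr p k x) - (LINT x|torus. g x * tr p k x)"
      unfolding left_diff_distrib using f g
      by (intro Bochner_Integration.integral_diff integrable_torus_mult continuous_intros)
    then show "(LINT x|torus. (f x - g x) * tr p k x) = 0" using eq by simp
  qed
  then show ?thesis by eventually_elim simp
qed

lemma integral_cong_AE_mult:
  fixes f g h :: "real \<Rightarrow> real"
  assumes "integrable torus f" "integrable torus g" "continuous_on UNIV h" "AE x in torus. f x = g x"
  shows "(LINT x|torus. f x * h x) = (LINT x|torus. g x * h x)"
  using assms by (intro integral_cong_AE borel_measurable_integrable integrable_torus_mult) auto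

lemma fcoef_cong_AE:
  assumes "integrable torus f" "integrable torus g" "AE x in torus. f x = g x"
  shows "fcoef p f k = fcoef p g k"
  unfolding fcoef_def using integral_cong_AE_mult[OF assms(1,2) _ assms(3)] continuous_on_tr by metis

lemma has_weak_deriv_tr:
  assumes "has_weak_deriv f g"
  shows "(LINT x|torus. f x * (real k * tr (Suc p) k x)) = - (LINT x|torus. g x * tr p k x)"
proof -
  have "(LINT x|torus. f x * deriv (tr p k) x) = - (LINT x|torus. g x * tr p k x)"
    using assms test_fun_tr unfolding has_weak_deriv_def by blast
  then show ?thesis by (simp only: deriv_tr)
qed

lemma has_weak_deriv_fcoef:
  assumes "has_weak_deriv f g"
  shows "real k * fcoef (Suc p) f k = - fcoef p g k"
proof -
  have "(LINT x|torus. f x * (real k * tr (Suc p) k x)) = (LINT x|torus. real k * (f x * tr (Suc p) k x))"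
    by (simp add: mult_ac)
  also have "\<dots> = real k * (LINT x|torus. f x * tr (Suc p) k x)" by simp
  finally have e: "real k * (LINT x|torus. f x * tr (Suc p) k x) = - (LINT x|torus. g x * tr p k x)"
    using has_weak_deriv_tr[OF assms, of k p] by simp
  show ?thesis unfolding fcoef_def times_divide_eq_right e by simp
qed

text \<open>The functions \<open>tr p k\<close> are test functions, and together they determine an
  integrable function up to a null set. This makes the choice in \<open>wderiv\<close>
  harmless.\<close>

lemma has_weak_deriv_unique:
  assumes "has_weak_deriv f g" "has_weak_deriv f g'"
  shows "AE x in torus. g x = g' x"
proof (rule AE_eq_if_integrals_eq)
  show "integrable torus g" "integrable torus g'" using assms by (auto simp: has_weak_deriv_def)
  show "(LINT x|torus. g x * tr p k x) = (LINT x|torus. g' x * tr p k x)" for p k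
    using has_weak_deriv_tr[OF assms(1), of k p] has_weak_deriv_tr[OF assms(2), of k p] by simp
qed

lemma continuous_test_fun:
  assumes "test_fun \<phi>"
  shows "continuous_on UNIV \<phi>" "continuous_on UNIV (deriv \<phi>)" "periodic (deriv \<phi>)"
    "(\<phi> has_real_derivative deriv \<phi> x) (at x)"
proof -
  have d: "(deriv ^^ n) \<phi> differentiable (at x)" for n x using assms by (auto simp: test_fun_def)
  have d0: "\<phi> differentiable (at x)" for x using d[of 0] by simp
  have d1: "deriv \<phi> differentiable (at x)" for x using d[of 1] by simp
  show "continuous_on UNIV \<phi>" "continuous_on UNIV (deriv \<phi>)"
    using d0 d1 by (auto simp: continuous_on_eq_continuous_at differentiable_imp_continuous_within)
  show der: "(\<phi> has_real_derivative deriv \<phi> x) (at x)" for x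
    using d0[of x] by (metis DERIV_deriv_iff_real_differentiable)
  show "periodic (deriv \<phi>)"
    unfolding periodic_def
  proof
    fix x
    have "((\<lambda>y. \<phi> (y + 2 * pi)) has_real_derivative deriv \<phi> (x + 2 * pi)) (at x)"
      using der[of "x + 2 * pi"] by (simp add: DERIV_shift)
    moreover have "(\<lambda>y. \<phi> (y + 2 * pi)) = \<phi>" using assms by (auto simp: test_fun_def periodic_def)
    ultimately show "deriv \<phi> (x + 2 * pi) = deriv \<phi> x" using DERIV_unique[OF _ der[of x]] by metis
  qed
qed

text \<open>A periodic antiderivative exists only after the mean c has been removed. Each
  oscillating term then integrates to a term of the same kind, for which the integration by parts is
  the hypothesis.\<close>

lemma trigp_antiderivative:
  assumes f: "integrable torus f" and g: "integrable torus g"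
    and w: "\<And>p k. (LINT x|torus. f x * (real k * tr (Suc p) k x)) = - (LINT x|torus. g x * tr p k x)"
    and P: "trigp P"
  shows "\<exists>Q c. trigp Q \<and> (\<forall>x. (Q has_real_derivative P x - c) (at x)) \<and>
     (LINT x|torus. f x * (P x - c)) = - (LINT x|torus. g x * Q x)"
  using P
proof (induction rule: trigp.induct)
  case (trigp_tr a p k)
  show ?case
  proof (cases "k = 0")
    case True
    then show ?thesis
      by (intro exI[of _ "\<lambda>x. 0"] exI[of _ "a * tr p k 0"]) (auto simp: tr_0_right trigp_const)
  next
    case False
    define Q where "Q x = a / real k * tr (p + 3) k x" for x
    have e: "tr (Suc (p + 3)) k = tr p k" by (rule ext) (simp add: tr_Suc_Suc numeral_eq_Suc)
    have dq: "(Q has_real_derivative a / real k * (real k * tr (Suc (p + 3)) k x)) (at x)" for x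
      unfolding Q_def by (intro DERIV_cmult tr_has_derivative)
    have d: "(Q has_real_derivative a * tr p k x - 0) (at x)" for x using dq[of x] False unfolding e by simp
    have "(LINT x|torus. f x * (a * tr p k x - 0)) = (LINT x|torus. a / real k * (f x * (real k * tr (Suc (p + 3)) k x)))"
      unfolding e by (intro Bochner_Integration.integral_cong refl) (use False in simp)
    also have "\<dots> = a / real k * (LINT x|torus. f x * (real k * tr (Suc (p + 3)) k x))"
      by (rule integral_mult_right_zero)
    also have "\<dots> = - (a / real k * (LINT x|torus. g x * tr (p + 3) k x))" unfolding w by simp
    also have "\<dots> = - (LINT x|torus. a / real k * (g x * tr (p + 3) k x))"
      by (simp only: integral_mult_right_zero)
    also have "\<dots> = - (LINT x|torus. g x * Q x)" unfolding Q_def by (simp add: mult_ac)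
    finally show ?thesis
      using d trigp.trigp_tr[of "a / real k" "p + 3" k] unfolding Q_def[symmetric] by blast
  qed
next
  case (trigp_add P1 P2)
  then obtain Q1 c1 Q2 c2 where
    1: "trigp Q1" "\<And>x. (Q1 has_real_derivative P1 x - c1) (at x)" "(LINT x|torus. f x * (P1 x - c1)) = - (LINT x|torus. g x * Q1 x)" and
    2: "trigp Q2" "\<And>x. (Q2 has_real_derivative P2 x - c2) (at x)" "(LINT x|torus. f x * (P2 x - c2)) = - (LINT x|torus. g x * Q2 x)"
    by blast
  have "(LINT x|torus. f x * (P1 x + P2 x - (c1 + c2))) = (LINT x|torus. f x * (P1 x - c1) + f x * (P2 x - c2))"
    by (simp add: algebra_simps)
  also have "\<dots> = (LINT x|torus. f x * (P1 x - c1)) + (LINT x|torus. f x * (P2 x - c2))"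
    using f trigp_add trigp_continuous
    by (intro Bochner_Integration.integral_add integrable_torus_mult continuous_on_diff continuous_on_const) auto
  also have "\<dots> = - ((LINT x|torus. g x * Q1 x) + (LINT x|torus. g x * Q2 x))" using 1 2 by simp
  also have "(LINT x|torus. g x * Q1 x) + (LINT x|torus. g x * Q2 x) = (LINT x|torus. g x * (Q1 x + Q2 x))"
    unfolding distrib_left using g 1 2 trigp_continuous
    by (intro Bochner_Integration.integral_add[symmetric] integrable_torus_mult) auto
  finally have "(LINT x|torus. f x * (P1 x + P2 x - (c1 + c2))) = - (LINT x|torus. g x * (Q1 x + Q2 x))" .
  moreover have "((\<lambda>x. Q1 x + Q2 x) has_real_derivative P1 x + P2 x - (c1 + c2)) (at x)" for x
    using DERIV_add[OF 1(2)[of x] 2(2)[of x]] by (simp add: algebra_simps)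
  ultimately show ?case using trigp.trigp_add[OF 1(1) 2(1)] by blast
qed

text \<open>The derivative of a test function is approximated by trigonometric polynomials; their
  antiderivatives then approximate the test function itself.\<close>

lemma has_weak_derivI:
  assumes per: "periodic f" "periodic g" and f: "integrable torus f" and g: "integrable torus g"
    and w: "\<And>p k. (LINT x|torus. f x * (real k * tr (Suc p) k x)) = - (LINT x|torus. g x * tr p k x)"
  shows "has_weak_deriv f g"
  unfolding has_weak_deriv_def
proof (intro conjI per f g allI impI)
  fix \<phi> assume \<phi>: "test_fun \<phi>"
  note \<phi>c = continuous_test_fun[OF \<phi>]
  \<comment> \<open>Frequency 0 shows that g has mean zero; hence a constant may be subtracted from
    the function that multiplies g, and \<open>v\<close> can be normalized at 0.\<close>
  have g0: "(LINT x|torus. g x) = 0" using w[of 0 1] by (simp add: tr_0_right)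
  define A where "A = (LINT x|torus. \<bar>f x\<bar>)"
  define B where "B = (LINT x|torus. \<bar>g x\<bar>)"
  have AB: "0 \<le> A" "0 \<le> B" by (auto simp: A_def B_def intro!: integral_nonneg_AE)
  define D where "D = (LINT x|torus. f x * deriv \<phi> x) + (LINT x|torus. g x * \<phi> x)"
  have "\<bar>D\<bar> \<le> e * (2 * A + 2 * pi * B)" if e: "e > 0" for e
  proof -
    obtain P where P: "trigp P" "\<And>x. \<bar>deriv \<phi> x - P x\<bar> < e" using trigp_dense[OF \<phi>c(3,2) e] by blast
    obtain Q c where Q: "trigp Q" "\<And>x. (Q has_real_derivative P x - c) (at x)"
      "(LINT x|torus. f x * (P x - c)) = - (LINT x|torus. g x * Q x)"
      using trigp_antiderivative[OF f g w P(1)] by blast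
    have Pc: "continuous_on UNIV P" and Qc: "continuous_on UNIV Q" using P Q trigp_continuous by auto
    define u where "u x = deriv \<phi> x - (P x - c)" for x
    define v where "v x = (\<phi> x - Q x) - (\<phi> 0 - Q 0)" for x
    have uc: "continuous_on UNIV u" unfolding u_def by (intro continuous_intros \<phi>c Pc)
    have vc: "continuous_on UNIV v" unfolding v_def by (intro continuous_intros \<phi>c Qc)
    have vd: "(v has_real_derivative u x) (at x)" for x
      unfolding v_def u_def by (auto intro!: derivative_eq_intros \<phi>c(4) Q(2))
    \<comment> \<open>The derivative of the periodic \<phi> has mean zero and \<open>P\<close> is
      within e of it, so the mean c of \<open>P\<close> is at most e in size.\<close>
    have c: "\<bar>c\<bar> \<le> e"
    proof -
      have "(LINT x|torus. u x) = v pi - v (- pi)" by (rule ftc_torus[OF vd uc])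
      also have "\<dots> = 0"
        using periodic_minus_pi[of \<phi>] periodic_minus_pi[OF trigp_periodic[OF Q(1)]] \<phi> by (simp add: v_def test_fun_def)
      finally have "0 = (LINT x|torus. (deriv \<phi> x - P x) + c)" by (simp add: u_def algebra_simps)
      also have "\<dots> = (LINT x|torus. deriv \<phi> x - P x) + 2 * pi * c"
        using measure_torus \<phi>c Pc by (subst Bochner_Integration.integral_add) (auto intro!: integrable_torus_continuous continuous_intros)
      finally have "2 * pi * c = - (LINT x|torus. deriv \<phi> x - P x)" by simp
      moreover have "2 * pi * \<bar>c\<bar> = \<bar>2 * pi * c\<bar>" by (simp add: abs_mult)
      ultimately have "2 * pi * \<bar>c\<bar> = \<bar>LINT x|torus. deriv \<phi> x - P x\<bar>" by simp
      also have "\<dots> \<le> (LINT x|torus. \<bar>deriv \<phi> x - P x\<bar>)" by (rule integral_abs_bound)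
      also have "\<dots> \<le> (LINT x|torus. e)"
        using P(2) \<phi>c Pc by (intro integral_mono integrable_torus_continuous continuous_intros) (auto intro: less_imp_le)
      also have "\<dots> = 2 * pi * e" using measure_torus by simp
      finally show ?thesis by simp
    qed
    have u2: "\<bar>u x\<bar> \<le> 2 * e" for x using P(2)[of x] c unfolding u_def by linarith
    have v2: "\<bar>v x\<bar> \<le> 2 * pi * e" if x: "x \<in> {-pi..pi}" for x
    proof -
      have "norm (v x - v 0) \<le> (2 * e) * norm (x - 0)"
        by (rule field_differentiable_bound[where S = UNIV and f' = u]) (use vd u2 in auto)
      also have "\<dots> \<le> (2 * e) * pi" using x e by (intro mult_left_mono) auto
      finally show ?thesis by (simp add: v_def mult_ac)
    qed
    have "(LINT x|torus. f x * u x) = (LINT x|torus. f x * deriv \<phi> x) - (LINT x|torus. f x * (P x - c))"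
      unfolding u_def right_diff_distrib[of "f _" "deriv \<phi> _"] using f \<phi>c Pc
      by (intro Bochner_Integration.integral_diff integrable_torus_mult continuous_intros)
    moreover have "(LINT x|torus. g x * v x) = (LINT x|torus. g x * \<phi> x) - (LINT x|torus. g x * Q x)"
    proof -
      have "(LINT x|torus. g x * v x) = (LINT x|torus. (g x * \<phi> x - g x * Q x) - (\<phi> 0 - Q 0) * g x)"
        by (simp add: v_def algebra_simps)
      also have "\<dots> = (LINT x|torus. g x * \<phi> x - g x * Q x) - (\<phi> 0 - Q 0) * (LINT x|torus. g x)"
        using g \<phi>c Qc by (subst Bochner_Integration.integral_diff) (auto intro!: Bochner_Integration.integrable_diff integrable_torus_mult)
      also have "(LINT x|torus. g x * \<phi> x - g x * Q x) = (LINT x|torus. g x * \<phi> x) - (LINT x|torus. g x * Q x)"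
        using g \<phi>c Qc by (intro Bochner_Integration.integral_diff integrable_torus_mult)
      finally show ?thesis using g0 by simp
    qed
    ultimately have "D = (LINT x|torus. f x * u x) + (LINT x|torus. g x * v x)" using Q(3) by (simp add: D_def)
    moreover have "\<bar>LINT x|torus. f x * u x\<bar> \<le> 2 * e * A"
    proof -
      have "\<bar>LINT x|torus. f x * u x\<bar> \<le> (LINT x|torus. \<bar>f x * u x\<bar>)" by (rule integral_abs_bound)
      also have "\<dots> \<le> (LINT x|torus. 2 * e * \<bar>f x\<bar>)"
      proof (rule integral_mono)
        show "integrable torus (\<lambda>x. \<bar>f x * u x\<bar>)" by (intro integrable_abs integrable_torus_mult f uc)
        show "integrable torus (\<lambda>x. 2 * e * \<bar>f x\<bar>)" using f by simp
        show "\<bar>f x * u x\<bar> \<le> 2 * e * \<bar>f x\<bar>" for x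
          unfolding abs_mult using u2[of x] by (subst mult.commute) (intro mult_right_mono, auto)
      qed
      finally show ?thesis by (simp add: A_def)
    qed
    moreover have "\<bar>LINT x|torus. g x * v x\<bar> \<le> 2 * pi * e * B"
    proof -
      have "\<bar>LINT x|torus. g x * v x\<bar> \<le> (LINT x|torus. \<bar>g x * v x\<bar>)" by (rule integral_abs_bound)
      also have "\<dots> \<le> (LINT x|torus. 2 * pi * e * \<bar>g x\<bar>)"
      proof (rule integral_mono)
        show "integrable torus (\<lambda>x. \<bar>g x * v x\<bar>)" by (intro integrable_abs integrable_torus_mult g vc)
        show "integrable torus (\<lambda>x. 2 * pi * e * \<bar>g x\<bar>)" using g by simp
        show "\<bar>g x * v x\<bar> \<le> 2 * pi * e * \<bar>g x\<bar>" if "x \<in> space torus" for x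
          unfolding abs_mult using v2[of x] that by (subst mult.commute) (intro mult_right_mono, auto)
      qed
      finally show ?thesis by (simp add: B_def)
    qed
    ultimately show ?thesis by (simp add: algebra_simps)
  qed
  note bd = this
  have "D = 0"
  proof (rule ccontr)
    assume D: "D \<noteq> 0"
    define C where "C = 2 * A + 2 * pi * B + 1"
    have C: "C > 0" using AB by (simp add: C_def add_nonneg_pos)
    have "\<bar>D\<bar> \<le> (\<bar>D\<bar> / (2 * C)) * (2 * A + 2 * pi * B)" using D C by (intro bd) auto
    also have "\<dots> \<le> (\<bar>D\<bar> / (2 * C)) * C" using C by (intro mult_left_mono) (auto simp: C_def)
    also have "\<dots> = \<bar>D\<bar> / 2" using C by simp
    finally show False using D by simp
  qed
  then show "(LINT x|torus. f x * deriv \<phi> x) = - (LINT x|torus. g x * \<phi> x)" by (simp add: D_def)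
qed

text \<open>\<open>pclass p f b\<close>: the Fourier series of \<open>f\<close> is the sum of the \<open>b k * tr p k\<close>.\<close>

definition pclass :: "nat \<Rightarrow> (real \<Rightarrow> real) \<Rightarrow> (nat \<Rightarrow> real) \<Rightarrow> bool" where
  "pclass p f b \<longleftrightarrow> periodic f \<and> integrable torus f \<and> b 0 = 0 \<and> (\<forall>k. fcoef p f k = b k \<and> fcoef (Suc p) f k = 0)"

lemma fcoef_Suc_Suc: "fcoef (Suc (Suc p)) f k = - fcoef p f k"
  by (simp add: fcoef_def tr_Suc_Suc)

lemma pclass_AE_eq:
  assumes "pclass p f b" "pclass p g b"
  shows "AE x in torus. f x = g x"
proof (rule AE_eq_if_integrals_eq)
  show fg: "integrable torus f" "integrable torus g" using assms by (auto simp: pclass_def)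
  fix q k
  have d: "(LINT x|torus. (f x - g x) * tr q' k' x) = (LINT x|torus. f x * tr q' k' x) - (LINT x|torus. g x * tr q' k' x)" for q' k'
    unfolding left_diff_distrib using fg by (intro Bochner_Integration.integral_diff integrable_torus_mult continuous_intros)
  have fe: "fcoef p f k' = fcoef p g k'" "fcoef (Suc p) f k' = fcoef (Suc p) g k'" for k'
    using assms by (auto simp: pclass_def)
  have "(LINT x|torus. (f x - g x) * tr q k x) = 0"
  proof (rule integral_tr_all_phases[where p = p])
    fix k'
    show "(LINT x|torus. (f x - g x) * tr p k' x) = 0" "(LINT x|torus. (f x - g x) * tr (Suc p) k' x) = 0"
      using fe[of k'] unfolding d by (simp_all add: fcoef_def)
  qed
  then show "(LINT x|torus. f x * tr q k x) = (LINT x|torus. g x * tr q k x)" by (simp add: d)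
qed

lemma pclass_cong_AE:
  assumes "pclass p f b" "periodic g" "integrable torus g" "AE x in torus. f x = g x"
  shows "pclass p g b"
  using assms fcoef_cong_AE[of f g] by (auto simp: pclass_def)

lemma pclass_weak_deriv:
  assumes f: "pclass p f b" and w: "has_weak_deriv f g"
  shows "pclass (Suc p) g (\<lambda>k. real k * b k)"
proof -
  have "fcoef p g k = 0" "fcoef (Suc p) g k = real k * b k" for k
    using has_weak_deriv_fcoef[OF w, of k p] has_weak_deriv_fcoef[OF w, of k "Suc p"] f
    by (auto simp: pclass_def fcoef_Suc_Suc)
  then show ?thesis using w f by (auto simp: pclass_def has_weak_deriv_def fcoef_Suc_Suc)
qed

text \<open>Comparing coefficients gives the integration by parts for the phases p and p + 1. A
  shift of the phase by 2 only changes its sign, so it spreads to all phases.\<close>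

lemma pclass_imp_weak_deriv:
  assumes f: "pclass p f b" and g: "pclass (Suc p) g (\<lambda>k. real k * b k)"
  shows "has_weak_deriv f g"
proof (rule has_weak_derivI)
  show fg: "periodic f" "periodic g" "integrable torus f" "integrable torus g" using f g by (auto simp: pclass_def)
  fix q k
  define h where "h q k = (LINT x|torus. f x * (real k * tr (Suc q) k x)) + (LINT x|torus. g x * tr q k x)" for q k
  have hq: "h q k = pi * (real k * fcoef (Suc q) f k + fcoef q g k)" for q k
  proof -
    have "(LINT x|torus. f x * (real k * tr (Suc q) k x)) = (LINT x|torus. real k * (f x * tr (Suc q) k x))"
      by (simp add: mult_ac)
    then show ?thesis by (simp add: h_def fcoef_def field_simps)
  qed
  have "fcoef (Suc (Suc p)) g k = 0" for k using g by (auto simp: pclass_def)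
  then have "fcoef p g k = 0" for k by (simp add: fcoef_Suc_Suc)
  then have h0: "h p k = 0" "h (Suc p) k = 0" for k using f g by (auto simp: hq pclass_def fcoef_Suc_Suc)
  have tw: "h (Suc (Suc q)) k = - h q k" for q k by (simp add: hq fcoef_Suc_Suc algebra_simps)
  have up: "h (p + n) k = 0 \<and> h (p + Suc n) k = 0" for n k by (induction n) (auto simp: h0 tw)
  have four: "h (q + 4 * n) k = h q k" for n
  proof (induction n)
    case (Suc n)
    have "q + 4 * Suc n = Suc (Suc (Suc (Suc (q + 4 * n))))" by simp
    then show ?case using Suc by (simp only: tw minus_minus)
  qed simp
  \<comment> \<open>Adding \<open>4 * p\<close> leaves \<open>h\<close> unchanged and lifts the
    phase to at least p, where upward induction has shown that \<open>h\<close> vanishes.\<close>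
  have "h q k = h (q + 4 * p) k" by (simp add: four)
  also have "\<dots> = h (p + (q + 3 * p)) k" by (simp add: algebra_simps)
  also have "\<dots> = 0" using up by blast
  finally show "(LINT x|torus. f x * (real k * tr (Suc q) k x)) = - (LINT x|torus. g x * tr q k x)" by (simp add: h_def)
qed

lemma pclass_diff:
  assumes "pclass p f b" "pclass p g c"
  shows "pclass p (\<lambda>x. f x - g x) (\<lambda>k. b k - c k)"
proof -
  have fg: "integrable torus f" "integrable torus g" using assms by (auto simp: pclass_def)
  have "fcoef q (\<lambda>x. f x - g x) k = fcoef q f k - fcoef q g k" for q k
    unfolding fcoef_def left_diff_distrib diff_divide_distrib[symmetric] using fg
    by (subst Bochner_Integration.integral_diff) (auto intro!: integrable_torus_mult continuous_intros)
  then show ?thesis using assms by (auto simp: pclass_def periodic_def)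
qed

lemma pclass_scale:
  assumes "pclass p f b"
  shows "pclass p (\<lambda>x. a * f x) (\<lambda>k. a * b k)"
proof -
  have "fcoef q (\<lambda>x. a * f x) k = a * fcoef q f k" for q k
    unfolding fcoef_def by (simp add: mult.assoc)
  then show ?thesis using assms by (auto simp: pclass_def periodic_def)
qed

text \<open>Riesz-Fischer supplies a square-integrable function with the same coefficients, and
  equal coefficients force equality almost everywhere.\<close>

lemma pclass_L2:
  assumes f: "pclass p f b" and b: "summable (\<lambda>k. (b k)\<^sup>2)"
  shows "f \<in> L2" "(LINT x|torus. (f x)\<^sup>2) \<le> pi * (\<Sum>k. (b k)\<^sup>2)"
proof -
  have b0: "b 0 = 0" using f by (simp add: pclass_def)
  obtain G where G: "periodic G" "integrable torus G" "integrable torus (\<lambda>x. (G x)\<^sup>2)"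
    "(LINT x|torus. (G x)\<^sup>2) \<le> pi * (\<Sum>k. (b k)\<^sup>2)"
    "\<And>k. fcoef p G k = b k" "\<And>k. fcoef (Suc p) G k = 0"
    using riesz_fischer[OF b b0, of p] by metis
  then have "pclass p G b" using b0 by (auto simp: pclass_def)
  then have ae: "AE x in torus. G x = f x" using f by (rule pclass_AE_eq)
  have [measurable]: "f \<in> borel_measurable torus" "G \<in> borel_measurable torus"
    using f G by (auto simp: pclass_def)
  have "integrable torus (\<lambda>x. (f x)\<^sup>2)"
    by (rule integrable_cong_AE_imp[OF G(3)]) (use ae in auto)
  then show "f \<in> L2" using f by (auto simp: L2_def pclass_def)
  have "(LINT x|torus. (f x)\<^sup>2) = (LINT x|torus. (G x)\<^sup>2)"
    by (rule integral_cong_AE) (use ae in auto)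
  then show "(LINT x|torus. (f x)\<^sup>2) \<le> pi * (\<Sum>k. (b k)\<^sup>2)" using G(4) by simp
qed

section \<open>Sobolev regularity and decay of coefficients\<close>

lemma riesz_fischer_pclass:
  assumes "summable (\<lambda>k. (b k)\<^sup>2)" "b 0 = 0"
  obtains G where "pclass p G b"
  using riesz_fischer[OF assms, of p] assms(2) unfolding pclass_def by metis

lemma has_weak_deriv_wderiv: "has_weak_deriv f g \<Longrightarrow> has_weak_deriv f (wderiv f)"
  unfolding wderiv_def by (rule someI[of "has_weak_deriv f"])

text \<open>Membership asks for some weak derivative in the lower space, while the norm is built
  from the chosen one. The induction hypothesis is therefore applied to two functions with the same
  coefficients: the Riesz-Fischer function \<open>G\<close> and \<open>wderiv f\<close>.\<close>

lemma pclass_Sob: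
  assumes "pclass p f b" "summable (wsq m b)"
  shows "f \<in> Sob m \<and> (\<forall>j\<le>m. (LINT x|torus. ((wderiv ^^ j) f x)\<^sup>2) \<le> pi * (\<Sum>k. wsq m b k))"
  using assms
proof (induction m arbitrary: p f b)
  case 0
  have "wsq 0 b = (\<lambda>k. (b k)\<^sup>2)" by (rule ext) (simp add: wsq_def)
  then show ?case using pclass_L2[OF 0(1)] 0(2) by simp
next
  case (Suc m)
  define b' where "b' k = real k * b k" for k
  have s0: "summable (wsq 0 b)" using summable_wsq_mono[OF Suc.prems(2), of 0] by simp
  have e0: "wsq 0 b = (\<lambda>k. (b k)\<^sup>2)" by (rule ext) (simp add: wsq_def)
  have le: "wsq m b' k \<le> wsq (Suc m) b k" for k
  proof -
    have "(real k + 1) ^ (2 * m) * ((real k)\<^sup>2 * (b k)\<^sup>2) \<le> (real k + 1) ^ (2 * m) * ((real k + 1)\<^sup>2 * (b k)\<^sup>2)"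
      by (intro mult_left_mono mult_right_mono power_mono) auto
    then show ?thesis by (simp add: wsq_def b'_def power_mult_distrib power2_eq_square mult_ac)
  qed
  have s': "summable (wsq m b')" by (rule summable_comparison_test'[OF Suc.prems(2), of 0]) (use le in auto)
  have sle: "(\<Sum>k. wsq m b' k) \<le> (\<Sum>k. wsq (Suc m) b k)" by (intro suminf_le le s' Suc.prems)
  have "summable (wsq 0 b')" using summable_wsq_mono[OF s', of 0] by simp
  moreover have "wsq 0 b' = (\<lambda>k. (b' k)\<^sup>2)" by (rule ext) (simp add: wsq_def)
  ultimately obtain G where G: "pclass (Suc p) G b'"
    using riesz_fischer_pclass[of b' "Suc p"] by (auto simp: b'_def)
  have w: "has_weak_deriv f G" by (rule pclass_imp_weak_deriv[OF Suc.prems(1) G[unfolded b'_def]])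
  note IHG = Suc.IH[OF G s']
  have wd: "has_weak_deriv f (wderiv f)" by (rule has_weak_deriv_wderiv[OF w])
  have "pclass (Suc p) (wderiv f) b'" unfolding b'_def by (rule pclass_weak_deriv[OF Suc.prems(1) wd])
  note IHw = Suc.IH[OF this s']
  have f2: "f \<in> L2" "(LINT x|torus. (f x)\<^sup>2) \<le> pi * (\<Sum>k. wsq 0 b k)"
    using pclass_L2[OF Suc.prems(1)] s0 unfolding e0 by auto
  have "(\<Sum>k. wsq 0 b k) \<le> (\<Sum>k. wsq (Suc m) b k)" by (intro suminf_le s0 Suc.prems wsq_mono) auto
  then have f3: "(LINT x|torus. (f x)\<^sup>2) \<le> pi * (\<Sum>k. wsq (Suc m) b k)"
    using f2(2) by (meson mult_left_mono order_trans pi_ge_zero)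
  have "(LINT x|torus. ((wderiv ^^ j) f x)\<^sup>2) \<le> pi * (\<Sum>k. wsq (Suc m) b k)" if j: "j \<le> Suc m" for j
  proof (cases j)
    case 0
    then show ?thesis using f3 by simp
  next
    case (Suc i)
    then have "(LINT x|torus. ((wderiv ^^ i) (wderiv f) x)\<^sup>2) \<le> pi * (\<Sum>k. wsq m b' k)" using IHw j by simp
    also have "\<dots> \<le> pi * (\<Sum>k. wsq (Suc m) b k)" using sle by (intro mult_left_mono) auto
    finally show ?thesis using Suc by (simp add: funpow_swap1)
  qed
  moreover have "f \<in> Sob (Suc m)" using f2(1) IHG w by auto
  ultimately show ?case by blast
qed

lemma Sob_norm_le:
  assumes "pclass p f b" "summable (wsq m b)"
  shows "Sob_norm m f \<le> sqrt ((real m + 1) * pi * (\<Sum>k. wsq m b k))"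
proof -
  have "(\<Sum>j\<le>m. LINT x|torus. ((wderiv ^^ j) f x)\<^sup>2) \<le> (\<Sum>j\<le>m. pi * (\<Sum>k. wsq m b k))"
    using pclass_Sob[OF assms] by (intro sum_mono) auto
  then show ?thesis unfolding Sob_norm_def by (intro real_sqrt_le_mono) (simp add: algebra_simps)
qed

lemma Sob_norm_nonneg: "0 \<le> Sob_norm m f"
  unfolding Sob_norm_def by (intro real_sqrt_ge_zero sum_nonneg integral_nonneg_AE) auto

lemma Sob_norm_tendsto:
  assumes c: "\<And>r. r \<in> S \<Longrightarrow> r \<noteq> t \<Longrightarrow> pclass p (F r) (b r) \<and> summable (wsq m (b r))"
    and l: "((\<lambda>r. \<Sum>k. wsq m (b r) k) \<longlongrightarrow> 0) (at t within S)"
  shows "((\<lambda>r. Sob_norm m (F r)) \<longlongrightarrow> 0) (at t within S)"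
proof (rule tendsto_sandwich[OF _ _ tendsto_const])
  have "((\<lambda>r. sqrt ((real m + 1) * pi * (\<Sum>k. wsq m (b r) k))) \<longlongrightarrow> sqrt ((real m + 1) * pi * 0)) (at t within S)"
    by (intro tendsto_intros l)
  then show "((\<lambda>r. sqrt ((real m + 1) * pi * (\<Sum>k. wsq m (b r) k))) \<longlongrightarrow> 0) (at t within S)" by simp
  show "\<forall>\<^sub>F r in at t within S. 0 \<le> Sob_norm m (F r)" by (simp add: Sob_norm_nonneg)
  show "\<forall>\<^sub>F r in at t within S. Sob_norm m (F r) \<le> sqrt ((real m + 1) * pi * (\<Sum>k. wsq m (b r) k))"
    unfolding eventually_at_filter using c by (intro always_eventually allI impI Sob_norm_le) auto
qed

lemma Sob_L2: "f \<in> Sob m \<Longrightarrow> f \<in> L2"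
  by (cases m) auto

lemma L2_imp_integrable: "f \<in> L2 \<Longrightarrow> integrable torus f"
  by (auto simp: L2_def intro: L2_integrable)

text \<open>\<open>Sob\<close> consists of functions rather than classes; this is what transfers
  membership from some weak derivative to the chosen \<open>wderiv\<close>.\<close>

lemma Sob_cong_AE:
  assumes f: "f \<in> Sob m" and g: "periodic g" "integrable torus g" and ae: "AE x in torus. f x = g x"
  shows "g \<in> Sob m"
proof -
  have fL: "f \<in> L2" using f by (rule Sob_L2)
  have [measurable]: "f \<in> borel_measurable torus" "g \<in> borel_measurable torus" using fL g by (auto simp: L2_def)
  have "integrable torus (\<lambda>x. (g x)\<^sup>2)"
    by (rule integrable_cong_AE_imp[of _ "\<lambda>x. (f x)\<^sup>2"]) (use ae fL in \<open>auto simp: L2_def\<close>)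
  then have gL: "g \<in> L2" using g by (auto simp: L2_def)
  show ?thesis
  proof (cases m)
    case (Suc n)
    then obtain h where h: "h \<in> Sob n" "has_weak_deriv f h" using f by auto
    have "has_weak_deriv g h"
    proof (rule has_weak_derivI)
      show "periodic g" "integrable torus g" "periodic h" "integrable torus h"
        using g h by (auto simp: has_weak_deriv_def)
      show "(LINT x|torus. g x * (real k * tr (Suc p) k x)) = - (LINT x|torus. h x * tr p k x)" for p k
        using has_weak_deriv_tr[OF h(2), of k p] integral_cong_AE_mult[OF L2_imp_integrable[OF fL] g(2) _ ae, of "\<lambda>x. real k * tr (Suc p) k x"]
        by (simp add: continuous_intros)
    qed
    then show ?thesis using Suc gL h by auto
  qed (use gL in simp)
qed

lemma Sob_Suc_wderiv:
  assumes "f \<in> Sob (Suc m)"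
  shows "has_weak_deriv f (wderiv f)" "wderiv f \<in> Sob m"
proof -
  obtain g where g: "g \<in> Sob m" "has_weak_deriv f g" using assms by auto
  show w: "has_weak_deriv f (wderiv f)" by (rule has_weak_deriv_wderiv[OF g(2)])
  show "wderiv f \<in> Sob m"
    by (rule Sob_cong_AE[OF g(1) _ _ has_weak_deriv_unique[OF g(2) w]]) (use w in \<open>auto simp: has_weak_deriv_def\<close>)
qed

lemma Sob_bessel:
  assumes "f \<in> Sob m" "finite S" "0 \<notin> S"
  shows "pi * (\<Sum>k\<in>S. real k ^ (2 * m) * (fcoef p f k)\<^sup>2) \<le> (LINT x|torus. ((wderiv ^^ m) f x)\<^sup>2)"
  using assms
proof (induction m arbitrary: p f)
  case 0
  then show ?case using bessel[of f S p] by (auto simp: L2_def)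
next
  case (Suc m)
  note w = Sob_Suc_wderiv[OF Suc.prems(1)]
  have eq: "real k ^ (2 * Suc m) * (fcoef p f k)\<^sup>2 = real k ^ (2 * m) * (fcoef (Suc p) (wderiv f) k)\<^sup>2" for k
  proof -
    have "fcoef (Suc p) (wderiv f) k = real k * fcoef p f k"
      using has_weak_deriv_fcoef[OF w(1), of k "Suc p"] by (simp add: fcoef_Suc_Suc)
    then show ?thesis by (simp add: power_mult_distrib power2_eq_square mult_ac)
  qed
  show ?case unfolding eq using Suc.IH[OF w(2) Suc.prems(2,3), of "Suc p"] by (simp add: funpow_swap1)
qed

text \<open>Bessel's inequality for the m-th weak derivative controls k^(2m) times the squared
  coefficients. As b 0 = 0 and k + 1 <= 2 k for k >= 1, the passage to the weight (k + 1)^(2m) costs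
  4^m.\<close>

lemma Sob_summable:
  assumes f: "f \<in> Sob m" and b: "pclass p f b"
  shows "summable (wsq m b)" "pi * (\<Sum>k. wsq m b k) \<le> 4 ^ m * (Sob_norm m f)\<^sup>2"
proof -
  have le: "pi * (\<Sum>k<n. wsq m b k) \<le> 4 ^ m * (Sob_norm m f)\<^sup>2" for n
  proof -
    have "(\<Sum>k<n. wsq m b k) = (\<Sum>k\<in>{1..<n}. wsq m b k)"
      by (rule sum.mono_neutral_right) (use b in \<open>auto simp: wsq_def pclass_def\<close>, metis gr0I Suc_leI not_less_eq_eq)
    also have "\<dots> \<le> (\<Sum>k\<in>{1..<n}. 4 ^ m * (real k ^ (2 * m) * (fcoef p f k)\<^sup>2))"
    proof (rule sum_mono)
      fix k assume "k \<in> {1..<n}"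
      then have "(real k + 1) ^ (2 * m) \<le> (2 * real k) ^ (2 * m)" by (intro power_mono) auto
      also have "\<dots> = 4 ^ m * real k ^ (2 * m)" unfolding power_mult_distrib by (simp add: power_mult)
      finally have "(real k + 1) ^ (2 * m) * (b k)\<^sup>2 \<le> (4 ^ m * real k ^ (2 * m)) * (b k)\<^sup>2"
        by (rule mult_right_mono) simp
      then show "wsq m b k \<le> 4 ^ m * (real k ^ (2 * m) * (fcoef p f k)\<^sup>2)"
        using b by (simp add: wsq_def pclass_def mult.assoc)
    qed
    also have "\<dots> = 4 ^ m * (\<Sum>k\<in>{1..<n}. real k ^ (2 * m) * (fcoef p f k)\<^sup>2)" by (simp add: sum_distrib_left)
    finally have "pi * (\<Sum>k<n. wsq m b k) \<le> pi * (4 ^ m * (\<Sum>k\<in>{1..<n}. real k ^ (2 * m) * (fcoef p f k)\<^sup>2))"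
      by (rule mult_left_mono) simp
    also have "\<dots> = 4 ^ m * (pi * (\<Sum>k\<in>{1..<n}. real k ^ (2 * m) * (fcoef p f k)\<^sup>2))" by simp
    also have "\<dots> \<le> 4 ^ m * (LINT x|torus. ((wderiv ^^ m) f x)\<^sup>2)"
      by (intro mult_left_mono Sob_bessel[OF f]) auto
    also have "(LINT x|torus. ((wderiv ^^ m) f x)\<^sup>2) \<le> (\<Sum>j\<le>m. LINT x|torus. ((wderiv ^^ j) f x)\<^sup>2)"
      by (rule member_le_sum[of m "{..m}" "\<lambda>j. LINT x|torus. ((wderiv ^^ j) f x)\<^sup>2"]) (auto intro: integral_nonneg_AE)
    also have "\<dots> = (Sob_norm m f)\<^sup>2"
      unfolding Sob_norm_def by (subst real_sqrt_pow2) (auto intro!: sum_nonneg integral_nonneg_AE)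
    finally show ?thesis by simp
  qed
  show 1: "summable (wsq m b)"
  proof (rule bounded_imp_summable)
    show "sum (wsq m b) {..n} \<le> 4 ^ m * (Sob_norm m f)\<^sup>2 / pi" for n
      using le[of "Suc n"] by (simp add: lessThan_Suc_atMost field_simps)
  qed simp
  have "(\<Sum>k. wsq m b k) \<le> 4 ^ m * (Sob_norm m f)\<^sup>2 / pi"
    using le by (intro suminf_le_const[OF 1]) (simp add: field_simps)
  then show "pi * (\<Sum>k. wsq m b k) \<le> 4 ^ m * (Sob_norm m f)\<^sup>2" by (simp add: field_simps)
qed

section \<open>Fourier series and the Hilbert transform\<close>

definition ts :: "nat \<Rightarrow> (nat \<Rightarrow> real) \<Rightarrow> real \<Rightarrow> real" where
  "ts p b x = (\<Sum>k. b k * tr p k x)"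

definition inv_sq_sum :: real where
  "inv_sq_sum = (\<Sum>k. (1 / (real k + 1))\<^sup>2)"

lemma summable_inv_sq: "summable (\<lambda>k. (1 / (real k + 1))\<^sup>2)"
proof -
  have "summable (\<lambda>k. 1 / (real (Suc k))\<^sup>2)"
    by (subst summable_Suc_iff[of "\<lambda>k. 1 / (real k)\<^sup>2"]) (rule inverse_power_summable[of 2, unfolded inverse_eq_divide], simp)
  then show ?thesis by (simp add: power_divide add.commute)
qed

text \<open>Cauchy-Schwarz against 1 / (k + 1): the one-dimensional Sobolev embedding into
  continuous functions, in terms of coefficients.\<close>

lemma wsq_abs_summable:
  assumes "summable (wsq 1 b)"
  shows "summable (\<lambda>k. \<bar>b k\<bar>)" "(\<Sum>k. \<bar>b k\<bar>) \<le> sqrt (inv_sq_sum * (\<Sum>k. wsq 1 b k))"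
proof -
  have le: "(\<Sum>k<n. \<bar>b k\<bar>) \<le> sqrt (inv_sq_sum * (\<Sum>k. wsq 1 b k))" for n
  proof -
    have "(\<Sum>k<n. \<bar>b k\<bar>)\<^sup>2 = (\<Sum>k<n. (1 / (real k + 1)) * ((real k + 1) * \<bar>b k\<bar>))\<^sup>2"
    proof -
      have "\<bar>b k\<bar> = (1 / (real k + 1)) * ((real k + 1) * \<bar>b k\<bar>)" for k
        by (metis add.commute divide_self_if mult.assoc mult_1 of_nat_Suc of_nat_neq_0 times_divide_eq_left)
      then show ?thesis by presburger
    qed
    also have "\<dots> \<le> (\<Sum>k<n. (1 / (real k + 1))\<^sup>2) * (\<Sum>k<n. ((real k + 1) * \<bar>b k\<bar>)\<^sup>2)"
      by (rule Cauchy_Schwarz_ineq_sum)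
    also have "\<dots> = (\<Sum>k<n. (1 / (real k + 1))\<^sup>2) * (\<Sum>k<n. wsq 1 b k)"
      by (simp add: wsq_def power_mult_distrib)
    also have "\<dots> \<le> inv_sq_sum * (\<Sum>k. wsq 1 b k)"
      unfolding inv_sq_sum_def using assms summable_inv_sq
      by (intro mult_mono sum_le_suminf suminf_nonneg sum_nonneg) auto
    finally show ?thesis by (rule real_le_rsqrt)
  qed
  show 1: "summable (\<lambda>k. \<bar>b k\<bar>)"
    by (rule bounded_imp_summable[where B = "sqrt (inv_sq_sum * (\<Sum>k. wsq 1 b k))"])
      (use le[of "Suc _"] in \<open>auto simp: lessThan_Suc_atMost\<close>)
  show "(\<Sum>k. \<bar>b k\<bar>) \<le> sqrt (inv_sq_sum * (\<Sum>k. wsq 1 b k))" by (rule suminf_le_const[OF 1 le])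
qed

lemma wsq_weighted_summable:
  assumes "summable (wsq 2 b)"
  shows "summable (\<lambda>k. real k * \<bar>b k\<bar>)"
proof -
  define b' where "b' k = real k * b k" for k
  have "summable (wsq 1 b')"
  proof (rule summable_comparison_test'[OF assms, of 0])
    fix k
    have "(real k + 1)\<^sup>2 * ((real k)\<^sup>2 * (b k)\<^sup>2) \<le> (real k + 1)\<^sup>2 * ((real k + 1)\<^sup>2 * (b k)\<^sup>2)"
      by (intro mult_left_mono mult_right_mono power_mono) auto
    then have "wsq 1 b' k \<le> wsq 2 b k"
      by (simp add: wsq_def b'_def power_mult_distrib power2_eq_square power4_eq_xxxx mult_ac)
    then show "norm (wsq 1 b' k) \<le> wsq 2 b k" by simp
  qed
  from wsq_abs_summable(1)[OF this] show ?thesis by (simp add: b'_def abs_mult)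
qed

lemma weighted_summable_abs:
  fixes b :: "nat \<Rightarrow> real"
  assumes "summable (\<lambda>k. real k * \<bar>b k\<bar>)"
  shows "summable (\<lambda>k. \<bar>b k\<bar>)"
proof (rule summable_comparison_test'[OF assms, of 1])
  fix k :: nat assume "1 \<le> k"
  then have "1 * \<bar>b k\<bar> \<le> real k * \<bar>b k\<bar>" by (intro mult_right_mono) auto
  then show "norm \<bar>b k\<bar> \<le> real k * \<bar>b k\<bar>" by simp
qed

section \<open>Absolutely convergent trigonometric series\<close>

lemma ts_summable:
  assumes "summable (\<lambda>k. \<bar>b k\<bar>)"
  shows "summable (\<lambda>k. \<bar>b k * tr p k x\<bar>)" "summable (\<lambda>k. b k * tr p k x)" "\<bar>ts p b x\<bar> \<le> (\<Sum>k. \<bar>b k\<bar>)"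
proof -
  have le: "\<bar>b k * tr p k x\<bar> \<le> \<bar>b k\<bar>" for k by (simp add: abs_mult mult_left_le tr_le_1)
  show 1: "summable (\<lambda>k. \<bar>b k * tr p k x\<bar>)"
    by (rule summable_comparison_test'[OF assms, of 0]) (use le in auto)
  then show "summable (\<lambda>k. b k * tr p k x)" by (rule summable_rabs_cancel)
  have "\<bar>ts p b x\<bar> \<le> (\<Sum>k. \<bar>b k * tr p k x\<bar>)" unfolding ts_def by (rule summable_rabs[OF 1])
  also have "\<dots> \<le> (\<Sum>k. \<bar>b k\<bar>)" by (intro suminf_le le 1 assms)
  finally show "\<bar>ts p b x\<bar> \<le> (\<Sum>k. \<bar>b k\<bar>)" .
qed

lemma ts_diff:
  assumes "summable (\<lambda>k. \<bar>b k\<bar>)" "summable (\<lambda>k. \<bar>c k\<bar>)"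
  shows "ts p (\<lambda>k. b k - c k) x = ts p b x - ts p c x"
  unfolding ts_def left_diff_distrib by (rule suminf_diff[symmetric]) (intro ts_summable assms)+

lemma ts_scale:
  assumes "summable (\<lambda>k. \<bar>b k\<bar>)"
  shows "ts p (\<lambda>k. a * b k) x = a * ts p b x"
  unfolding ts_def mult.assoc by (rule suminf_mult) (rule ts_summable[OF assms])

lemma ts_periodic: "periodic (ts p b)"
  by (simp add: periodic_def ts_def tr_periodic)

lemma ts_even_odd: "ts 0 b (- x) = - ts 0 b x" "ts (Suc 0) b (- x) = ts (Suc 0) b x" if "summable (\<lambda>k. \<bar>b k\<bar>)"
  using suminf_minus[OF ts_summable(2)[OF that, of 0 x]] by (auto simp: ts_def tr_0 tr_1)

lemma continuous_on_M_test:
  fixes h :: "nat \<Rightarrow> real \<Rightarrow> real"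
  assumes "\<And>k. continuous_on UNIV (h k)" "\<And>k x. \<bar>h k x\<bar> \<le> M k" "summable M"
  shows "continuous_on UNIV (\<lambda>x. \<Sum>k. h k x)"
proof (rule uniform_limit_theorem[where F = sequentially])
  show "uniform_limit UNIV (\<lambda>n x. \<Sum>k<n. h k x) (\<lambda>x. \<Sum>k. h k x) sequentially"
    using assms by (intro Weierstrass_m_test) auto
  show "\<forall>\<^sub>F n in sequentially. continuous_on UNIV (\<lambda>x. \<Sum>k<n. h k x)"
    using assms by (intro always_eventually allI continuous_intros) auto
qed simp

lemma continuous_on_ts: "summable (\<lambda>k. \<bar>b k\<bar>) \<Longrightarrow> continuous_on UNIV (ts p b)"
  unfolding ts_def[abs_def]
  by (rule continuous_on_M_test[where M = "\<lambda>k. \<bar>b k\<bar>"]) (auto intro!: continuous_intros simp: abs_mult mult_left_le tr_le_1)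

lemma integral_M_test:
  fixes h :: "nat \<Rightarrow> real \<Rightarrow> real"
  assumes h: "\<And>k. continuous_on UNIV (h k)" "\<And>k x. \<bar>h k x\<bar> \<le> M k" "summable M"
  shows "(\<lambda>k. LINT x|torus. h k x) sums (LINT x|torus. (\<Sum>k. h k x))"
proof (rule sums_integral)
  show hi: "integrable torus (h k)" for k by (rule integrable_torus_continuous[OF h(1)])
  show "AE x in torus. summable (\<lambda>k. norm (h k x))"
    by (rule AE_I2) (rule summable_comparison_test'[OF h(3), of 0], use h in auto)
  show "summable (\<lambda>k. LINT x|torus. norm (h k x))"
  proof (rule summable_comparison_test'[where N = 0])
    show "summable (\<lambda>k. 2 * pi * M k)" using h by (intro summable_mult)
    fix k
    have "(LINT x|torus. norm (h k x)) \<le> (LINT x|torus. M k)"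
      using h hi by (intro integral_mono integrable_norm) (auto intro: integrable_torus_continuous)
    also have "\<dots> = 2 * pi * M k" using measure_torus by simp
    finally have "(LINT x|torus. norm (h k x)) \<le> 2 * pi * M k" .
    moreover have "0 \<le> (LINT x|torus. norm (h k x))" by (intro integral_nonneg_AE) auto
    ultimately show "norm (LINT x|torus. norm (h k x)) \<le> 2 * pi * M k"
      unfolding real_norm_def[of "LINT x|torus. norm (h k x)"] by linarith
  qed
qed

lemma pclass_ts:
  assumes b: "summable (\<lambda>k. \<bar>b k\<bar>)" "b 0 = 0"
  shows "pclass p (ts p b) b"
proof -
  have s: "(\<lambda>n. b n * (LINT x|torus. tr p n x * tr q k x)) sums (LINT x|torus. ts p b x * tr q k x)" for q k
  proof -
    have "(\<lambda>n. LINT x|torus. b n * tr p n x * tr q k x) sums (LINT x|torus. (\<Sum>n. b n * tr p n x * tr q k x))"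
    proof (rule integral_M_test[OF _ _ b(1)])
      fix n x
      have "\<bar>b n\<bar> * (\<bar>tr p n x\<bar> * \<bar>tr q k x\<bar>) \<le> \<bar>b n\<bar> * (1 * 1)"
        by (intro mult_left_mono mult_mono tr_le_1) auto
      then show "\<bar>b n * tr p n x * tr q k x\<bar> \<le> \<bar>b n\<bar>" by (simp add: abs_mult)
    qed (intro continuous_intros)
    moreover have "(\<Sum>n. b n * tr p n x * tr q k x) = ts p b x * tr q k x" for x
      unfolding ts_def by (rule suminf_mult2[symmetric]) (rule ts_summable[OF b(1)])
    ultimately show ?thesis by (simp add: mult.assoc)
  qed
  have "(LINT x|torus. ts p b x * tr p k x) = pi * b k" for k
  proof -
    have "b n * (LINT x|torus. tr p n x * tr p k x) = (if n = k then pi * b k else 0)" for n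
    proof (cases "n = 0 \<or> k = 0")
      case True
      then show ?thesis
      proof
        assume k: "k = 0"
        show ?thesis
        proof (cases "n = 0")
          case False
          then show ?thesis using k b(2) integral_tr[OF False, of p] by (simp add: tr_0_right)
        qed (use k b(2) in simp)
      qed (use b(2) in auto)
    qed (simp add: tr_orthogonal)
    then have "(\<lambda>n. if n = k then pi * b k else 0) sums (LINT x|torus. ts p b x * tr p k x)" using s[of p k] by simp
    then show ?thesis using sums_single[of k "\<lambda>_. pi * b k"] sums_unique2 by blast
  qed
  moreover have "(LINT x|torus. ts p b x * tr (Suc p) k x) = 0" for k
  proof -
    have "(\<lambda>n. 0) sums (LINT x|torus. ts p b x * tr (Suc p) k x)"
      using s[of "Suc p" k] by (simp add: tr_orthogonal_Suc)
    then show ?thesis using sums_zero sums_unique2 by blast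
  qed
  ultimately show ?thesis using b integrable_torus_continuous[OF continuous_on_ts[OF b(1)], of p] ts_periodic[of p b]
    by (simp add: pclass_def fcoef_def)
qed

lemma ts_has_derivative:
  assumes "summable (\<lambda>k. real k * \<bar>b k\<bar>)"
  shows "(ts p b has_real_derivative ts (Suc p) (\<lambda>k. real k * b k) x) (at x)"
proof -
  have sb: "summable (\<lambda>k. \<bar>b k\<bar>)" by (rule weighted_summable_abs[OF assms])
  have "((\<lambda>x. \<Sum>k. b k * tr p k x) has_real_derivative (\<Sum>k. b k * (real k * tr (Suc p) k x))) (at x)"
  proof (rule has_field_derivative_series'(2)[where S = UNIV and ?x0.0 = 0])
    show "((\<lambda>x. b k * tr p k x) has_real_derivative b k * (real k * tr (Suc p) k x)) (at x within UNIV)" for k x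
      by (intro DERIV_cmult tr_has_derivative)
    show "uniformly_convergent_on UNIV (\<lambda>n x. \<Sum>k<n. b k * (real k * tr (Suc p) k x))"
    proof (rule Weierstrass_m_test'[OF _ assms])
      fix k x
      have "\<bar>b k\<bar> * (real k * \<bar>tr (Suc p) k x\<bar>) \<le> \<bar>b k\<bar> * (real k * 1)"
        by (intro mult_left_mono tr_le_1) auto
      then show "norm (b k * (real k * tr (Suc p) k x)) \<le> real k * \<bar>b k\<bar>" by (simp add: abs_mult mult.commute)
    qed
    show "summable (\<lambda>k. b k * tr p k 0)" by (rule ts_summable[OF sb])
  qed auto
  then show ?thesis by (simp add: ts_def[abs_def] mult_ac)
qed

text \<open>By the embedding, continuity in t is uniform in x, and so it combines with continuity in
  x at the fixed time t.\<close>

lemma ts_joint_continuous: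
  assumes b: "hcont 1 T b"
  shows "continuous_on ({0..T} \<times> UNIV) (\<lambda>(t, x). ts p (b t) x)"
  unfolding continuous_on_def
proof (rule ballI, clarify)
  fix t x assume t: "t \<in> {0..T}"
  have s: "summable (\<lambda>k. \<bar>b r k\<bar>)" if "r \<in> {0..T}" for r
    using b that wsq_abs_summable(1) unfolding hcont_def by blast
  have "((\<lambda>r. sqrt (inv_sq_sum * (\<Sum>k. wsq 1 (\<lambda>k. b r k - b t k) k))) \<longlongrightarrow> sqrt (inv_sq_sum * 0)) (at t within {0..T})"
    using b t unfolding hcont_def by (intro tendsto_intros) blast
  then have L: "((\<lambda>r. sqrt (inv_sq_sum * (\<Sum>k. wsq 1 (\<lambda>k. b r k - b t k) k))) \<longlongrightarrow> 0) (at t within {0..T})" by simp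
  show "((\<lambda>(t, x). ts p (b t) x) \<longlongrightarrow> ts p (b t) x) (at (t, x) within {0..T} \<times> UNIV)"
  proof (rule tendstoI)
    fix e :: real assume e: "e > 0"
    obtain d1 where d1: "d1 > 0" "\<And>r. r \<in> {0..T} \<Longrightarrow> r \<noteq> t \<Longrightarrow> dist r t < d1 \<Longrightarrow> dist (sqrt (inv_sq_sum * (\<Sum>k. wsq 1 (\<lambda>k. b r k - b t k) k))) 0 < e / 2"
      using tendstoD[OF L, of "e/2"] e unfolding eventually_at by auto
    have "isCont (ts p (b t)) x" using continuous_on_ts[OF s[OF t]] by (simp add: continuous_on_eq_continuous_at)
    then obtain d2 where d2: "d2 > 0" "\<And>y. dist y x < d2 \<Longrightarrow> dist (ts p (b t) y) (ts p (b t) x) < e / 2"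
      using e unfolding continuous_at_eps_delta by (metis half_gt_zero)
    have "dist (ts p (b r) y) (ts p (b t) x) < e" if ry: "r \<in> {0..T}" "dist (r, y) (t, x) < min d1 d2" for r y
    proof -
      have dr: "dist r t < d1" "dist y x < d2"
        using ry(2) dist_fst_le[of "(r, y)" "(t, x)"] dist_snd_le[of "(r, y)" "(t, x)"] by auto
      have "\<bar>ts p (b r) y - ts p (b t) y\<bar> < e / 2"
      proof (cases "r = t")
        case False
        have "summable (wsq 1 (\<lambda>k. b r k - b t k))" using b ry t unfolding hcont_def by (intro summable_wsq_diff) auto
        note w = wsq_abs_summable[OF this]
        have "\<bar>ts p (b r) y - ts p (b t) y\<bar> = \<bar>ts p (\<lambda>k. b r k - b t k) y\<bar>" using s ry t by (simp add: ts_diff)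
        also have "\<dots> \<le> (\<Sum>k. \<bar>b r k - b t k\<bar>)" by (rule ts_summable(3)[OF w(1)])
        also have "\<dots> \<le> sqrt (inv_sq_sum * (\<Sum>k. wsq 1 (\<lambda>k. b r k - b t k) k))" by (rule w(2))
        also have "\<dots> < e / 2" using d1(2)[OF ry(1) False dr(1)] by (simp add: dist_real_def)
        finally show ?thesis .
      qed (use e in simp)
      then show ?thesis using d2(2)[OF dr(2)] unfolding dist_real_def by linarith
    qed
    then show "\<forall>\<^sub>F z in at (t, x) within {0..T} \<times> UNIV. dist (case z of (t, x) \<Rightarrow> ts p (b t) x) (ts p (b t) x) < e"
      unfolding eventually_at using d1 d2 by (intro exI[of _ "min d1 d2"]) auto
  qed
qed

text \<open>The embedding turns convergence of the difference quotients in the weighted norm into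
  convergence at every point.\<close>

lemma ts_time_derivative:
  assumes c: "\<And>t. t \<in> {0..T} \<Longrightarrow> summable (wsq 1 (c t))" and b: "\<And>t. t \<in> {0..T} \<Longrightarrow> summable (wsq 1 (b t))" and t: "t \<in> {0..T}"
    and l: "((\<lambda>r. \<Sum>k. wsq 1 (\<lambda>k. (c r k - c t k) / (r - t) - b t k) k) \<longlongrightarrow> 0) (at t within {0..T})"
  shows "((\<lambda>r. ts p (c r) x) has_real_derivative ts p (b t) x) (at t within {0..T})"
  unfolding has_field_derivative_iff
proof (rule LIM_zero_cancel, rule Lim_null_comparison)
  have "((\<lambda>r. sqrt (inv_sq_sum * (\<Sum>k. wsq 1 (\<lambda>k. (c r k - c t k) / (r - t) - b t k) k))) \<longlongrightarrow> sqrt (inv_sq_sum * 0)) (at t within {0..T})"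
    by (intro tendsto_intros l)
  then show "((\<lambda>r. sqrt (inv_sq_sum * (\<Sum>k. wsq 1 (\<lambda>k. (c r k - c t k) / (r - t) - b t k) k))) \<longlongrightarrow> 0) (at t within {0..T})" by simp
  have "norm ((ts p (c r) x - ts p (c t) x) / (r - t) - ts p (b t) x) \<le> sqrt (inv_sq_sum * (\<Sum>k. wsq 1 (\<lambda>k. (c r k - c t k) / (r - t) - b t k) k))"
    if r: "r \<in> {0..T}" "r \<noteq> t" for r
  proof -
    have 1: "summable (wsq 1 (\<lambda>k. c r k - c t k))" using c r t by (intro summable_wsq_diff) auto
    have 2: "summable (wsq 1 (\<lambda>k. 1 / (r - t) * (c r k - c t k)))" by (rule summable_wsq_scale[OF 1])
    have 3: "summable (wsq 1 (\<lambda>k. 1 / (r - t) * (c r k - c t k) - b t k))" using 2 b[OF t] by (rule summable_wsq_diff)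
    have "ts p (\<lambda>k. 1 / (r - t) * (c r k - c t k) - b t k) x = 1 / (r - t) * (ts p (c r) x - ts p (c t) x) - ts p (b t) x"
      using wsq_abs_summable(1)[OF 1] wsq_abs_summable(1)[OF 2] wsq_abs_summable(1)[OF b[OF t]] wsq_abs_summable(1)[OF c[OF r(1)]] wsq_abs_summable(1)[OF c[OF t]]
      by (simp only: ts_diff ts_scale)
    moreover have "\<bar>ts p (\<lambda>k. 1 / (r - t) * (c r k - c t k) - b t k) x\<bar> \<le> sqrt (inv_sq_sum * (\<Sum>k. wsq 1 (\<lambda>k. 1 / (r - t) * (c r k - c t k) - b t k) k))"
      using ts_summable(3)[OF wsq_abs_summable(1)[OF 3], of p x] wsq_abs_summable(2)[OF 3] by linarith
    ultimately show ?thesis by simp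
  qed
  then show "\<forall>\<^sub>F r in at t within {0..T}. norm ((ts p (c r) x - ts p (c t) x) / (r - t) - ts p (b t) x) \<le> sqrt (inv_sq_sum * (\<Sum>k. wsq 1 (\<lambda>k. (c r k - c t k) / (r - t) - b t k) k))"
    unfolding eventually_at_filter by (intro always_eventually allI impI) auto
qed

section \<open>The Hilbert transform of a sine series\<close>

definition conj_kernel :: "nat \<Rightarrow> real \<Rightarrow> real" where
  "conj_kernel k y = (\<Sum>j<k. cos (real j * y) + cos (real (Suc j) * y))"

text \<open>For k >= 1 the sum is 1 + 2 cos y + ... + 2 cos (k - 1) y + cos k y, the modified
  Dirichlet kernel. It extends the left side continuously across y = 0, since sin k y cancels the
  pole of the cotangent.\<close>

lemma conj_kernel: "sin (y / 2) \<noteq> 0 \<Longrightarrow> cot (y / 2) * sin (real k * y) = conj_kernel k y"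
proof (induction k)
  case (Suc k)
  define z where "z = y / 2"
  have y: "y = 2 * z" by (simp add: z_def)
  have "cot z * (sin (real (Suc k) * y) - sin (real k * y)) = cos (real k * y) + cos (real (Suc k) * y)"
  proof -
    define a where "a = real k * y + z"
    have 1: "real (Suc k) * y = a + z" "real k * y = a - z" by (simp_all add: a_def y algebra_simps)
    show ?thesis unfolding 1 using Suc.prems
      by (simp add: cot_def z_def[symmetric] sin_add sin_diff cos_add cos_diff)
  qed
  then show ?case using Suc by (simp add: conj_kernel_def z_def algebra_simps)
qed (simp add: conj_kernel_def)

lemma conj_kernel_le: "\<bar>conj_kernel k y\<bar> \<le> 2 * real k"
proof -
  have "\<bar>conj_kernel k y\<bar> \<le> (\<Sum>j<k. \<bar>cos (real j * y) + cos (real (Suc j) * y)\<bar>)"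
    unfolding conj_kernel_def by (rule sum_abs)
  also have "\<dots> \<le> (\<Sum>j<k. 2)"
  proof (rule sum_mono)
    fix j
    show "\<bar>cos (real j * y) + cos (real (Suc j) * y)\<bar> \<le> 2"
      using abs_cos_le_one[of "real j * y"] abs_cos_le_one[of "real (Suc j) * y"] by linarith
  qed
  finally show ?thesis by simp
qed

lemma continuous_on_conj_kernel: "continuous_on A (conj_kernel k)"
  unfolding conj_kernel_def[abs_def] by (intro continuous_intros)

lemma integral_conj_kernel: "(LINT y|torus. conj_kernel k y) = (if k = 0 then 0 else 2 * pi)"
proof -
  have c: "(LINT y|torus. cos (real j * y)) = (if j = 0 then 2 * pi else 0)" for j
    using integral_tr[of j "Suc 0"] measure_torus by (simp add: tr_1)
  have "(LINT y|torus. conj_kernel k y) = (\<Sum>j<k. (LINT y|torus. cos (real j * y)) + (LINT y|torus. cos (real (Suc j) * y)))"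
    unfolding conj_kernel_def
    by (subst Bochner_Integration.integral_sum, (auto intro!: integrable_torus_continuous continuous_intros)[1],
        intro sum.cong refl, subst Bochner_Integration.integral_add) (auto intro!: integrable_torus_continuous continuous_intros)
  also have "\<dots> = (\<Sum>j<k. if j = 0 then 2 * pi else 0)" unfolding c by simp
  finally show ?thesis by (simp add: sum.delta)
qed

text \<open>Symmetrizing the kernel turns the truncated integral of \<open>cot (y/2) f(\<theta> - y)\<close> into that of a
  continuous function, so that the principal value is an ordinary integral.\<close>

lemma hilbert_ts:
  assumes b: "summable (\<lambda>k. real k * \<bar>b k\<bar>)" "b 0 = 0"
  shows "hilbert (ts 0 b) \<theta> = - ts (Suc 0) b \<theta>"
proof -
  have sb: "summable (\<lambda>k. \<bar>b k\<bar>)" by (rule weighted_summable_abs[OF b(1)])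
  define f where "f = ts 0 b"
  define h where "h y = cot (y / 2) * f (\<theta> - y)" for y
  define J where "J y = (\<Sum>k. - 2 * b k * cos (real k * \<theta>) * conj_kernel k y)" for y
  have fc: "continuous_on UNIV f" unfolding f_def by (rule continuous_on_ts[OF sb])
  have fm: "f \<in> borel_measurable borel" using fc by (rule borel_measurable_continuous_onI)
  have hm: "h \<in> borel_measurable borel" unfolding h_def cot_def using fm by measurable
  have Jle: "\<bar>- 2 * b k * cos (real k * \<theta>) * conj_kernel k y\<bar> \<le> 4 * (real k * \<bar>b k\<bar>)" for k y
  proof -
    have "\<bar>b k\<bar> * (\<bar>cos (real k * \<theta>)\<bar> * \<bar>conj_kernel k y\<bar>) \<le> \<bar>b k\<bar> * (1 * (2 * real k))"
      by (intro mult_left_mono mult_mono conj_kernel_le abs_cos_le_one) auto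
    then show ?thesis by (simp add: abs_mult mult_ac)
  qed
  have s4: "summable (\<lambda>k. 4 * (real k * \<bar>b k\<bar>))" by (intro summable_mult b)
  have Jc: "continuous_on UNIV J" unfolding J_def[abs_def]
    by (rule continuous_on_M_test[OF _ Jle s4]) (intro continuous_intros continuous_on_conj_kernel)
  have Js: "summable (\<lambda>k. - 2 * b k * cos (real k * \<theta>) * conj_kernel k y)" for y
    by (rule summable_comparison_test'[OF s4, of 0]) (use Jle in auto)
  \<comment> \<open>The cotangent is odd, so only f (\<theta> - y) - f (\<theta> + y) survives; its
    series consists of multiples of sin k y, which \<open>conj_kernel\<close> absorbs together with
    the cotangent.\<close>
  have sym: "h y + h (- y) = J y" if y: "sin (y / 2) \<noteq> 0" for y
  proof -
    have "(\<lambda>k. b k * tr 0 k (\<theta> - y) - b k * tr 0 k (\<theta> + y)) sums (f (\<theta> - y) - f (\<theta> + y))"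
      unfolding f_def ts_def by (intro sums_diff summable_sums ts_summable[OF sb])
    moreover have "b k * tr 0 k (\<theta> - y) - b k * tr 0 k (\<theta> + y) = - 2 * b k * cos (real k * \<theta>) * sin (real k * y)" for k
      by (simp add: tr_0 distrib_left right_diff_distrib sin_add sin_diff algebra_simps)
    ultimately have "(\<lambda>k. - 2 * b k * cos (real k * \<theta>) * sin (real k * y)) sums (f (\<theta> - y) - f (\<theta> + y))" by simp
    then have "(\<lambda>k. cot (y / 2) * (- 2 * b k * cos (real k * \<theta>) * sin (real k * y))) sums (cot (y / 2) * (f (\<theta> - y) - f (\<theta> + y)))"
      by (rule sums_mult)
    moreover have "cot (y / 2) * (- 2 * b k * cos (real k * \<theta>) * sin (real k * y)) = - 2 * b k * cos (real k * \<theta>) * conj_kernel k y" for k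
      unfolding conj_kernel[OF y, symmetric] by (simp add: mult_ac)
    ultimately have "(\<lambda>k. - 2 * b k * cos (real k * \<theta>) * conj_kernel k y) sums (cot (y / 2) * (f (\<theta> - y) - f (\<theta> + y)))"
      by (simp only:)
    then have "J y = cot (y / 2) * (f (\<theta> - y) - f (\<theta> + y))"
      unfolding J_def by (rule sums_unique[symmetric])
    then show ?thesis by (simp add: h_def cot_def algebra_simps diff_divide_distrib)
  qed
  obtain B where B: "0 < B" "\<And>x. x \<in> {-pi..pi} \<Longrightarrow> \<bar>J x\<bar> \<le> B" using continuous_bounded_torus[OF Jc] by blast
  obtain Bf where Bf: "\<And>x. \<bar>f x\<bar> \<le> Bf" using ts_summable(3)[OF sb] unfolding f_def by blast
  define I where "I = (LINT y|torus. J y)"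
  have I: "I = 2 * (2 * pi) * - ts (Suc 0) b \<theta>"
  proof -
    have "(\<lambda>k. LINT y|torus. - 2 * b k * cos (real k * \<theta>) * conj_kernel k y) sums I"
      unfolding I_def J_def
      by (rule integral_M_test[OF _ Jle s4]) (intro continuous_intros continuous_on_conj_kernel)
    moreover have "(LINT y|torus. - 2 * b k * cos (real k * \<theta>) * conj_kernel k y) = - 4 * pi * (b k * tr (Suc 0) k \<theta>)" for k
      using b(2) by (simp add: integral_conj_kernel tr_1 mult_ac)
    ultimately have "(\<lambda>k. - 4 * pi * (b k * tr (Suc 0) k \<theta>)) sums I" by (simp only:)
    moreover have "(\<lambda>k. - 4 * pi * (b k * tr (Suc 0) k \<theta>)) sums (- 4 * pi * ts (Suc 0) b \<theta>)"
      unfolding ts_def by (intro sums_mult summable_sums ts_summable[OF sb])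
    ultimately show ?thesis using sums_unique2 by fastforce
  qed
  define PV where "PV \<epsilon> = 1 / (2 * pi) * (LINT \<phi>|lebesgue_on {\<phi>. \<epsilon> \<le> \<bar>\<theta> - \<phi>\<bar> \<and> \<bar>\<theta> - \<phi>\<bar> \<le> pi}. cot ((\<theta> - \<phi>) / 2) * f \<phi>)" for \<epsilon>
  \<comment> \<open>The full integral of \<open>J\<close> is 4 pi times the claimed limit, and twice
    the truncated integral differs from it only by the part of \<open>J\<close> over an interval of
    length 2 \<epsilon>, at most 2 \<epsilon> B.\<close>
  have PV: "\<bar>PV \<epsilon> - - ts (Suc 0) b \<theta>\<bar> \<le> \<epsilon> * B" if e: "0 < \<epsilon>" "\<epsilon> < pi" for \<epsilon>
  proof -
    define E where "E = {y :: real. \<epsilon> \<le> \<bar>y\<bar> \<and> \<bar>y\<bar> \<le> pi}"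
    define D where "D = {\<phi>. \<epsilon> \<le> \<bar>\<theta> - \<phi>\<bar> \<and> \<bar>\<theta> - \<phi>\<bar> \<le> pi}"
    have Eb: "E \<in> sets borel" unfolding E_def by measurable
    have Db: "D \<in> sets borel" unfolding D_def by measurable
    have trans: "(LINT \<phi>|lebesgue_on D. cot ((\<theta> - \<phi>) / 2) * f \<phi>) = (LINT y|lborel. indicator E y * h y)"
    proof -
      have m: "(\<lambda>\<phi>. indicator D \<phi> * (cot ((\<theta> - \<phi>) / 2) * f \<phi>)) \<in> borel_measurable lborel"
        unfolding cot_def using fm Db by measurable
      have "(LINT \<phi>|lebesgue_on D. cot ((\<theta> - \<phi>) / 2) * f \<phi>) = (LINT \<phi>|lebesgue. indicator D \<phi> * (cot ((\<theta> - \<phi>) / 2) * f \<phi>))"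
        using Db by (subst integral_restrict_space) auto
      also have "\<dots> = (LINT \<phi>|lborel. indicator D \<phi> * (cot ((\<theta> - \<phi>) / 2) * f \<phi>))"
        by (rule integral_completion[OF m])
      also have "\<dots> = (LINT y|lborel. indicator D (\<theta> + (-1) * y) * (cot ((\<theta> - (\<theta> + (-1) * y)) / 2) * f (\<theta> + (-1) * y)))"
        by (subst lborel_integral_real_affine[of "-1" _ \<theta>]) auto
      also have "\<dots> = (LINT y|lborel. indicator E y * h y)"
        by (intro Bochner_Integration.integral_cong) (auto simp: h_def E_def D_def indicator_def)
      finally show ?thesis .
    qed
    have sE: "sin (y / 2) \<noteq> 0" and cE: "\<bar>cot (y / 2)\<bar> \<le> 1 / sin (\<epsilon> / 2)" if y: "y \<in> E" for y
    proof -
      have p: "0 < sin (\<epsilon> / 2)" using e by (intro sin_gt_zero) auto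
      have "sin (\<epsilon> / 2) \<le> sin (\<bar>y\<bar> / 2)" using y e by (intro sin_monotone_2pi_le) (auto simp: E_def)
      also have "sin (\<bar>y\<bar> / 2) \<le> \<bar>sin (y / 2)\<bar>" by (auto simp: abs_if)
      finally have s: "sin (\<epsilon> / 2) \<le> \<bar>sin (y / 2)\<bar>" .
      then show "sin (y / 2) \<noteq> 0" using p by auto
      have "\<bar>cot (y / 2)\<bar> = \<bar>cos (y / 2)\<bar> / \<bar>sin (y / 2)\<bar>" by (simp add: cot_def abs_divide)
      also have "\<dots> \<le> 1 / sin (\<epsilon> / 2)" using p s by (intro frac_le) auto
      finally show "\<bar>cot (y / 2)\<bar> \<le> 1 / sin (\<epsilon> / 2)" .
    qed
    have Efin: "emeasure lborel E < \<infinity>"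
    proof -
      have "E \<subseteq> {-pi..pi}" by (auto simp: E_def)
      then have "emeasure lborel E \<le> emeasure lborel {-pi..pi}" by (intro emeasure_mono) auto
      also have "\<dots> < \<infinity>" by simp
      finally show ?thesis .
    qed
    have hi: "integrable lborel (\<lambda>y. indicator E y *\<^sub>R h y)"
    proof (rule integrableI_bounded_set_indicator[where B = "1 / sin (\<epsilon> / 2) * Bf"])
      show "AE y in lborel. y \<in> E \<longrightarrow> norm (h y) \<le> 1 / sin (\<epsilon> / 2) * Bf"
      proof (rule AE_I2, rule impI)
        fix y assume y: "y \<in> E"
        have "\<bar>cot (y / 2)\<bar> * \<bar>f (\<theta> - y)\<bar> \<le> 1 / sin (\<epsilon> / 2) * Bf"
          using cE[OF y] by (intro mult_mono Bf order_trans[OF abs_ge_zero cE[OF y]]) auto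
        then show "norm (h y) \<le> 1 / sin (\<epsilon> / 2) * Bf" by (simp add: h_def abs_mult)
      qed
    qed (use Eb hm Efin in auto)
    then have hi: "integrable lborel (\<lambda>y. indicator E y * h y)" by simp
    have refl: "(LINT y|lborel. indicator E y * h (- y)) = (LINT y|lborel. indicator E y * h y)"
    proof -
      have "(LINT y|lborel. indicator E y * h y) = (LINT y|lborel. indicator E (0 + (-1) * y) * h (0 + (-1) * y))"
        by (subst lborel_integral_real_affine[of "-1" _ 0]) auto
      also have "\<dots> = (LINT y|lborel. indicator E y * h (- y))"
        by (intro Bochner_Integration.integral_cong) (auto simp: E_def indicator_def)
      finally show ?thesis by simp
    qed
    have hi': "integrable lborel (\<lambda>y. indicator E y * h (- y))"
    proof -
      have "integrable lborel (\<lambda>y. indicator E (0 + (-1) * y) * h (0 + (-1) * y))"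
        using lborel_integrable_real_affine[OF hi, of "-1" 0] by simp
      moreover have "indicator E (0 + (-1) * y) * h (0 + (-1) * y) = indicator E y * h (- y)" for y
        by (auto simp: E_def indicator_def)
      ultimately show ?thesis by (simp only:)
    qed
    have "2 * (LINT y|lborel. indicator E y * h y) = (LINT y|lborel. indicator E y * h y + indicator E y * h (- y))"
      using hi hi' refl by simp
    also have "\<dots> = (LINT y|lborel. indicator E y * J y)"
      by (intro Bochner_Integration.integral_cong) (auto simp: indicator_def sE sym)
    finally have two: "2 * (LINT y|lborel. indicator E y * h y) = (LINT y|lborel. indicator E y * J y)" .
    have Jm: "J \<in> borel_measurable borel" using Jc by (rule borel_measurable_continuous_onI)
    have I': "I = (LINT y|lborel. indicator {-pi..pi} y * J y)"
    proof -
      have "I = (LINT y|lebesgue. indicator {-pi..pi} y * J y)"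
        unfolding I_def by (subst integral_restrict_space) auto
      also have "\<dots> = (LINT y|lborel. indicator {-pi..pi} y * J y)" using Jm by (intro integral_completion) measurable
      finally show ?thesis .
    qed
    have Ji: "integrable lborel (\<lambda>y. indicator A y * J y)" if "A \<in> sets borel" "A \<subseteq> {-pi..pi}" for A
    proof -
      have "integrable lborel (\<lambda>y. indicator A y *\<^sub>R J y)"
      proof (rule integrableI_bounded_set_indicator[where B = B])
        have "emeasure lborel A \<le> emeasure lborel {-pi..pi}" using that by (intro emeasure_mono) auto
        also have "\<dots> < \<infinity>" by simp
        finally show "emeasure lborel A < \<infinity>" .
        show "AE y in lborel. y \<in> A \<longrightarrow> norm (J y) \<le> B"
          by (rule AE_I2) (use that(2) B(2) in auto)
      qed (use that Jm in auto)
      then show ?thesis by simp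
    qed
    have "I - (LINT y|lborel. indicator E y * J y) = (LINT y|lborel. indicator {-pi..pi} y * J y - indicator E y * J y)"
      unfolding I' by (rule Bochner_Integration.integral_diff[symmetric]) (rule Ji, use Eb in \<open>auto simp: E_def\<close>)+
    also have "\<dots> = (LINT y|lborel. indicator {-\<epsilon><..<\<epsilon>} y * J y)"
      by (intro Bochner_Integration.integral_cong) (use e in \<open>auto simp: E_def indicator_def\<close>)
    finally have "\<bar>I - (LINT y|lborel. indicator E y * J y)\<bar> \<le> (LINT y|lborel. \<bar>indicator {-\<epsilon><..<\<epsilon>} y * J y\<bar>)"
      by (simp only: integral_abs_bound)
    also have "\<dots> \<le> (LINT y|lborel. B * indicator {-\<epsilon><..<\<epsilon>} y)"
    proof (rule integral_mono)
      show "integrable lborel (\<lambda>y. \<bar>indicator {-\<epsilon><..<\<epsilon>} y * J y\<bar>)" using e by (intro integrable_abs Ji) auto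
      show "integrable lborel (\<lambda>y. B * indicator {-\<epsilon><..<\<epsilon>} y :: real)" using e by (intro integrable_mult_right integrable_real_indicator) auto
      show "\<bar>indicator {-\<epsilon><..<\<epsilon>} y * J y\<bar> \<le> B * indicator {-\<epsilon><..<\<epsilon>} y" for y
        using B e by (auto simp: indicator_def)
    qed
    also have "\<dots> = B * (2 * \<epsilon>)" using e by simp
    finally have "\<bar>I - (LINT y|lborel. indicator E y * J y)\<bar> \<le> B * (2 * \<epsilon>)" .
    then have d: "\<bar>I - 2 * (LINT y|lborel. indicator E y * h y)\<bar> \<le> B * (2 * \<epsilon>)" unfolding two .
    have "PV \<epsilon> = 1 / (2 * pi) * (LINT y|lborel. indicator E y * h y)"
      unfolding PV_def D_def[symmetric] trans ..
    then have eq: "4 * pi * (PV \<epsilon> - - ts (Suc 0) b \<theta>) = 2 * (LINT y|lborel. indicator E y * h y) - I"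
      unfolding I by (simp add: field_simps)
    have "4 * pi * \<bar>PV \<epsilon> - - ts (Suc 0) b \<theta>\<bar> = \<bar>4 * pi * (PV \<epsilon> - - ts (Suc 0) b \<theta>)\<bar>"
      by (simp add: abs_mult)
    also have "\<dots> = \<bar>I - 2 * (LINT y|lborel. indicator E y * h y)\<bar>"
      unfolding eq by (rule abs_minus_commute)
    also note d
    finally have "4 * pi * \<bar>PV \<epsilon> - - ts (Suc 0) b \<theta>\<bar> \<le> B * (2 * \<epsilon>)" .
    moreover have "1 * \<bar>PV \<epsilon> - - ts (Suc 0) b \<theta>\<bar> \<le> 2 * pi * \<bar>PV \<epsilon> - - ts (Suc 0) b \<theta>\<bar>"
      using pi_ge_two by (intro mult_right_mono) auto
    ultimately show ?thesis by (simp add: mult.commute)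
  qed
  have "(PV \<longlongrightarrow> - ts (Suc 0) b \<theta>) (at_right 0)"
  proof (rule LIM_zero_cancel, rule Lim_null_comparison)
    show "((\<lambda>\<epsilon>. \<epsilon> * B) \<longlongrightarrow> 0) (at_right 0)" by (intro tendsto_eq_intros) auto
    show "\<forall>\<^sub>F \<epsilon> in at_right 0. norm (PV \<epsilon> - - ts (Suc 0) b \<theta>) \<le> \<epsilon> * B"
      unfolding eventually_at_right_field using PV by (intro exI[of _ pi]) auto
  qed
  then have "Lim (at_right 0) PV = - ts (Suc 0) b \<theta>" by (intro tendsto_Lim) auto
  then show ?thesis unfolding hilbert_def PV_def f_def .
qed

section \<open>The operator of the linearized equation\<close>

text \<open>Multiplying the coefficients of \<open>sin k\<theta>\<close> by \<open>k\<close>, the operator of the equation acts as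
  \<open>Lam\<close>; in terms of the sine coefficients of \<open>\<partial>\<^sub>\<theta>\<eta> / (2 sqrt \<pi> sin \<theta>)\<close> it is the Jacobi
  operator with couplings \<open>q_DG\<close>.\<close>

definition d_DG :: "nat \<Rightarrow> real" where
  "d_DG k = (real k - 2)\<^sup>2 * (real k + 2) / (4 * (real k)\<^sup>2)"

definition q_DG :: "nat \<Rightarrow> real" where
  "q_DG k = d_DG (k + 1)"

text \<open>At k = 1 the mode 1 itself contributes: shifted down by two it becomes sin (- \<theta>)
  = - sin \<theta>. At k = 2 the lower term vanishes, as division by zero makes
  \<open>d_DG 0\<close> equal to 0.\<close>

definition Lam :: "(nat \<Rightarrow> real) \<Rightarrow> nat \<Rightarrow> real" where
  "Lam e k = (if k = 1 then - d_DG 1 * e 1 else d_DG (k - 2) * e (k - 2)) - d_DG (k + 2) * e (k + 2)"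

text \<open>From 2 sin \<theta> sin k\<theta> = cos (k - 1)\<theta> - cos (k + 1)\<theta>: the
  coefficient of cos k\<theta> in 2 sqrt pi sin \<theta> w, divided by k to integrate. Division by
  zero gives the value 0 at k = 0.\<close>

definition acoef :: "(nat \<Rightarrow> real) \<Rightarrow> nat \<Rightarrow> real" where
  "acoef c k = sqrt pi * (c (k + 1) - c (k - 1)) / real k"

text \<open>With y = k + 1, four times the coupling is y - 2 - 4 / y + 8 / y^2. Over two steps this
  grows by 2 plus a remainder of size at most 40 / 9, and (2 + 40 / 9) / 4 < 2.\<close>

lemma jac_coupling_q_DG: "jac_coupling q_DG"
  unfolding jac_coupling_def
proof (intro allI conjI)
  fix k
  define y where "y = real k + 1"
  have y: "y \<ge> 1" by (simp add: y_def)
  have q: "q_DG k = (y - 2)\<^sup>2 * (y + 2) / (4 * y\<^sup>2)" by (simp add: q_DG_def d_DG_def y_def algebra_simps)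
  have q2: "q_DG (k + 2) = ((y + 2) - 2)\<^sup>2 * ((y + 2) + 2) / (4 * (y + 2)\<^sup>2)" by (simp add: q_DG_def d_DG_def y_def algebra_simps)
  show "0 \<le> q_DG k" unfolding q using y by simp
  have "\<bar>y - 2\<bar>\<^sup>2 \<le> y\<^sup>2" using y by (intro power_mono) auto
  then have "(y - 2)\<^sup>2 * (y + 2) \<le> y\<^sup>2 * (4 * y)" using y by (intro mult_mono) auto
  then show "q_DG k \<le> real k + 1" unfolding q y_def[symmetric] using y by (simp add: divide_le_eq power2_eq_square mult_ac)
  define u where "u = 1 / y"
  define w where "w = 1 / (y + 2)"
  have ex: "(x - 2)\<^sup>2 * (x + 2) / (4 * x\<^sup>2) = (x - 2 - 4 * (1 / x) + 8 * (1 / x)\<^sup>2) / 4" if "x > 0" for x :: real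
    using that by (simp add: field_simps power2_eq_square)
  have d: "4 * (q_DG (k + 2) - q_DG k) = 2 + 4 * (u - w) * (1 - 2 * (u + w))"
    unfolding q q2 u_def w_def using ex[of y] ex[of "y + 2"] y by (simp add: power2_eq_square algebra_simps)
  have uw: "0 < w" "w \<le> 1/3" "0 < u" "u \<le> 1" "w \<le> u" using y by (auto simp: u_def w_def field_simps)
  have uw2: "u - w = 2 * (u * w)" using y by (simp add: u_def w_def field_simps)
  have "u * w \<le> 1 * (1/3)" using uw by (intro mult_mono) auto
  then have b1: "0 \<le> 4 * (u - w)" "4 * (u - w) \<le> 8/3" using uw uw2 by auto
  have b2: "\<bar>1 - 2 * (u + w)\<bar> \<le> 5/3" unfolding abs_le_iff using uw by argo
  define X where "X = 4 * (u - w) * (1 - 2 * (u + w))"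
  have "\<bar>X\<bar> \<le> 8/3 * (5/3)"
    unfolding X_def abs_mult[of "4 * (u - w)"] using b1 b2 by (intro mult_mono) auto
  then show "\<bar>q_DG (k + 2) - q_DG k\<bar> \<le> 2" using d unfolding X_def[symmetric] abs_le_iff by argo
qed

text \<open>In the difference of rows k + 1 and k - 1 all terms with \<open>d_DG k\<close> cancel.
  What is left attaches \<open>d_DG (k + 2)\<close> and \<open>d_DG (k - 2)\<close> to differences
  of c, that is, to entries of e. Rows 1 and 2 are treated apart because \<open>jac\<close> is cut
  off below index 2.\<close>

lemma Lam_jac:
  assumes c: "c 0 = 0" "c 1 = 0" and e: "\<And>k. k \<ge> 1 \<Longrightarrow> e k = sqrt pi * (c (k + 1) - c (k - 1))" "e 0 = 0" and k: "k \<ge> 1"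
  shows "Lam e k = sqrt pi * (jac q_DG c (k + 1) - jac q_DG c (k - 1))"
proof -
  consider "k = 1" | "k = 2" | "k \<ge> 3" using k by linarith
  then show ?thesis
  proof cases
    case 1
    have e3: "e (Suc (Suc (Suc 0))) = sqrt pi * (c (Suc (Suc (Suc (Suc 0)))) - c (Suc (Suc 0)))"
      using e(1)[of 3] by (simp add: numeral_eq_Suc)
    have e1: "e (Suc 0) = sqrt pi * c (Suc (Suc 0))" using e(1)[of 1] c by simp
    show ?thesis using 1 c by (simp add: Lam_def jac_def q_DG_def numeral_eq_Suc e1 e3 algebra_simps)
  next
    case 2
    \<comment> \<open>The coupling between the indices 1 and 3 is zero, in accordance with the zero
      row 1 of \<open>jac\<close>.\<close>
    have d2: "d_DG (Suc (Suc 0)) = 0" by (simp add: d_DG_def)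
    have e4: "e (Suc (Suc (Suc (Suc 0)))) = sqrt pi * (c (Suc (Suc (Suc (Suc (Suc 0))))) - c (Suc (Suc (Suc 0))))"
      using e(1)[of 4] by (simp add: numeral_eq_Suc)
    show ?thesis using 2 e(2) c by (simp add: d2 e4 Lam_def jac_def q_DG_def numeral_eq_Suc algebra_simps)
  next
    case 3
    then obtain j where j: "k = j + 3" by (metis add.commute le_Suc_ex)
    have ej: "e (Suc j) = sqrt pi * (c (Suc (Suc j)) - c j)" using e(1)[of "Suc j"] by simp
    have ej5: "e (Suc (Suc (Suc (Suc (Suc j))))) = sqrt pi * (c (Suc (Suc (Suc (Suc (Suc (Suc j)))))) - c (Suc (Suc (Suc (Suc j)))))"
      using e(1)[of "j + 5"] by (simp add: numeral_eq_Suc)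
    show ?thesis unfolding j using c by (simp add: ej ej5 Lam_def jac_def q_DG_def numeral_eq_Suc algebra_simps)
  qed
qed

section \<open>Coefficients of the equation's operator\<close>

lemma fcoef_mult:
  assumes f: "integrable torus f" and m: "\<And>x. g x * tr q k x = (s1 * tr p1 l1 x + s2 * tr p2 l2 x) / 2"
  shows "fcoef q (\<lambda>x. g x * f x) k = (s1 * fcoef p1 f l1 + s2 * fcoef p2 f l2) / 2"
proof -
  \<comment> \<open>The multiplier is moved onto the test function, where it only shifts
    frequencies.\<close>
  have "g x * f x * tr q k x = s1 / 2 * (f x * tr p1 l1 x) + s2 / 2 * (f x * tr p2 l2 x)" for x
  proof -
    have "g x * f x * tr q k x = f x * (g x * tr q k x)" by simp
    then show ?thesis unfolding m by (simp add: field_simps)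
  qed
  then have "(LINT x|torus. g x * f x * tr q k x) = (LINT x|torus. s1 / 2 * (f x * tr p1 l1 x) + s2 / 2 * (f x * tr p2 l2 x))"
    by simp
  also have "\<dots> = s1 / 2 * (LINT x|torus. f x * tr p1 l1 x) + s2 / 2 * (LINT x|torus. f x * tr p2 l2 x)"
  proof -
    have "integrable torus (\<lambda>x. f x * tr p1 l1 x)" "integrable torus (\<lambda>x. f x * tr p2 l2 x)"
      using f by (auto intro!: integrable_torus_mult continuous_intros)
    then show ?thesis by (subst Bochner_Integration.integral_add) auto
  qed
  finally show ?thesis by (simp add: fcoef_def add_divide_distrib)
qed

text \<open>At k = 1 the lower frequency k - 2 = -1 is reflected to 1. Cosine is even, so no sign
  appears here; in the companion formula for cos 2x the reflected function is a sine and changes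
  sign.\<close>

lemma fcoef_sin2:
  assumes f: "integrable torus f" and k: "k \<ge> 1"
  shows "fcoef 0 (\<lambda>x. sin (2 * x) * f x) k = (fcoef (Suc 0) f (if k = 1 then 1 else k - 2) - fcoef (Suc 0) f (k + 2)) / 2"
proof -
  have "sin (2 * x) * tr 0 k x = (1 * tr (Suc 0) (if k = 1 then 1 else k - 2) x + (-1) * tr (Suc 0) (k + 2) x) / 2" for x
  proof -
    have "tr (Suc 0) (if k = 1 then 1 else k - 2) x = cos (real k * x - 2 * x)"
    proof (cases "k = 1")
      case True
      have "real k * x - 2 * x = - x" using True by simp
      then show ?thesis using True by (simp only: cos_minus) (simp add: tr_1)
    next
      case False
      then show ?thesis using k by (simp add: tr_1 of_nat_diff algebra_simps)
    qed
    moreover have "tr (Suc 0) (k + 2) x = cos (real k * x + 2 * x)" by (simp add: tr_1 algebra_simps)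
    ultimately show ?thesis by (simp add: tr_0 cos_add cos_diff field_simps)
  qed
  from fcoef_mult[OF f this] show ?thesis by simp
qed

lemma fcoef_cos2:
  assumes f: "integrable torus f" and k: "k \<ge> 1"
  shows "fcoef 0 (\<lambda>x. cos (2 * x) * f x) k = (fcoef 0 f (k + 2) + (if k = 1 then - fcoef 0 f 1 else fcoef 0 f (k - 2))) / 2"
proof -
  have "cos (2 * x) * tr 0 k x = (1 * tr 0 (k + 2) x + (if k = 1 then - 1 else 1) * tr 0 (if k = 1 then 1 else k - 2) x) / 2" for x
  proof -
    have "(if k = 1 then - 1 else 1) * tr 0 (if k = 1 then 1 else k - 2) x = sin (real k * x - 2 * x)"
    proof (cases "k = 1")
      case True
      have "real k * x - 2 * x = - x" using True by simp
      then show ?thesis using True by (simp only: sin_minus) (simp add: tr_0)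
    next
      case False
      then show ?thesis using k by (simp add: tr_0 of_nat_diff algebra_simps)
    qed
    moreover have "tr 0 (k + 2) x = sin (real k * x + 2 * x)" by (simp add: tr_0 algebra_simps)
    ultimately show ?thesis by (simp add: tr_0 sin_add sin_diff field_simps)
  qed
  from fcoef_mult[OF f this] show ?thesis by (simp split: if_splits)
qed

lemma fcoef_odd:
  assumes "odd_fun f"
  shows "fcoef (Suc 0) f k = 0"
proof -
  have "(LINT x|torus. f (- x) * tr (Suc 0) k (- x)) = (LINT x|torus. f x * tr (Suc 0) k x)"
    using integral_reflect_real[of pi "- pi" "\<lambda>x. f x * tr (Suc 0) k x"] by simp
  moreover have "f (- x) * tr (Suc 0) k (- x) = - (f x * tr (Suc 0) k x)" for x
    using assms by (simp add: odd_fun_def tr_1)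
  ultimately show ?thesis by (simp add: fcoef_def)
qed

lemma fcoef_0_0: "fcoef 0 f 0 = 0"
  by (simp add: fcoef_def tr_0)

text \<open>Oddness disposes of all cosine coefficients, so pointwise identities between continuous
  odd functions can be checked on the sine coefficients with k >= 1.\<close>

lemma continuous_odd_eq_zero:
  assumes "periodic f" "continuous_on UNIV f" "odd_fun f" "\<And>k. k \<ge> 1 \<Longrightarrow> fcoef 0 f k = 0"
  shows "f x = 0"
proof (rule continuous_eq_zero[OF assms(1,2)])
  have 0: "fcoef 0 f k = 0" for k using assms(4)[of k] fcoef_0_0[of f] by (cases "k = 0") auto
  show "(LINT x|torus. f x * tr p k x) = 0" for p k
  proof (rule integral_tr_all_phases[where p = 0])
    show "(LINT x|torus. f x * tr 0 k x) = 0" for k using 0[of k] by (simp add: fcoef_def)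
    show "(LINT x|torus. f x * tr (Suc 0) k x) = 0" for k using fcoef_odd[OF assms(3), of k] by (simp add: fcoef_def)
  qed
qed

lemma velocity_ts_derivative:
  assumes a: "summable (\<lambda>k. real k * \<bar>a k\<bar>)" "a 0 = 0"
  shows "(ts 0 (\<lambda>k. - a k / real k) has_real_derivative hilbert (ts 0 a) x) (at x)"
proof -
  have sa: "summable (\<lambda>k. \<bar>a k\<bar>)" by (rule weighted_summable_abs[OF a(1)])
  have e: "real k * (- a k / real k) = - a k" for k using a(2) by (cases "k = 0") auto
  have s: "summable (\<lambda>k. real k * \<bar>- a k / real k\<bar>)"
  proof -
    have "real k * \<bar>- a k / real k\<bar> = \<bar>a k\<bar>" for k using a(2) by (cases "k = 0") auto
    then show ?thesis using sa by simp
  qed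
  have m: "ts (Suc 0) (\<lambda>k. - a k) x = - ts (Suc 0) a x"
    using ts_scale[OF sa, of "Suc 0" "-1" x] by simp
  show ?thesis using ts_has_derivative[OF s, of 0 x] unfolding e m hilbert_ts[OF a] .
qed

text \<open>Two admissible velocities have the same derivative and the same value at 0; so v can be
  replaced by the series obtained from H sin k\<theta> = - cos k\<theta> by integration.\<close>

lemma velocity_ts:
  assumes a: "summable (\<lambda>k. real k * \<bar>a k\<bar>)" "a 0 = 0"
    and v: "\<And>x. (v has_real_derivative hilbert (ts 0 a) x) (at x)" "v 0 = 0"
  shows "v = ts 0 (\<lambda>k. - a k / real k)"
proof
  fix x
  have "v x - ts 0 (\<lambda>k. - a k / real k) x = v 0 - ts 0 (\<lambda>k. - a k / real k) 0"
  proof (rule DERIV_isconst_all[where f = "\<lambda>x. v x - ts 0 (\<lambda>k. - a k / real k) x"])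
    show "\<forall>x. ((\<lambda>x. v x - ts 0 (\<lambda>k. - a k / real k) x) has_real_derivative 0) (at x)"
      using DERIV_diff[OF v(1) velocity_ts_derivative[OF a]] by simp
  qed
  moreover have "ts 0 (\<lambda>k. - a k / real k) 0 = 0" by (simp add: ts_def tr_0)
  ultimately show "v x = ts 0 (\<lambda>k. - a k / real k) x" using v(2) by simp
qed

text \<open>L sends sin k\<theta> to (k - 2)^2 / (4 k) sin (k + 2)\<theta> minus (k - 2) (k + 2) /
  (4 k) sin (k - 2)\<theta>. Multiplying each term by its own frequency gives both the same factor,
  \<open>k * d_DG k\<close>; this is the origin of \<open>d_DG\<close>.\<close>

lemma L_op_ts:
  assumes a: "summable (\<lambda>k. real k * \<bar>a k\<bar>)" "a 0 = 0"
  defines "v \<equiv> ts 0 (\<lambda>k. - a k / real k)"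
  shows "periodic (L_op (ts 0 a) v)" "continuous_on UNIV (L_op (ts 0 a) v)" "odd_fun (L_op (ts 0 a) v)"
    "k \<ge> 1 \<Longrightarrow> real k * fcoef 0 (L_op (ts 0 a) v) k = Lam (\<lambda>k. real k * a k) k"
proof -
  have sa: "summable (\<lambda>k. \<bar>a k\<bar>)" by (rule weighted_summable_abs[OF a(1)])
  have s1: "summable (\<lambda>k. \<bar>real k * a k\<bar>)" using a(1) by (simp add: abs_mult)
  have s2: "summable (\<lambda>k. \<bar>- a k / real k\<bar>)"
  proof (rule summable_comparison_test'[OF sa, of 0])
    fix k
    show "norm \<bar>- a k / real k\<bar> \<le> \<bar>a k\<bar>"
      using a(2) divide_left_mono[of 1 "real k" "\<bar>a k\<bar>"] by (cases "k = 0") auto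
  qed
  define f1 where "f1 = ts (Suc 0) (\<lambda>k. real k * a k)"
  define f2 where "f2 = ts 0 a"
  define f3 where "f3 = ts (Suc 0) a"
  have der: "deriv (ts 0 a) x = f1 x" for x
    unfolding f1_def by (rule DERIV_imp_deriv[OF ts_has_derivative[OF a(1)]])
  have L: "L_op (ts 0 a) v = (\<lambda>x. 1 / 2 * (sin (2 * x) * f1 x) - cos (2 * x) * f2 x - sin (2 * x) * f3 x - 2 * (cos (2 * x) * v x))"
    by (rule ext) (simp add: L_op_def der hilbert_ts[OF a] f2_def f3_def)
  have c: "continuous_on UNIV f1" "continuous_on UNIV f2" "continuous_on UNIV f3" "continuous_on UNIV v"
    unfolding f1_def f2_def f3_def v_def by (intro continuous_on_ts s1 sa s2)+
  show "continuous_on UNIV (L_op (ts 0 a) v)" unfolding L by (intro continuous_intros c)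
  have "sin (2 * (x + 2 * pi)) = sin (2 * x)" "cos (2 * (x + 2 * pi)) = cos (2 * x)" for x
    using tr_periodic[of 0 2 x] tr_periodic[of "Suc 0" 2 x] by (simp_all add: tr_0 tr_1)
  then show "periodic (L_op (ts 0 a) v)"
    using ts_periodic[of "Suc 0" "\<lambda>k. real k * a k"] ts_periodic[of 0 a] ts_periodic[of "Suc 0" a] ts_periodic[of 0 "\<lambda>k. - a k / real k"]
    unfolding L unfolding periodic_def f1_def f2_def f3_def v_def by (simp only:) simp
  have "v (- x) = - v x" for x unfolding v_def by (rule ts_even_odd(1)[OF s2])
  then show "odd_fun (L_op (ts 0 a) v)"
    unfolding L unfolding odd_fun_def f1_def f2_def f3_def
    by (simp add: ts_even_odd s1 sa)
  have i: "integrable torus f1" "integrable torus f2" "integrable torus f3" "integrable torus v"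
    using c by (auto intro: integrable_torus_continuous)
  assume k: "k \<ge> 1"
  have "fcoef 0 (L_op (ts 0 a) v) k = 1 / 2 * fcoef 0 (\<lambda>x. sin (2 * x) * f1 x) k - fcoef 0 (\<lambda>x. cos (2 * x) * f2 x) k
     - fcoef 0 (\<lambda>x. sin (2 * x) * f3 x) k - 2 * fcoef 0 (\<lambda>x. cos (2 * x) * v x) k"
  proof -
    have lin: "fcoef 0 (\<lambda>x. r * g x) k = r * fcoef 0 g k" for r g by (simp add: fcoef_def mult.assoc)
    have lind: "fcoef 0 (\<lambda>x. g x - h x) k = fcoef 0 g k - fcoef 0 h k" if "continuous_on UNIV g" "continuous_on UNIV h" for g h
      unfolding fcoef_def left_diff_distrib using that
      by (subst Bochner_Integration.integral_diff) (auto intro!: integrable_torus_continuous continuous_intros simp: diff_divide_distrib)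
    show ?thesis unfolding L
      by (subst lind, (intro continuous_intros c)+, subst lind, (intro continuous_intros c)+, subst lind, (intro continuous_intros c)+) (simp only: lin)
  qed
  also have "\<dots> = 1 / 2 * ((fcoef (Suc 0) f1 (if k = 1 then 1 else k - 2) - fcoef (Suc 0) f1 (k + 2)) / 2)
     - ((fcoef 0 f2 (k + 2) + (if k = 1 then - fcoef 0 f2 1 else fcoef 0 f2 (k - 2))) / 2)
     - ((fcoef (Suc 0) f3 (if k = 1 then 1 else k - 2) - fcoef (Suc 0) f3 (k + 2)) / 2)
     - 2 * ((fcoef 0 v (k + 2) + (if k = 1 then - fcoef 0 v 1 else fcoef 0 v (k - 2))) / 2)"
    by (simp only: fcoef_sin2[OF i(1) k] fcoef_sin2[OF i(3) k] fcoef_cos2[OF i(2) k] fcoef_cos2[OF i(4) k])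
  finally have F: "fcoef 0 (L_op (ts 0 a) v) k = \<dots>" .
  have f: "fcoef (Suc 0) f1 j = real j * a j" "fcoef 0 f2 j = a j" "fcoef (Suc 0) f3 j = a j" "fcoef 0 v j = - a j / real j" for j
    using pclass_ts[OF s1, of "Suc 0"] pclass_ts[OF sa a(2), of 0] pclass_ts[OF sa a(2), of "Suc 0"] pclass_ts[OF s2, of 0] a(2)
    unfolding f1_def f2_def f3_def v_def pclass_def by auto
  show "real k * fcoef 0 (L_op (ts 0 a) v) k = Lam (\<lambda>k. real k * a k) k"
  proof (cases "k = 1")
    case True
    show ?thesis unfolding F f using True by (simp add: Lam_def d_DG_def power2_eq_square field_simps)
  next
    case False
    then obtain j where j: "k = j + 2" using k by (metis One_nat_def Suc_1 Suc_leI add.commute le_Suc_ex le_neq_implies_less)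
    define y where "y = real j"
    have rk: "real k = y + 2" "real (k + 2) = y + 4" by (auto simp: j y_def)
    have k2: "k - 2 = j" using j by simp
    \<comment> \<open>The contributions to index y + 2 from the mode y + 4 and, in
      \<open>down\<close>, from the mode y. The case y = 0 is consistent because the coefficient of
      index 0 is zero.\<close>
    have up: "(y + 2) * (1 / 2 * (- ((y + 4) * A) / 2) - A / 2 + A / 2 - 2 * ((- A / (y + 4)) / 2))
        = - ((y + 4 - 2)\<^sup>2 * (y + 4 + 2) / (4 * (y + 4)\<^sup>2) * ((y + 4) * A))" for A
    proof -
      have *: "(z - 2) * (1 / 2 * (- (z * A) / 2) - A / 2 + A / 2 - 2 * ((- A / z) / 2))
        = - ((z - 2)\<^sup>2 * (z + 2) / (4 * z\<^sup>2) * (z * A))" if "z > 0" for z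
        using that by (simp add: field_simps power2_eq_square)
      have y4: "y + 4 > 0" "y + 2 = y + 4 - 2" by (simp_all add: y_def)
      show ?thesis unfolding y4(2) by (rule *[OF y4(1)])
    qed
    have down: "(y + 2) * (1 / 2 * (y * A / 2) - A / 2 - A / 2 - 2 * ((- A / y) / 2))
        = (y - 2)\<^sup>2 * (y + 2) / (4 * y\<^sup>2) * (y * A)" if "y = 0 \<Longrightarrow> A = 0" for A
      using that by (cases "y = 0") (simp_all add: field_simps power2_eq_square)
    have "real k * fcoef 0 (L_op (ts 0 a) v) k
       = (y + 2) * (1 / 2 * (y * a j / 2) - a j / 2 - a j / 2 - 2 * ((- a j / y) / 2))
       + (y + 2) * (1 / 2 * (- ((y + 4) * a (k + 2)) / 2) - a (k + 2) / 2 + a (k + 2) / 2 - 2 * ((- a (k + 2) / (y + 4)) / 2))"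
      unfolding F f rk using False by (simp add: k2 y_def[symmetric] algebra_simps add_divide_distrib diff_divide_distrib)
    also have "\<dots> = Lam (\<lambda>k. real k * a k) k"
    proof -
      have "y = 0 \<Longrightarrow> a j = 0" using a(2) by (simp add: y_def)
      from down[OF this] show ?thesis
        unfolding up using False by (simp add: Lam_def d_DG_def k2 rk y_def[symmetric] add.commute)
    qed
    finally show ?thesis .
  qed
qed

section \<open>Uniqueness for Jacobi systems\<close>

lemma jac_solution_unique:
  assumes q: "jac_coupling q" and T: "t \<in> {0..T}"
    and z01: "\<And>t. t \<in> {0..T} \<Longrightarrow> z t 0 = 0" "\<And>t. t \<in> {0..T} \<Longrightarrow> z t 1 = 0"
    and der: "\<And>t k. t \<in> {0..T} \<Longrightarrow> ((\<lambda>r. z r k) has_real_derivative - jac q (z t) k) (at t within {0..T})"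
    and bd: "\<And>t k. t \<in> {0..T} \<Longrightarrow> (real k + 1) * \<bar>z t k\<bar> \<le> B" and z0: "\<And>k. z 0 k = 0"
  shows "z t k = 0"
proof -
  define E where "E N t = (\<Sum>k\<le>Suc N. (z t k)\<^sup>2)" for N t
  have B0: "0 \<le> B" using bd[OF T, of 0] by simp
  have bound: "E N t \<le> exp (4 * t) * (4 * B\<^sup>2 / (real N + 1) * t)" for N
  proof -
    define E' where "E' t = - 2 * (\<Sum>k\<le>Suc N. z t k * jac q (z t) k)" for t
    have "E N t \<le> exp (4 * t) * (E N 0 + 4 * B\<^sup>2 / (real N + 1) * t)"
    proof (rule gronwall[OF _ _ _ _ T])
      fix u assume u: "u \<in> {0..T}"
      have "(E N has_real_derivative (\<Sum>k\<le>Suc N. 2 * (z u k * - jac q (z u) k))) (at u within {0..T})"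
        unfolding E_def[abs_def] using der[OF u] by (auto intro!: derivative_eq_intros sum.cong)
      then show "(E N has_real_derivative E' u) (at u within {0..T})"
        unfolding E'_def by (simp add: sum_distrib_left sum_negf mult.assoc)
      \<comment> \<open>The factor j + 1 from the coupling is absorbed by the bound on one entry,
        while the bound on the other entry supplies the decay in N.\<close>
      have prod_le: "q j * (\<bar>z u j\<bar> * \<bar>z u (j + 2)\<bar>) \<le> B\<^sup>2 / (real N + 1)" if "N \<le> j" for j
      proof -
        have "q j * (\<bar>z u j\<bar> * \<bar>z u (j + 2)\<bar>) \<le> (real j + 1) * (\<bar>z u j\<bar> * \<bar>z u (j + 2)\<bar>)"
          using jac_couplingD(1,2)[OF q, of j] by (intro mult_right_mono) auto
        also have "\<dots> = ((real j + 1) * \<bar>z u j\<bar>) * \<bar>z u (j + 2)\<bar>" by simp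
        also have "\<dots> \<le> B * (B / (real N + 1))"
        proof (rule mult_mono)
          have "(real N + 1) * \<bar>z u (j + 2)\<bar> \<le> (real (j + 2) + 1) * \<bar>z u (j + 2)\<bar>" using that by (intro mult_right_mono) auto
          also have "\<dots> \<le> B" by (rule bd[OF u])
          finally show "\<bar>z u (j + 2)\<bar> \<le> B / (real N + 1)" by (simp add: field_simps)
        qed (use bd[OF u, of j] B0 in auto)
        finally show ?thesis by (simp add: power2_eq_square)
      qed
      have id: "(\<Sum>k\<le>Suc N. z u k * jac q (z u) k) =
         (\<Sum>k\<le>Suc N. if k < 2 then 0 else (q k - q (k - 2)) * (z u k)\<^sup>2)
         - q (N + 1) * z u (N + 1) * z u (N + 3) - q N * z u N * z u (N + 2)"
        using jac_energy_identity[OF z01(1)[OF u] z01(2)[OF u], where p = "\<lambda>_. 1" and q = q and N = N] by simp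
      have "\<bar>\<Sum>k\<le>Suc N. if k < 2 then 0 else (q k - q (k - 2)) * (z u k)\<^sup>2\<bar> \<le> (\<Sum>k\<le>Suc N. 2 * (z u k)\<^sup>2)"
      proof (rule order_trans[OF sum_abs], rule sum_mono)
        fix k
        show "\<bar>if k < 2 then 0 else (q k - q (k - 2)) * (z u k)\<^sup>2\<bar> \<le> 2 * (z u k)\<^sup>2"
          using jac_coupling_diff[OF q, of k] by (auto simp: abs_mult intro!: mult_right_mono)
      qed
      also have "\<dots> = 2 * E N u" by (simp add: E_def sum_distrib_left)
      finally have 1: "\<bar>\<Sum>k\<le>Suc N. if k < 2 then 0 else (q k - q (k - 2)) * (z u k)\<^sup>2\<bar> \<le> 2 * E N u" .
      have 2: "\<bar>q (N + 1) * z u (N + 1) * z u (N + 3)\<bar> \<le> B\<^sup>2 / (real N + 1)"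
        using prod_le[of "N + 1"] jac_couplingD(1)[OF q, of "N + 1"] by (simp add: abs_mult mult.assoc numeral_3_eq_3)
      have 3: "\<bar>q N * z u N * z u (N + 2)\<bar> \<le> B\<^sup>2 / (real N + 1)"
        using prod_le[of N] jac_couplingD(1)[OF q, of N] by (simp add: abs_mult mult.assoc)
      \<comment> \<open>The factor 2 from differentiating squares meets the diagonal bound 2, and
        likewise two boundary products; this accounts for both constants 4.\<close>
      have "E' u \<le> 4 * E N u + 4 * (B\<^sup>2 / (real N + 1))"
        unfolding E'_def id using 1 2 3 unfolding abs_le_iff by argo
      then show "E' u \<le> 4 * E N u + 4 * B\<^sup>2 / (real N + 1)" by simp
    qed auto
    moreover have "E N 0 = 0" by (simp add: E_def z0)
    ultimately show ?thesis by simp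
  qed
  have le: "(z t k)\<^sup>2 \<le> exp (4 * t) * (4 * B\<^sup>2 * inverse (real (Suc N)) * t)" if "k \<le> N" for N
  proof -
    have "(z t k)\<^sup>2 \<le> E N t" unfolding E_def
      by (rule member_le_sum[of k "{..Suc N}" "\<lambda>k. (z t k)\<^sup>2"]) (use that in auto)
    also note bound[of N]
    finally show ?thesis by (simp add: divide_inverse add.commute)
  qed
  have "(\<lambda>N. exp (4 * t) * (4 * B\<^sup>2 * inverse (real (Suc N)) * t)) \<longlonglongrightarrow> exp (4 * t) * (4 * B\<^sup>2 * 0 * t)"
    by (intro tendsto_intros LIMSEQ_inverse_real_of_nat)
  then have "(z t k)\<^sup>2 \<le> exp (4 * t) * (4 * B\<^sup>2 * 0 * t)"
    by (rule LIMSEQ_le_const) (use le in blast)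
  then show ?thesis by simp
qed

text \<open>Continuity bounds the norm near each time, and bisection extends this to the compact
  interval.\<close>

lemma hcont_bounded:
  assumes c: "hcont s T c" and T: "0 \<le> T"
  obtains B where "\<And>t. t \<in> {0..T} \<Longrightarrow> (\<Sum>k. wsq s (c t) k) \<le> B"
proof -
  define P where "P u w = (\<exists>B. \<forall>t\<in>{u..w} \<inter> {0..T}. (\<Sum>k. wsq s (c t) k) \<le> B)" for u w
  have "P 0 T" using T
  proof (induction rule: Bolzano)
    case (trans a b c')
    then obtain B1 B2 where B: "\<forall>t\<in>{a..b} \<inter> {0..T}. (\<Sum>k. wsq s (c t) k) \<le> B1" "\<forall>t\<in>{b..c'} \<inter> {0..T}. (\<Sum>k. wsq s (c t) k) \<le> B2"
      unfolding P_def by blast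
    have "(\<Sum>k. wsq s (c t) k) \<le> max B1 B2" if "t \<in> {a..c'} \<inter> {0..T}" for t
      using B that by (cases "t \<le> b") (auto simp: le_max_iff_disj)
    then show ?case unfolding P_def by blast
  next
    case (local x)
    then have x: "x \<in> {0..T}" by simp
    have L: "((\<lambda>r. \<Sum>k. wsq s (\<lambda>k. c r k - c x k) k) \<longlongrightarrow> 0) (at x within {0..T})"
      using c x unfolding hcont_def by blast
    obtain d where d: "d > 0" "\<And>r. r \<in> {0..T} \<Longrightarrow> r \<noteq> x \<Longrightarrow> dist r x < d \<Longrightarrow> dist (\<Sum>k. wsq s (\<lambda>k. c r k - c x k) k) 0 < 1"
      using tendstoD[OF L zero_less_one] unfolding eventually_at by auto
    have "P a b" if ab: "a \<le> x \<and> x \<le> b \<and> b - a < d" for a b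
      unfolding P_def
    proof (intro exI ballI)
      fix t assume t: "t \<in> {a..b} \<inter> {0..T}"
      have "(\<Sum>k. wsq s (\<lambda>k. c t k - c x k) k) \<le> 1"
      proof (cases "t = x")
        case False
        have "dist t x < d" using t ab by (auto simp: dist_real_def)
        then show ?thesis using d(2)[of t] False t by (simp add: dist_real_def)
      qed (simp add: wsq_def)
      moreover have s: "summable (wsq s (c t))" "summable (wsq s (c x))" using c t x by (auto simp: hcont_def)
      moreover have "(\<Sum>k. wsq s (\<lambda>k. (c t k - c x k) + c x k) k) \<le> 2 * (\<Sum>k. wsq s (\<lambda>k. c t k - c x k) k) + 2 * (\<Sum>k. wsq s (c x) k)"
        by (rule summable_wsq_add(2)[OF summable_wsq_diff(1)[OF s] s(2)])
      ultimately show "(\<Sum>k. wsq s (c t) k) \<le> 2 + 2 * (\<Sum>k. wsq s (c x) k)" by simp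
    qed
    then show ?case using d(1) by blast
  qed
  then obtain B where "\<forall>t\<in>{0..T} \<inter> {0..T}. (\<Sum>k. wsq s (c t) k) \<le> B" unfolding P_def by blast
  then show ?thesis by (intro that[of B]) simp
qed

section \<open>The change of unknown between eta and w\<close>

lemma acoef_diff: "acoef (\<lambda>k. x k - y k) k = acoef x k - acoef y k"
  unfolding acoef_def diff_divide_distrib[symmetric] by (simp add: algebra_simps)

lemma acoef_0: "acoef c 0 = 0"
  by (simp add: acoef_def)

text \<open>Division by k gains one power of the weight: eta has one derivative more than w.\<close>

lemma acoef_wsq_le:
  "wsq (Suc s) (acoef x) k \<le> (8 * pi * 9 ^ s) * (wsq s x (k - 2) + wsq s x (k - 1) + wsq s x k + wsq s x (k + 1) + wsq s x (k + 2))"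
proof (cases "k = 0")
  case True
  then show ?thesis by (simp add: acoef_0 wsq_def)
next
  case False
  then have k: "real k \<ge> 1" by simp
  define A where "A = x (k + 1)"
  define B where "B = x (k - 1)"
  have k1: "real (k - 1) = real k - 1" using False by (simp add: of_nat_diff)
  have r: "((real k + 1) / real k)\<^sup>2 \<le> 2\<^sup>2" using k by (intro power_mono) (auto simp: field_simps)
  have "wsq (Suc s) (acoef x) k = (real k + 1) ^ (2 * s) * (pi * (A - B)\<^sup>2) * ((real k + 1) / real k)\<^sup>2"
    by (simp add: wsq_def acoef_def A_def B_def power_divide power_mult_distrib power2_eq_square mult_ac)
  also have "\<dots> \<le> (real k + 1) ^ (2 * s) * (pi * (2 * A\<^sup>2 + 2 * B\<^sup>2)) * 2\<^sup>2"
    using r sq_add_le[of A "- B"] by (intro mult_mono mult_left_mono) auto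
  also have "\<dots> = 8 * pi * ((real k + 1) ^ (2 * s) * A\<^sup>2) + 8 * pi * ((real k + 1) ^ (2 * s) * B\<^sup>2)"
    by (simp add: algebra_simps)
  also have "\<dots> \<le> 8 * pi * (9 ^ s * wsq s x (k + 1)) + 8 * pi * (9 ^ s * wsq s x (k - 1))"
  proof (intro add_mono mult_left_mono)
    have "(real k + 1) ^ (2 * s) * A\<^sup>2 \<le> wsq s x (k + 1)"
      unfolding wsq_def A_def by (intro mult_right_mono power_mono) auto
    also have "\<dots> \<le> 9 ^ s * wsq s x (k + 1)" by (simp add: mult_le_cancel_right1 wsq_nonneg[THEN leD])
    finally show "(real k + 1) ^ (2 * s) * A\<^sup>2 \<le> 9 ^ s * wsq s x (k + 1)" .
    have "(real k + 1) ^ (2 * s) \<le> (real (k - 1) + 3) ^ (2 * s)" by (intro power_mono) (auto simp: k1)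
    also have "\<dots> \<le> 9 ^ s * (real (k - 1) + 1) ^ (2 * s)" by (rule weight_shift_le)
    finally have "(real k + 1) ^ (2 * s) * B\<^sup>2 \<le> (9 ^ s * (real (k - 1) + 1) ^ (2 * s)) * B\<^sup>2" by (rule mult_right_mono) simp
    then show "(real k + 1) ^ (2 * s) * B\<^sup>2 \<le> 9 ^ s * wsq s x (k - 1)" by (simp add: wsq_def B_def)
  qed auto
  also have "\<dots> = (8 * pi * 9 ^ s) * (wsq s x (k - 1) + wsq s x (k + 1))" by (simp add: algebra_simps)
  also have "\<dots> \<le> (8 * pi * 9 ^ s) * (wsq s x (k - 2) + wsq s x (k - 1) + wsq s x k + wsq s x (k + 1) + wsq s x (k + 2))"
    using wsq_nonneg[of s x "k - 2"] wsq_nonneg[of s x k] wsq_nonneg[of s x "k + 2"]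
    by (intro mult_left_mono) (linarith, simp)
  finally show ?thesis .
qed

lemma summable_acoef: "summable (wsq s c) \<Longrightarrow> summable (wsq (Suc s) (acoef c))"
  by (rule shift_comparison(1)[OF _ _ _ acoef_wsq_le]) auto

lemma hcont_acoef: "hcont s T c \<Longrightarrow> hcont (Suc s) T (\<lambda>t. acoef (c t))"
  by (rule hcont_map[OF _ acoef_diff acoef_wsq_le]) auto

lemma hcont_mult_index: "hcont (Suc s) T c \<Longrightarrow> hcont s T (\<lambda>t k. real k * c t k)"
proof (rule hcont_map[where \<Phi> = "\<lambda>x k. real k * x k" and C = 1])
  fix x k
  have "(real k + 1) ^ (2 * s) * ((real k)\<^sup>2 * (x k)\<^sup>2) \<le> (real k + 1) ^ (2 * s) * ((real k + 1)\<^sup>2 * (x k)\<^sup>2)"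
    by (intro mult_left_mono mult_right_mono power_mono) auto
  then have "wsq s (\<lambda>k. real k * x k) k \<le> wsq (Suc s) x k"
    by (simp add: wsq_def power_mult_distrib power2_eq_square mult_ac)
  then show "wsq s (\<lambda>k. real k * x k) k \<le> 1 * (wsq (Suc s) x (k - 2) + wsq (Suc s) x (k - 1) + wsq (Suc s) x k + wsq (Suc s) x (k + 1) + wsq (Suc s) x (k + 2))"
    using wsq_nonneg[of "Suc s" x "k - 2"] wsq_nonneg[of "Suc s" x "k - 1"] wsq_nonneg[of "Suc s" x "k + 1"] wsq_nonneg[of "Suc s" x "k + 2"]
    by argo
qed (auto simp: algebra_simps)

text \<open>The substitution behind the weighted space: \<open>\<partial>\<^sub>\<theta>\<eta> = 2 sqrt \<pi> sin \<theta> w\<close>.\<close>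

lemma ts_acoef_derivative:
  assumes c: "summable (\<lambda>k. \<bar>c k\<bar>)" "c 0 = 0" "c 1 = 0"
  shows "ts (Suc 0) (\<lambda>k. real k * acoef c k) x = 2 * sqrt pi * sin x * ts 0 c x"
proof -
  \<comment> \<open>\<open>S\<close> and \<open>U\<close> collect the frequencies k - 1 and k + 1.
    After reindexing, c 0 = 0 removes the frequency -1, and c 1 = 0 removes the constant
    term.\<close>
  define S where "S = (\<Sum>k. c k * cos (real k * x - x))"
  define U where "U = (\<Sum>k. c k * cos (real k * x + x))"
  have sm: "summable (\<lambda>k. c k * cos (g k))" for g
    by (rule summable_rabs_cancel, rule summable_comparison_test'[OF c(1), of 0])
       (simp add: abs_mult mult_left_le)
  have "(\<lambda>k. c k * cos (real k * x - x)) sums S" unfolding S_def by (intro summable_sums sm)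
  then have "(\<lambda>k. c (Suc k) * cos (real (Suc k) * x - x)) sums S"
    using c(2) by (subst sums_Suc_iff[of "\<lambda>k. c k * cos (real k * x - x)"]) simp
  then have 1: "(\<lambda>k. c (Suc k) * cos (real k * x)) sums S" by (simp add: algebra_simps)
  have "(\<lambda>k. c k * cos (real k * x + x)) sums U" unfolding U_def by (intro summable_sums sm)
  then have "(\<lambda>k. (\<lambda>k. if k = 0 then 0 else c (k - 1) * cos (real k * x)) (Suc k)) sums U" by (simp add: algebra_simps)
  then have 2: "(\<lambda>k. if k = 0 then 0 else c (k - 1) * cos (real k * x)) sums U"
    using sums_Suc[of "\<lambda>k. if k = 0 then 0 else c (k - 1) * cos (real k * x)" U] by simp
  have "(\<lambda>k. sqrt pi * (c (Suc k) * cos (real k * x) - (if k = 0 then 0 else c (k - 1) * cos (real k * x)))) sums (sqrt pi * (S - U))"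
    by (intro sums_mult sums_diff 1 2)
  moreover have "sqrt pi * (c (Suc k) * cos (real k * x) - (if k = 0 then 0 else c (k - 1) * cos (real k * x))) = real k * acoef c k * tr (Suc 0) k x" for k
  proof (cases "k = 0")
    case False
    have "real k * acoef c k = sqrt pi * (c (k + 1) - c (k - 1))" using False by (simp add: acoef_def)
    then show ?thesis using False by (simp only: tr_1) (simp add: algebra_simps)
  qed (use c(3) in simp)
  ultimately have "(\<lambda>k. real k * acoef c k * tr (Suc 0) k x) sums (sqrt pi * (S - U))" by (simp only:)
  then have lhs: "ts (Suc 0) (\<lambda>k. real k * acoef c k) x = sqrt pi * (S - U)"
    unfolding ts_def by (rule sums_unique[symmetric])
  have "S - U = (\<Sum>k. c k * cos (real k * x - x) - c k * cos (real k * x + x))"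
    unfolding S_def U_def by (intro suminf_diff sm)
  also have "\<dots> = (\<Sum>k. 2 * sin x * (c k * tr 0 k x))"
    by (intro suminf_cong) (simp add: tr_0 cos_add cos_diff algebra_simps)
  also have "\<dots> = 2 * sin x * ts 0 c x" unfolding ts_def by (intro suminf_mult ts_summable c)
  finally show ?thesis unfolding lhs by simp
qed

lemma AE_sin_nonzero: "AE x in torus. sin x \<noteq> 0"
proof -
  have "x \<in> {0, pi, - pi}" if "sin x = 0" "x \<in> {-pi..pi}" for x :: real
  proof (rule ccontr)
    assume n: "x \<notin> {0, pi, - pi}"
    then have "0 < \<bar>x\<bar>" "\<bar>x\<bar> < pi" using that by auto
    then have "0 < sin \<bar>x\<bar>" by (rule sin_gt_zero)
    then show False using that by (auto simp: abs_if split: if_splits)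
  qed
  note * = this
  have "negligible {0, pi, - pi :: real}" by simp
  then have "{0, pi, - pi :: real} \<in> null_sets lebesgue" by (simp add: negligible_iff_null_sets)
  from AE_not_in[OF this] have "AE x in torus. x \<notin> {0, pi, - pi}"
    by (intro AE_restrict_space_iff[THEN iffD2]) auto
  moreover have "AE x in torus. x \<in> {-pi..pi}" by (rule AE_I2) simp
  ultimately show ?thesis by eventually_elim (use * in blast)
qed

text \<open>At the zeros of sine \<open>rho_half\<close> is 0 by the convention on division, and the
  chosen weak derivative is known only up to null sets; so the factorization of the derivative is
  stated almost everywhere.\<close>

lemma weighted_deriv_AE:
  assumes "has_weak_deriv \<eta> g"
  shows "AE x in torus. g x = 2 * sqrt pi * sin x * weighted_deriv \<eta> x"
proof -
  have "AE x in torus. wderiv \<eta> x = g x" by (rule has_weak_deriv_unique[OF has_weak_deriv_wderiv[OF assms] assms])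
  then show ?thesis using AE_sin_nonzero
    by eventually_elim (simp add: weighted_deriv_def rho_half_def)
qed

lemma weighted_deriv_periodic:
  assumes "has_weak_deriv \<eta> g"
  shows "periodic (weighted_deriv \<eta>)"
  using has_weak_deriv_wderiv[OF assms] by (simp add: has_weak_deriv_def periodic_def weighted_deriv_def rho_half_def)

lemma has_weak_deriv_ts_acoef:
  assumes c: "summable (wsq 1 c)"
  shows "has_weak_deriv (ts 0 (acoef c)) (ts (Suc 0) (\<lambda>k. real k * acoef c k))"
proof -
  have s2: "summable (wsq 2 (acoef c))" using summable_acoef[OF c] by (simp add: numeral_2_eq_2)
  have w: "summable (\<lambda>k. real k * \<bar>acoef c k\<bar>)" by (rule wsq_weighted_summable[OF s2])
  show ?thesis
    by (rule pclass_imp_weak_deriv[OF pclass_ts[OF weighted_summable_abs[OF w] acoef_0] pclass_ts])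
       (use w in \<open>auto simp: abs_mult\<close>)
qed

text \<open>The chosen weak derivative agrees with the differentiated series only almost everywhere,
  which is enough to identify the Fourier coefficients.\<close>

lemma weighted_deriv_ts:
  assumes c: "summable (wsq 1 c)" "c 0 = 0" "c 1 = 0"
  shows "AE x in torus. weighted_deriv (ts 0 (acoef c)) x = ts 0 c x" "pclass 0 (weighted_deriv (ts 0 (acoef c))) c"
proof -
  have sc: "summable (\<lambda>k. \<bar>c k\<bar>)" by (rule wsq_abs_summable(1)[OF c(1)])
  note w = has_weak_deriv_ts_acoef[OF c(1)]
  show ae: "AE x in torus. weighted_deriv (ts 0 (acoef c)) x = ts 0 c x"
    using weighted_deriv_AE[OF w] AE_sin_nonzero
    by eventually_elim (simp add: ts_acoef_derivative[OF sc c(2,3)])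
  have "wderiv (ts 0 (acoef c)) \<in> borel_measurable torus"
    using has_weak_deriv_wderiv[OF w] by (auto simp: has_weak_deriv_def)
  moreover have "rho_half \<in> borel_measurable torus"
  proof -
    have "rho_half \<in> borel_measurable borel" unfolding rho_half_def[abs_def] by measurable
    then show ?thesis by (intro measurable_restrict_space1 measurable_completion) simp
  qed
  ultimately have [measurable]: "weighted_deriv (ts 0 (acoef c)) \<in> borel_measurable torus"
    unfolding weighted_deriv_def[abs_def] by measurable
  have ti: "integrable torus (ts 0 c)" by (rule integrable_torus_continuous[OF continuous_on_ts[OF sc]])
  have "integrable torus (weighted_deriv (ts 0 (acoef c)))"
    by (rule integrable_cong_AE_imp[OF ti]) (use ae in auto)
  moreover have "AE x in torus. ts 0 c x = weighted_deriv (ts 0 (acoef c)) x" using ae by eventually_elim simp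
  ultimately show "pclass 0 (weighted_deriv (ts 0 (acoef c))) c"
    using pclass_cong_AE[OF pclass_ts[OF sc c(2)] weighted_deriv_periodic[OF w]] by blast
qed

text \<open>That the cosine coefficients of \<open>w = \<partial>\<^sub>\<theta>\<eta> / (2 sqrt \<pi> sin \<theta>)\<close> vanish: oddness of \<open>\<eta>\<close> makes
  them 2-periodic in \<open>k\<close>, while Bessel's inequality makes them tend to 0.\<close>

lemma H_DW_expansion:
  assumes \<eta>: "\<eta> \<in> H_DW" and w: "weighted_deriv \<eta> \<in> Sob m" and m: "m \<ge> 1"
  defines "c \<equiv> fcoef 0 (weighted_deriv \<eta>)"
  shows "pclass 0 (weighted_deriv \<eta>) c" "c 0 = 0" "c 1 = 0" "summable (wsq m c)" "\<eta> = ts 0 (acoef c)"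
proof -
  define W where "W = weighted_deriv \<eta>"
  obtain g where g: "has_weak_deriv \<eta> g" using \<eta> by (auto simp: H_DW_def)
  have odd: "odd_fun \<eta>" and cont: "continuous_on UNIV \<eta>" and per: "periodic \<eta>" and ei: "integrable torus \<eta>"
    using \<eta> g by (auto simp: H_DW_def has_weak_deriv_def)
  have WL: "W \<in> L2" unfolding W_def by (rule Sob_L2[OF w])
  have Wi: "integrable torus W" by (rule L2_imp_integrable[OF WL])
  have gi: "integrable torus g" using g by (simp add: has_weak_deriv_def)
  have ae: "AE x in torus. g x = 2 * sqrt pi * sin x * W x" unfolding W_def by (rule weighted_deriv_AE[OF g])
  have gW: "fcoef p g k = fcoef p (\<lambda>x. (2 * sqrt pi * sin x) * W x) k" for p k
  proof (rule fcoef_cong_AE[OF gi _ ae])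
    have "integrable torus (\<lambda>x. W x * (2 * sqrt pi * sin x))" by (intro integrable_torus_mult Wi continuous_intros)
    then show "integrable torus (\<lambda>x. 2 * sqrt pi * sin x * W x)" by (simp add: mult.commute)
  qed
  have g0: "fcoef 0 g k = sqrt pi * (fcoef (Suc 0) W (k - 1) - fcoef (Suc 0) W (k + 1))" if k: "k \<ge> 1" for k
  proof -
    have "2 * sqrt pi * sin x * tr 0 k x = (2 * sqrt pi * tr (Suc 0) (k - 1) x + (- 2 * sqrt pi) * tr (Suc 0) (k + 1) x) / 2" for x
      using k by (simp add: tr_0 tr_1 of_nat_diff algebra_simps cos_add cos_diff)
    from fcoef_mult[OF Wi this] show ?thesis unfolding gW by (simp add: algebra_simps)
  qed
  have g1: "fcoef (Suc 0) g k = sqrt pi * (fcoef 0 W (k + 1) - fcoef 0 W (k - 1))" if k: "k \<ge> 1" for k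
  proof -
    have "2 * sqrt pi * sin x * tr (Suc 0) k x = (2 * sqrt pi * tr 0 (k + 1) x + (- 2 * sqrt pi) * tr 0 (k - 1) x) / 2" for x
      using k by (simp add: tr_0 tr_1 of_nat_diff algebra_simps sin_add sin_diff)
    from fcoef_mult[OF Wi this] show ?thesis unfolding gW by (simp add: algebra_simps)
  qed
  have cosz: "fcoef (Suc 0) W j = 0" for j
  proof -
    have "fcoef 0 g k = 0" for k
      using has_weak_deriv_fcoef[OF g, of k 0] fcoef_odd[OF odd, of k] by simp
    then have step: "fcoef (Suc 0) W (k + 2) = fcoef (Suc 0) W k" for k
      using g0[of "k + 1"] by simp
    have per2: "fcoef (Suc 0) W (j + 2 * n) = fcoef (Suc 0) W j" for n
    proof (induction n)
      case (Suc n)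
      then show ?case using step[of "j + 2 * n"] by (simp add: algebra_simps)
    qed simp
    have bes: "pi * (real n * (fcoef (Suc 0) W j)\<^sup>2) \<le> (LINT x|torus. (W x)\<^sup>2)" for n
    proof -
      \<comment> \<open>A set of n indices congruent to j modulo 2, all carrying the same
        coefficient. The shift by i + 1 keeps 0 out of it, as Bessel's inequality requires.\<close>
      define S where "S = (\<lambda>i. j + 2 * (i + 1)) ` {..<n}"
      have "(\<Sum>k\<in>S. (fcoef (Suc 0) W k)\<^sup>2) = (\<Sum>i<n. (fcoef (Suc 0) W j)\<^sup>2)"
        unfolding S_def by (subst sum.reindex) (auto simp: inj_on_def per2 simp del: mult_Suc_right)
      moreover have "pi * (\<Sum>k\<in>S. (fcoef (Suc 0) W k)\<^sup>2) \<le> (LINT x|torus. (W x)\<^sup>2)"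
        using WL by (intro bessel) (auto simp: L2_def S_def)
      ultimately show ?thesis by simp
    qed
    show ?thesis
    proof (rule ccontr)
      assume "fcoef (Suc 0) W j \<noteq> 0"
      then have p: "0 < pi * (fcoef (Suc 0) W j)\<^sup>2" by simp
      obtain n where "(LINT x|torus. (W x)\<^sup>2) < real n * (pi * (fcoef (Suc 0) W j)\<^sup>2)"
        using reals_Archimedean3[OF p] by blast
      then show False using bes[of n] by (simp add: mult_ac)
    qed
  qed
  have c: "c = fcoef 0 W" by (simp add: c_def W_def)
  show c0: "c 0 = 0" by (simp add: c_def fcoef_0_0)
  show c1: "c 1 = 0"
  proof -
    have "(LINT x|torus. g x * tr (Suc 0) 0 x) = 0" using has_weak_deriv_tr[OF g, of 0 "Suc 0"] by simp
    then have "fcoef (Suc 0) g 0 = 0" by (simp add: fcoef_def)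
    moreover have "2 * sqrt pi * sin x * tr (Suc 0) 0 x = (4 * sqrt pi * tr 0 1 x + 0 * tr 0 0 x) / 2" for x
      by (simp add: tr_0 tr_1)
    from fcoef_mult[OF Wi this] have "fcoef (Suc 0) g 0 = 2 * sqrt pi * fcoef 0 W 1" unfolding gW by simp
    ultimately show ?thesis by (simp add: c)
  qed
  show pc: "pclass 0 (weighted_deriv \<eta>) c"
    using Wi weighted_deriv_periodic[OF g] c0 cosz by (auto simp: pclass_def W_def c_def)
  show sm: "summable (wsq m c)" by (rule Sob_summable(1)[OF w pc])
  have s1: "summable (wsq 1 c)" by (rule summable_wsq_mono[OF sm m])
  have "summable (wsq 2 (acoef c))" using summable_acoef[OF s1] by (simp add: numeral_2_eq_2)
  then have sa: "summable (\<lambda>k. \<bar>acoef c k\<bar>)" using summable_wsq_mono[of 2 _ 1] wsq_abs_summable(1) by auto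
  have ecoef: "fcoef 0 \<eta> k = acoef c k" for k
  proof (cases "k = 0")
    case False
    have "real k * fcoef (Suc (Suc 0)) \<eta> k = - fcoef (Suc 0) g k" by (rule has_weak_deriv_fcoef[OF g])
    then have "real k * fcoef 0 \<eta> k = sqrt pi * (c (k + 1) - c (k - 1))" using False g1[of k] by (simp add: fcoef_Suc_Suc c)
    then show ?thesis using False by (simp add: acoef_def field_simps)
  qed (simp add: acoef_0 fcoef_0_0)
  have pts: "pclass 0 (ts 0 (acoef c)) (acoef c)" by (rule pclass_ts[OF sa acoef_0])
  show "\<eta> = ts 0 (acoef c)"
  proof
    fix x
    have "\<eta> x - ts 0 (acoef c) x = 0"
    proof (rule continuous_odd_eq_zero[where f = "\<lambda>x. \<eta> x - ts 0 (acoef c) x"])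
      show "periodic (\<lambda>x. \<eta> x - ts 0 (acoef c) x)" using per ts_periodic[of 0 "acoef c"] by (simp add: periodic_def)
      show "continuous_on UNIV (\<lambda>x. \<eta> x - ts 0 (acoef c) x)" by (intro continuous_intros cont continuous_on_ts sa)
      show "odd_fun (\<lambda>x. \<eta> x - ts 0 (acoef c) x)" using odd ts_even_odd(1)[OF sa] by (simp add: odd_fun_def)
      have "pclass 0 \<eta> (acoef c)" using per ei ecoef fcoef_odd[OF odd] by (simp add: pclass_def acoef_0)
      from pclass_diff[OF this pts] show "fcoef 0 (\<lambda>x. \<eta> x - ts 0 (acoef c) x) k = 0" for k by (simp add: pclass_def)
    qed
    then show "\<eta> x = ts 0 (acoef c) x" by simp
  qed
qed

section \<open>Membership and norm in the weighted space\<close>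

lemma H_DW_ts:
  assumes c: "summable (wsq 1 c)" "c 0 = 0" "c 1 = 0"
  shows "ts 0 (acoef c) \<in> H_DW"
proof -
  have s2: "summable (wsq 2 (acoef c))" using summable_acoef[OF c(1)] by (simp add: numeral_2_eq_2)
  have w: "summable (\<lambda>k. real k * \<bar>acoef c k\<bar>)" by (rule wsq_weighted_summable[OF s2])
  note sa = weighted_summable_abs[OF w]
  have pc: "pclass 0 (ts 0 (acoef c)) (acoef c)" by (rule pclass_ts[OF sa acoef_0])
  have "ts 0 (acoef c) \<in> Sob 1"
    using pclass_Sob[OF pc summable_wsq_mono[OF s2, of 1]] by simp
  moreover have "continuous_on UNIV (ts 0 (acoef c))" by (rule continuous_on_ts[OF sa])
  moreover have "odd_fun (ts 0 (acoef c))" using ts_even_odd(1)[OF sa] by (simp add: odd_fun_def)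
  moreover have "integrable torus (\<lambda>\<theta>. (wderiv (ts 0 (acoef c)) \<theta>)\<^sup>2 / (sin \<theta>)\<^sup>2)"
  proof -
    note wd = weighted_deriv_ts[OF c]
    have "summable (wsq 0 c)" by (rule summable_wsq_mono[OF c(1)]) simp
    moreover have "wsq 0 c = (\<lambda>k. (c k)\<^sup>2)" by (rule ext) (simp add: wsq_def)
    ultimately have L: "weighted_deriv (ts 0 (acoef c)) \<in> L2" using pclass_L2[OF wd(2)] by simp
    have "(wderiv (ts 0 (acoef c)) \<theta>)\<^sup>2 / (sin \<theta>)\<^sup>2 = 4 * pi * (weighted_deriv (ts 0 (acoef c)) \<theta>)\<^sup>2" for \<theta>
      by (simp add: weighted_deriv_def rho_half_def power_divide power_mult_distrib)
    then show ?thesis using L by (simp add: L2_def)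
  qed
  ultimately show ?thesis by (simp add: H_DW_def)
qed

text \<open>Since \<open>rho\<close> is the square of \<open>rho_half\<close>, the weighted norm is
  the L^2 norm of \<open>weighted_deriv\<close>. The bound is put in terms of weight 1, the weight
  in which the continuity of the coefficients is then invoked.\<close>

lemma DW_norm_le:
  assumes c: "summable (wsq 1 c)" "c 0 = 0" "c 1 = 0"
  shows "DW_norm (ts 0 (acoef c)) \<le> sqrt (pi * (\<Sum>k. wsq 1 c k))" "0 \<le> DW_norm (ts 0 (acoef c))"
proof -
  note wd = weighted_deriv_ts[OF c]
  have s0: "summable (wsq 0 c)" by (rule summable_wsq_mono[OF c(1)]) simp
  have e0: "wsq 0 c = (\<lambda>k. (c k)\<^sup>2)" by (rule ext) (simp add: wsq_def)
  have "rho \<theta> * wderiv (ts 0 (acoef c)) \<theta> * wderiv (ts 0 (acoef c)) \<theta> = (weighted_deriv (ts 0 (acoef c)) \<theta>)\<^sup>2" for \<theta>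
    by (simp add: weighted_deriv_def rho_half_def rho_def power2_eq_square)
  then have D: "DW_inner (ts 0 (acoef c)) (ts 0 (acoef c)) = (LINT \<theta>|torus. (weighted_deriv (ts 0 (acoef c)) \<theta>)\<^sup>2)"
    by (simp add: DW_inner_def)
  also have "\<dots> \<le> pi * (\<Sum>k. wsq 0 c k)" using pclass_L2(2)[OF wd(2)] s0 unfolding e0 by simp
  also have "\<dots> \<le> pi * (\<Sum>k. wsq 1 c k)" by (intro mult_left_mono suminf_le s0 c wsq_mono) auto
  finally show "DW_norm (ts 0 (acoef c)) \<le> sqrt (pi * (\<Sum>k. wsq 1 c k))" unfolding DW_norm_def by simp
  show "0 \<le> DW_norm (ts 0 (acoef c))" unfolding DW_norm_def D by (intro real_sqrt_ge_zero integral_nonneg_AE) auto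
qed

section \<open>Existence and uniqueness\<close>

text \<open>\<open>Sob_norm\<close> is bounded by the coefficients alone, so the functions
  \<open>U t\<close> may be arbitrary representatives, such as
  \<open>weighted_deriv\<close>.\<close>

lemma C_into_0_pclass:
  assumes b: "hcont s T b" and U: "\<And>t. t \<in> {0..T} \<Longrightarrow> pclass 0 (U t) (b t)"
  shows "C_into 0 T (Sob s) (Sob_norm s) U"
  unfolding C_into.simps
proof (intro ballI conjI)
  fix t assume t: "t \<in> {0..T}"
  have sm: "summable (wsq s (b r))" if "r \<in> {0..T}" for r using b that unfolding hcont_def by blast
  show "U t \<in> Sob s" using pclass_Sob[OF U[OF t] sm[OF t]] by blast
  show "((\<lambda>r. Sob_norm s (\<lambda>x. U r x - U t x)) \<longlongrightarrow> 0) (at t within {0..T})"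
  proof (rule Sob_norm_tendsto)
    show "((\<lambda>r. \<Sum>k. wsq s (\<lambda>k. b r k - b t k) k) \<longlongrightarrow> 0) (at t within {0..T})"
      using b t unfolding hcont_def by blast
    show "pclass 0 (\<lambda>x. U r x - U t x) (\<lambda>k. b r k - b t k) \<and> summable (wsq s (\<lambda>k. b r k - b t k))" if "r \<in> {0..T}" for r
      using that t by (intro conjI pclass_diff U summable_wsq_diff sm)
  qed
qed

lemma C_into_Suc_pclass:
  assumes b: "\<And>t. t \<in> {0..T} \<Longrightarrow> summable (wsq s (b t))" and U: "\<And>t. t \<in> {0..T} \<Longrightarrow> pclass 0 (U t) (b t)"
    and b': "\<And>t. t \<in> {0..T} \<Longrightarrow> summable (wsq s (b' t))" and U': "\<And>t. t \<in> {0..T} \<Longrightarrow> pclass 0 (U' t) (b' t)"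
    and l: "\<And>t. t \<in> {0..T} \<Longrightarrow> ((\<lambda>r. \<Sum>k. wsq s (\<lambda>k. (b r k - b t k) / (r - t) - b' t k) k) \<longlongrightarrow> 0) (at t within {0..T})"
    and C: "C_into n T (Sob s) (Sob_norm s) U'"
  shows "C_into (Suc n) T (Sob s) (Sob_norm s) U"
  unfolding C_into.simps
proof (intro ballI conjI exI[of _ U'] C)
  fix t assume t: "t \<in> {0..T}"
  show "U t \<in> Sob s" using pclass_Sob[OF U[OF t] b[OF t]] by blast
  show "((\<lambda>r. Sob_norm s (\<lambda>x. (U r x - U t x) / (r - t) - U' t x)) \<longlongrightarrow> 0) (at t within {0..T})"
  proof (rule Sob_norm_tendsto[OF _ l[OF t]])
    fix r assume r: "r \<in> {0..T}"
    have "pclass 0 (\<lambda>x. 1 / (r - t) * (U r x - U t x) - U' t x) (\<lambda>k. 1 / (r - t) * (b r k - b t k) - b' t k)"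
      using r t by (intro pclass_diff pclass_scale U U')
    moreover have "summable (wsq s (\<lambda>k. 1 / (r - t) * (b r k - b t k) - b' t k))"
      using r t by (intro summable_wsq_diff summable_wsq_scale b b')
    ultimately show "pclass 0 (\<lambda>x. (U r x - U t x) / (r - t) - U' t x) (\<lambda>k. (b r k - b t k) / (r - t) - b' t k)
        \<and> summable (wsq s (\<lambda>k. (b r k - b t k) / (r - t) - b' t k))" by simp
  qed
qed

lemma jac_has_derivative:
  assumes "\<And>k. ((\<lambda>r. x r k) has_real_derivative x' k) (at t within S)"
  shows "((\<lambda>r. jac q (x r) k) has_real_derivative jac q x' k) (at t within S)"
proof (cases "k < 2")
  case True
  then show ?thesis by (simp add: jac_def)
next
  case False
  have "((\<lambda>r. q (k - 2) * x r (k - 2) + (q k - q (k - 2)) * x r k - q k * x r (k + 2)) has_real_derivative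
     q (k - 2) * x' (k - 2) + (q k - q (k - 2)) * x' k - q k * x' (k + 2)) (at t within S)"
    by (intro DERIV_diff DERIV_add DERIV_cmult assms)
  then show ?thesis using False by (simp add: jac_def)
qed

lemma acoef_has_derivative:
  assumes "\<And>k. ((\<lambda>r. x r k) has_real_derivative x' k) (at t within S)"
  shows "((\<lambda>r. acoef (x r) k) has_real_derivative acoef x' k) (at t within S)"
  unfolding acoef_def by (intro DERIV_cdivide DERIV_cmult DERIV_diff assms)

text \<open>The form of \<open>Lam_jac\<close> used for both existence and uniqueness: the passage
  from c to the coefficients of eta intertwines the two operators.\<close>

lemma Lam_acoef:
  assumes "c 0 = 0" "c 1 = 0" "k \<ge> 1"
  shows "Lam (\<lambda>k. real k * acoef c k) k = real k * acoef (jac q_DG c) k"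
proof -
  have "Lam (\<lambda>k. real k * acoef c k) k = sqrt pi * (jac q_DG c (k + 1) - jac q_DG c (k - 1))"
    by (rule Lam_jac[OF assms(1,2) _ _ assms(3)]) (simp_all add: acoef_def)
  then show ?thesis using assms(3) by (simp add: acoef_def)
qed

text \<open>Leibniz' rule for an integral with a parameter; the joint continuity of the time
  derivative is part of what a classical solution provides.\<close>

lemma fcoef_time_derivative:
  assumes d: "\<And>t \<theta>. t \<in> {0..T} \<Longrightarrow> ((\<lambda>s. f s \<theta>) has_real_derivative ft t \<theta>) (at t within {0..T})"
    and ftc: "continuous_on ({0..T} \<times> UNIV) (\<lambda>(t, \<theta>). ft t \<theta>)"
    and fc: "\<And>t. t \<in> {0..T} \<Longrightarrow> continuous_on UNIV (f t)" and t: "t \<in> {0..T}"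
  shows "((\<lambda>s. fcoef p (f s) k) has_real_derivative fcoef p (ft t) k) (at t within {0..T})"
proof -
  have ft_t: "continuous_on UNIV (ft t)" if "t \<in> {0..T}" for t
  proof -
    have "continuous_on UNIV ((\<lambda>(t, \<theta>). ft t \<theta>) \<circ> (\<lambda>\<theta>. (t, \<theta>)))"
      by (rule continuous_on_compose[OF _ continuous_on_subset[OF ftc]]) (use that in \<open>auto intro!: continuous_intros\<close>)
    then show ?thesis by (simp add: o_def)
  qed
  have eq: "fcoef p g k = integral (cbox (- pi) pi) (\<lambda>x. g x * tr p k x) / pi" if "continuous_on UNIV g" for g
    unfolding fcoef_def using that
    by (subst lebesgue_integral_eq_integral) (auto intro!: integrable_torus_continuous continuous_intros)
  have "((\<lambda>s. integral (cbox (- pi) pi) (\<lambda>x. f s x * tr p k x)) has_real_derivative integral (cbox (- pi) pi) (\<lambda>x. ft t x * tr p k x)) (at t within {0..T})"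
  proof (rule leibniz_rule_field_derivative[OF _ _ _ t])
    show "((\<lambda>s. f s x * tr p k x) has_real_derivative ft s x * tr p k x) (at s within {0..T})" if "s \<in> {0..T}" for s x
      by (rule DERIV_cmult_right[OF d[OF that]])
    show "(\<lambda>x. f s x * tr p k x) integrable_on cbox (- pi) pi" if "s \<in> {0..T}" for s
      by (intro integrable_continuous continuous_intros continuous_on_subset[OF fc[OF that]]) auto
    have "continuous_on ({0..T} \<times> cbox (- pi) pi) (\<lambda>z. (case z of (t, \<theta>) \<Rightarrow> ft t \<theta>) * tr p k (snd z))"
    proof (intro continuous_intros continuous_on_subset[OF ftc])
      show "continuous_on ({0..T} \<times> cbox (- pi) pi) (\<lambda>z. tr p k (snd z))"
        by (rule continuous_on_compose2[OF continuous_on_tr[of UNIV p k]]) (auto intro!: continuous_intros)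
    qed auto
    then show "continuous_on ({0..T} \<times> cbox (- pi) pi) (\<lambda>(s, x). ft s x * tr p k x)"
      by (simp add: case_prod_beta')
  qed simp
  then have "((\<lambda>s. integral (cbox (- pi) pi) (\<lambda>x. f s x * tr p k x) / pi) has_real_derivative fcoef p (ft t) k) (at t within {0..T})"
    unfolding eq[OF ft_t[OF t]] by (rule DERIV_cdivide)
  then show ?thesis
    by (rule has_field_derivative_transform_within[OF _ zero_less_one t]) (simp add: eq fc)
qed

section \<open>The solution assembled from its coefficients\<close>

lemma regular_odd_solution_exists:
  assumes m: "m > 3" and T: "T > 0" and c0: "summable (wsq m c0)" "c0 0 = 0" "c0 1 = 0" and e0: "\<eta>\<^sub>0 = ts 0 (acoef c0)"
  shows "\<exists>\<eta>. regular_odd_solution m T \<eta>\<^sub>0 \<eta>"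
proof -
  have T0: "0 \<le> T" using T by simp
  obtain c where c: "c 0 = c0" "\<And>t. t \<in> {0..T} \<Longrightarrow> c t 0 = 0 \<and> c t 1 = 0" "hcont m T c"
    "\<And>t k. t \<in> {0..T} \<Longrightarrow> ((\<lambda>r. c r k) has_real_derivative - jac q_DG (c t) k) (at t within {0..T})"
    using jac_solution_exists[OF jac_coupling_q_DG c0 T0] by blast
  define b where "b = (\<lambda>t k. - jac q_DG (c t) k)"
  define b2 where "b2 = (\<lambda>t k. - jac q_DG (b t) k)"
  \<comment> \<open>With m = n + 2, the first and second time derivatives \<open>b\<close> and
    \<open>b2\<close> of the coefficients have the weights n + 1 and n. As n is at least 1, even the
    series of \<open>b2\<close> converges absolutely.\<close>
  obtain n where n: "m = Suc (Suc n)" "n \<ge> 2" using m by (metis add_2_eq_Suc le_Suc_ex less_imp_le_nat numeral_3_eq_3 Suc_le_mono Suc_le_eq numeral_2_eq_2)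
  have hb: "hcont (Suc n) T b" unfolding b_def using c(3) n by (intro hcont_uminus hcont_jac jac_coupling_q_DG) simp
  have hb2: "hcont n T b2" unfolding b2_def by (intro hcont_uminus hcont_jac jac_coupling_q_DG hb)
  have hc: "hcont s T c" if "s \<le> m" for s by (rule hcont_mono[OF c(3) that])
  have hb': "hcont s T b" if "s \<le> Suc n" for s by (rule hcont_mono[OF hb that])
  have sm: "summable (wsq s (x t))" if "hcont s T x" "t \<in> {0..T}" for s x t using that unfolding hcont_def by blast
  have b01: "b t 0 = 0" "b t 1 = 0" "b2 t 0 = 0" "b2 t 1 = 0" for t by (simp_all add: b_def b2_def jac_def)
  have dc: "((\<lambda>r. c r k) has_real_derivative b t k) (at t within {0..T})" if "t \<in> {0..T}" for t k
    using c(4)[OF that] by (simp add: b_def)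
  have db: "((\<lambda>r. b r k) has_real_derivative b2 t k) (at t within {0..T})" if "t \<in> {0..T}" for t k
    unfolding b_def b2_def by (intro DERIV_minus jac_has_derivative) (use dc[OF that] in \<open>simp add: b_def\<close>)
  define \<eta> where "\<eta> t = ts 0 (acoef (c t))" for t
  define v where "v t = ts 0 (\<lambda>k. - acoef (c t) k / real k)" for t
  have ha: "hcont (Suc m) T (\<lambda>t. acoef (c t))" by (rule hcont_acoef[OF c(3)])
  have ha': "hcont 1 T (\<lambda>t. acoef (b t))" by (rule hcont_mono[OF hcont_acoef[OF hb]]) simp
  have wa: "summable (\<lambda>k. real k * \<bar>acoef (c t) k\<bar>)" if t: "t \<in> {0..T}" for t
    by (rule wsq_weighted_summable[OF sm[OF hcont_mono[OF ha] t]]) (use m in simp)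
  have sa: "summable (\<lambda>k. \<bar>acoef (c t) k\<bar>)" if "t \<in> {0..T}" for t by (rule weighted_summable_abs[OF wa[OF that]])
  have sa': "summable (\<lambda>k. \<bar>acoef (b t) k\<bar>)" if "t \<in> {0..T}" for t by (rule wsq_abs_summable(1)[OF sm[OF ha' that]])
  \<comment> \<open>The left side is continuous, periodic and odd, so the pointwise equation reduces
    to its sine coefficients, where it is the Jacobi system.\<close>
  have pde: "ts 0 (acoef (b t)) \<theta> + L_op (\<eta> t) (v t) \<theta> = 0" if t: "t \<in> {0..T}" for t \<theta>
  proof (rule continuous_odd_eq_zero[where f = "\<lambda>\<theta>. ts 0 (acoef (b t)) \<theta> + L_op (\<eta> t) (v t) \<theta>"])
    note L = L_op_ts[OF wa[OF t] acoef_0, folded v_def \<eta>_def]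
    show "periodic (\<lambda>\<theta>. ts 0 (acoef (b t)) \<theta> + L_op (\<eta> t) (v t) \<theta>)"
      using L(1) ts_periodic[of 0 "acoef (b t)"] by (simp add: periodic_def)
    show "continuous_on UNIV (\<lambda>\<theta>. ts 0 (acoef (b t)) \<theta> + L_op (\<eta> t) (v t) \<theta>)"
      by (intro continuous_intros L(2) continuous_on_ts sa'[OF t])
    show "odd_fun (\<lambda>\<theta>. ts 0 (acoef (b t)) \<theta> + L_op (\<eta> t) (v t) \<theta>)"
      using L(3) ts_even_odd(1)[OF sa'[OF t]] by (simp add: odd_fun_def)
    fix k :: nat assume k: "k \<ge> 1"
    have "fcoef 0 (\<lambda>\<theta>. ts 0 (acoef (b t)) \<theta> + L_op (\<eta> t) (v t) \<theta>) k = fcoef 0 (ts 0 (acoef (b t))) k + fcoef 0 (L_op (\<eta> t) (v t)) k"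
      unfolding fcoef_def distrib_right add_divide_distrib[symmetric] using L(2) sa'[OF t]
      by (subst Bochner_Integration.integral_add) (auto intro!: integrable_torus_continuous continuous_intros continuous_on_ts)
    moreover have "fcoef 0 (ts 0 (acoef (b t))) k = acoef (b t) k"
      using pclass_ts[OF sa'[OF t] acoef_0, of 0] by (simp add: pclass_def)
    moreover have "real k * fcoef 0 (L_op (\<eta> t) (v t)) k = real k * acoef (jac q_DG (c t)) k"
      using L(4)[OF k] Lam_acoef[of "c t" k] c(2)[OF t] k by simp
    moreover have "acoef (b t) k = - acoef (jac q_DG (c t)) k"
      unfolding b_def acoef_def by (simp add: algebra_simps diff_divide_distrib minus_divide_left)
    ultimately show "fcoef 0 (\<lambda>\<theta>. ts 0 (acoef (b t)) \<theta> + L_op (\<eta> t) (v t) \<theta>) k = 0" using k by simp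
  qed
  have "classical_solution T \<eta>\<^sub>0 \<eta>"
    unfolding classical_solution_def
  proof (intro conjI exI ballI allI)
    fix t assume t: "t \<in> {0..T}"
    show "periodic (\<eta> t)" unfolding \<eta>_def by (rule ts_periodic)
  next
    fix t \<theta> assume t: "t \<in> {0..T}"
    show "((\<lambda>s. \<eta> s \<theta>) has_real_derivative ts 0 (acoef (b t)) \<theta>) (at t within {0..T})"
      unfolding \<eta>_def
    proof (rule ts_time_derivative[OF _ _ t])
      show "summable (wsq 1 (acoef (c t)))" if "t \<in> {0..T}" for t by (rule sm[OF hcont_mono[OF ha] that]) simp
      show "summable (wsq 1 (acoef (b t)))" if "t \<in> {0..T}" for t by (rule sm[OF ha' that])
      show "((\<lambda>r. \<Sum>k. wsq 1 (\<lambda>k. (acoef (c r) k - acoef (c t) k) / (r - t) - acoef (b t) k) k) \<longlongrightarrow> 0) (at t within {0..T})"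
      proof (rule hcont_strong_derivative[OF _ ha' _ t])
        show "((\<lambda>r. acoef (c r) k) has_real_derivative acoef (b t) k) (at t within {0..T})" if "t \<in> {0..T}" for t k
          by (rule acoef_has_derivative[OF dc[OF that]])
        show "summable (wsq 1 (acoef (c t)))" if "t \<in> {0..T}" for t by (rule sm[OF hcont_mono[OF ha] that]) simp
      qed
    qed
    show "(\<eta> t has_real_derivative ts (Suc 0) (\<lambda>k. real k * acoef (c t) k) \<theta>) (at \<theta>)"
      unfolding \<eta>_def by (rule ts_has_derivative[OF wa[OF t]])
  next
    show "continuous_on ({0..T} \<times> UNIV) (\<lambda>(t, \<theta>). ts 0 (acoef (b t)) \<theta>)" by (rule ts_joint_continuous[OF ha'])
    show "continuous_on ({0..T} \<times> UNIV) (\<lambda>(t, \<theta>). ts (Suc 0) (\<lambda>k. real k * acoef (c t) k) \<theta>)"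
      by (rule ts_joint_continuous[OF hcont_mono[OF hcont_mult_index[OF ha]]]) (use m in simp)
  next
    fix t \<theta> assume t: "t \<in> {0..T}"
    show "ts 0 (acoef (b t)) \<theta> + L_op (\<eta> t) (v t) \<theta> = 0" by (rule pde[OF t])
    show "(v t has_real_derivative hilbert (\<eta> t) \<theta>) (at \<theta>)"
      unfolding v_def \<eta>_def by (rule velocity_ts_derivative[OF wa[OF t] acoef_0])
  next
    fix t show "v t 0 = 0" by (simp add: v_def ts_def tr_0)
  next
    fix \<theta> show "\<eta> 0 \<theta> = \<eta>\<^sub>0 \<theta>" by (simp add: \<eta>_def c(1) e0)
  qed
  moreover have "odd_fun (\<eta> t)" if "t \<in> {0..T}" for t
    using ts_even_odd(1)[OF sa[OF that]] by (simp add: \<eta>_def odd_fun_def)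
  moreover have "C_into 0 T H_DW DW_norm \<eta>"
    unfolding C_into.simps
  proof (intro ballI conjI)
    fix t assume t: "t \<in> {0..T}"
    have h1: "hcont 1 T c" by (rule hc) (use m in simp)
    show "\<eta> t \<in> H_DW" unfolding \<eta>_def using c(2)[OF t] by (intro H_DW_ts sm[OF h1 t]) auto
    have eq: "(\<lambda>x. \<eta> r x - \<eta> t x) = ts 0 (acoef (\<lambda>k. c r k - c t k))" if r: "r \<in> {0..T}" for r
    proof
      fix x
      have "acoef (\<lambda>k. c r k - c t k) = (\<lambda>k. acoef (c r) k - acoef (c t) k)" by (rule ext) (rule acoef_diff)
      then show "\<eta> r x - \<eta> t x = ts 0 (acoef (\<lambda>k. c r k - c t k)) x"
        using ts_diff[OF sa[OF r] sa[OF t], of 0 x] by (simp add: \<eta>_def)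
    qed
    have bd: "0 \<le> DW_norm (\<lambda>x. \<eta> r x - \<eta> t x) \<and> DW_norm (\<lambda>x. \<eta> r x - \<eta> t x) \<le> sqrt (pi * (\<Sum>k. wsq 1 (\<lambda>k. c r k - c t k) k))" if r: "r \<in> {0..T}" for r
      unfolding eq[OF r] using c(2)[OF t] c(2)[OF r] by (intro conjI DW_norm_le summable_wsq_diff sm[OF h1] r t) auto
    have "((\<lambda>r. sqrt (pi * (\<Sum>k. wsq 1 (\<lambda>k. c r k - c t k) k))) \<longlongrightarrow> sqrt (pi * 0)) (at t within {0..T})"
      using h1 t unfolding hcont_def by (intro tendsto_intros) blast
    then have l: "((\<lambda>r. sqrt (pi * (\<Sum>k. wsq 1 (\<lambda>k. c r k - c t k) k))) \<longlongrightarrow> 0) (at t within {0..T})" by simp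
    show "((\<lambda>r. DW_norm (\<lambda>x. \<eta> r x - \<eta> t x)) \<longlongrightarrow> 0) (at t within {0..T})"
      by (rule tendsto_sandwich[OF _ _ tendsto_const l])
         (use bd in \<open>auto simp: eventually_at_filter intro!: always_eventually\<close>)
  qed
  moreover have pcW: "pclass 0 (weighted_deriv (\<eta> t)) (c t)" if t: "t \<in> {0..T}" for t
    unfolding \<eta>_def using c(2)[OF t] by (intro weighted_deriv_ts(2) sm[OF hc t]) (use m in auto)
  then have "C_into 0 T (Sob m) (Sob_norm m) (\<lambda>t. weighted_deriv (\<eta> t))"
    by (intro C_into_0_pclass[OF c(3)])
  \<comment> \<open>The time derivatives are represented by the series of \<open>b\<close> and
    \<open>b2\<close>; only the curve itself has to be the prescribed representative
    \<open>weighted_deriv\<close>.\<close>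
  moreover have "C_into (Suc (Suc 0)) T (Sob n) (Sob_norm n) (\<lambda>t. weighted_deriv (\<eta> t))"
  proof -
    have hcn: "hcont n T c" and hbn: "hcont n T b" using n by (auto intro: hc hb')
    have p1: "pclass 0 (ts 0 (b t)) (b t)" if t: "t \<in> {0..T}" for t
      by (rule pclass_ts[OF wsq_abs_summable(1)[OF sm[OF hb' t]] b01(1)]) simp
    have p2: "pclass 0 (ts 0 (b2 t)) (b2 t)" if t: "t \<in> {0..T}" for t
      by (rule pclass_ts[OF wsq_abs_summable(1)[OF sm[OF hcont_mono[OF hb2] t]] b01(3)]) (use n in simp)
    have C0: "C_into 0 T (Sob n) (Sob_norm n) (\<lambda>t. ts 0 (b2 t))" by (rule C_into_0_pclass[OF hb2 p2])
    have C1: "C_into (Suc 0) T (Sob n) (Sob_norm n) (\<lambda>t. ts 0 (b t))"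
    proof (rule C_into_Suc_pclass[where b = b and b' = b2, OF _ _ _ _ _ C0])
      fix t assume t: "t \<in> {0..T}"
      show "((\<lambda>r. \<Sum>k. wsq n (\<lambda>k. (b r k - b t k) / (r - t) - b2 t k) k) \<longlongrightarrow> 0) (at t within {0..T})"
        by (rule hcont_strong_derivative[OF db hb2 sm[OF hbn] t])
    qed (use sm[OF hbn] p1 sm[OF hb2] p2 in auto)
    show ?thesis
    proof (rule C_into_Suc_pclass[where b = c and b' = b, OF _ _ _ _ _ C1])
      fix t assume t: "t \<in> {0..T}"
      show "((\<lambda>r. \<Sum>k. wsq n (\<lambda>k. (c r k - c t k) / (r - t) - b t k) k) \<longlongrightarrow> 0) (at t within {0..T})"
        by (rule hcont_strong_derivative[OF dc hbn sm[OF hcn] t])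
    qed (use sm[OF hcn] pcW sm[OF hbn] p1 in auto)
  qed
  ultimately have "regular_odd_solution m T \<eta>\<^sub>0 \<eta>"
    unfolding regular_odd_solution_def using n by (simp add: numeral_2_eq_2 del: C_into.simps)
  then show ?thesis by blast
qed

text \<open>The classical equation concerns eta, so it yields time derivatives of the coefficients
  of eta, that is, of the differences c (k + 1) - c (k - 1). Starting from c 0 = c 1 = 0, these are
  added up in steps of two to recover the derivative of every c k.\<close>

lemma regular_odd_solution_coefficients:
  assumes sol: "regular_odd_solution m T \<eta>\<^sub>0 \<xi>" and m: "m > 3"
  defines "c \<equiv> \<lambda>t. fcoef 0 (weighted_deriv (\<xi> t))"
  shows "hcont m T c"
    and "\<And>t. t \<in> {0..T} \<Longrightarrow> \<xi> t = ts 0 (acoef (c t))" "\<And>t. t \<in> {0..T} \<Longrightarrow> c t 0 = 0" "\<And>t. t \<in> {0..T} \<Longrightarrow> c t 1 = 0"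
    and "\<And>t k. t \<in> {0..T} \<Longrightarrow> ((\<lambda>r. c r k) has_real_derivative - jac q_DG (c t) k) (at t within {0..T})"
proof -
  define W where "W t = weighted_deriv (\<xi> t)" for t
  have H: "\<xi> t \<in> H_DW" and WS: "W t \<in> Sob m" if "t \<in> {0..T}" for t
    using sol that unfolding regular_odd_solution_def W_def by auto
  have Wl: "((\<lambda>r. Sob_norm m (\<lambda>x. W r x - W t x)) \<longlongrightarrow> 0) (at t within {0..T})" if "t \<in> {0..T}" for t
    using sol that unfolding regular_odd_solution_def W_def by simp
  have m1: "m \<ge> 1" using m by simp
  note ex = H_DW_expansion[OF H WS[unfolded W_def] m1, folded c_def]
  have pc: "pclass 0 (W t) (c t)" and c0: "c t 0 = 0" and c1: "c t 1 = 0" and sm: "summable (wsq m (c t))" and \<xi>: "\<xi> t = ts 0 (acoef (c t))"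
    if "t \<in> {0..T}" for t
    using ex[OF that that] by (auto simp: c_def W_def)
  show "\<xi> t = ts 0 (acoef (c t))" "c t 0 = 0" "c t 1 = 0" if "t \<in> {0..T}" for t
    by (rule \<xi>[OF that], rule c0[OF that], rule c1[OF that])
  show "hcont m T c"
    unfolding hcont_def
  proof (intro ballI conjI sm)
    fix t assume t: "t \<in> {0..T}"
    \<comment> \<open>Here the Sobolev norm has to control the coefficients, the converse of the
      estimate behind existence.\<close>
    have le: "(\<Sum>k. wsq m (\<lambda>k. c r k - c t k) k) \<le> 4 ^ m / pi * (Sob_norm m (\<lambda>x. W r x - W t x))\<^sup>2
       \<and> 0 \<le> (\<Sum>k. wsq m (\<lambda>k. c r k - c t k) k)" if r: "r \<in> {0..T}" for r
    proof -
      have p: "pclass 0 (\<lambda>x. W r x - W t x) (\<lambda>k. c r k - c t k)" by (rule pclass_diff[OF pc[OF r] pc[OF t]])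
      have s: "summable (wsq m (\<lambda>k. c r k - c t k))" by (rule summable_wsq_diff(1)[OF sm[OF r] sm[OF t]])
      have "(\<lambda>x. W r x - W t x) \<in> Sob m" using pclass_Sob[OF p s] by blast
      from Sob_summable(2)[OF this p] have "(\<Sum>k. wsq m (\<lambda>k. c r k - c t k) k) \<le> 4 ^ m / pi * (Sob_norm m (\<lambda>x. W r x - W t x))\<^sup>2"
        by (simp add: field_simps)
      then show ?thesis using suminf_nonneg[OF s] by simp
    qed
    have "((\<lambda>r. 4 ^ m / pi * (Sob_norm m (\<lambda>x. W r x - W t x))\<^sup>2) \<longlongrightarrow> 4 ^ m / pi * 0\<^sup>2) (at t within {0..T})"
      by (intro tendsto_intros Wl[OF t])
    then have l: "((\<lambda>r. 4 ^ m / pi * (Sob_norm m (\<lambda>x. W r x - W t x))\<^sup>2) \<longlongrightarrow> 0) (at t within {0..T})" by simp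
    show "((\<lambda>r. \<Sum>k. wsq m (\<lambda>k. c r k - c t k) k) \<longlongrightarrow> 0) (at t within {0..T})"
      by (rule tendsto_sandwich[OF _ _ tendsto_const l])
         (use le in \<open>auto simp: eventually_at_filter intro!: always_eventually\<close>)
  qed
  have wa: "summable (\<lambda>k. real k * \<bar>acoef (c t) k\<bar>)" if t: "t \<in> {0..T}" for t
    by (rule wsq_weighted_summable[OF summable_wsq_mono[OF summable_acoef[OF sm[OF t]]]]) (use m in simp)
  have fa: "fcoef 0 (\<xi> t) k = acoef (c t) k" if t: "t \<in> {0..T}" for t k
    using pclass_ts[OF weighted_summable_abs[OF wa[OF t]] acoef_0, of 0] by (simp add: pclass_def \<xi>[OF t])
  obtain \<eta>t \<eta>\<theta> v where cl: "\<And>t \<theta>. t \<in> {0..T} \<Longrightarrow> ((\<lambda>s. \<xi> s \<theta>) has_real_derivative \<eta>t t \<theta>) (at t within {0..T})"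
      "continuous_on ({0..T} \<times> UNIV) (\<lambda>(t, \<theta>). \<eta>t t \<theta>)"
      "\<And>t \<theta>. t \<in> {0..T} \<Longrightarrow> \<eta>t t \<theta> + L_op (\<xi> t) (v t) \<theta> = 0"
      "\<And>t \<theta>. t \<in> {0..T} \<Longrightarrow> (v t has_real_derivative hilbert (\<xi> t) \<theta>) (at \<theta>)"
      "\<And>t. t \<in> {0..T} \<Longrightarrow> v t 0 = 0"
    using sol unfolding regular_odd_solution_def classical_solution_def by blast
  have da: "((\<lambda>s. real k * fcoef 0 (\<xi> s) k) has_real_derivative - (real k * acoef (jac q_DG (c t)) k)) (at t within {0..T})"
    if t: "t \<in> {0..T}" and k: "k \<ge> 1" for t k
  proof -
    have "continuous_on UNIV (\<xi> s)" if "s \<in> {0..T}" for s using H[OF that] by (simp add: H_DW_def)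
    from fcoef_time_derivative[OF cl(1,2) this t]
    have d: "((\<lambda>s. fcoef 0 (\<xi> s) k) has_real_derivative fcoef 0 (\<eta>t t) k) (at t within {0..T})" .
    have v: "v t = ts 0 (\<lambda>k. - acoef (c t) k / real k)"
      using cl(4)[OF t] cl(5)[OF t] unfolding \<xi>[OF t] by (intro velocity_ts[OF wa[OF t] acoef_0])
    have "\<eta>t t = (\<lambda>\<theta>. - L_op (\<xi> t) (v t) \<theta>)" using cl(3)[OF t] by (intro ext) (simp add: eq_neg_iff_add_eq_0)
    then have "fcoef 0 (\<eta>t t) k = - fcoef 0 (L_op (\<xi> t) (v t)) k" by (simp add: fcoef_def)
    moreover have "real k * fcoef 0 (L_op (\<xi> t) (v t)) k = real k * acoef (jac q_DG (c t)) k"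
      using L_op_ts(4)[OF wa[OF t] acoef_0 k] Lam_acoef[of "c t" k] c0[OF t] c1[OF t] k
      unfolding v \<xi>[OF t] by simp
    ultimately have "real k * fcoef 0 (\<eta>t t) k = - (real k * acoef (jac q_DG (c t)) k)" by simp
    then show ?thesis using DERIV_cmult[OF d, of "real k"] by simp
  qed
  have step: "((\<lambda>r. c r (k + 2)) has_real_derivative - jac q_DG (c t) (k + 2)) (at t within {0..T})"
    if t: "t \<in> {0..T}" and dk: "((\<lambda>r. c r k) has_real_derivative - jac q_DG (c t) k) (at t within {0..T})" for t k
  proof -
    have eq: "c r k + real (k + 1) * fcoef 0 (\<xi> r) (k + 1) / sqrt pi = c r (k + 2)" if r: "r \<in> {0..T}" for r
      unfolding fa[OF r] by (simp add: acoef_def del: of_nat_Suc of_nat_add)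
    have "((\<lambda>r. c r k + real (k + 1) * fcoef 0 (\<xi> r) (k + 1) / sqrt pi) has_real_derivative
       - jac q_DG (c t) k + - (real (k + 1) * acoef (jac q_DG (c t)) (k + 1)) / sqrt pi) (at t within {0..T})"
      by (intro DERIV_add DERIV_cdivide dk da t) simp
    moreover have "- jac q_DG (c t) k + - (real (k + 1) * acoef (jac q_DG (c t)) (k + 1)) / sqrt pi = - jac q_DG (c t) (k + 2)"
      by (simp add: acoef_def del: of_nat_Suc of_nat_add)
    ultimately have "((\<lambda>r. c r k + real (k + 1) * fcoef 0 (\<xi> r) (k + 1) / sqrt pi) has_real_derivative - jac q_DG (c t) (k + 2)) (at t within {0..T})"
      by simp
    then show ?thesis by (rule has_field_derivative_transform_within[OF _ zero_less_one t]) (rule eq)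
  qed
  have "((\<lambda>r. c r k) has_real_derivative - jac q_DG (c t) k) (at t within {0..T}) \<and>
     ((\<lambda>r. c r (k + 1)) has_real_derivative - jac q_DG (c t) (k + 1)) (at t within {0..T})" if t: "t \<in> {0..T}" for t k
  proof (induction k)
    case 0
    have const: "((\<lambda>r. f r) has_real_derivative 0) (at t within {0..T})" if "\<And>r. r \<in> {0..T} \<Longrightarrow> f r = 0" for f :: "real \<Rightarrow> real"
      by (rule has_field_derivative_transform_within[OF DERIV_const zero_less_one t]) (simp add: that)
    have "((\<lambda>r. c r 0) has_real_derivative 0) (at t within {0..T})" "((\<lambda>r. c r 1) has_real_derivative 0) (at t within {0..T})"
      by (rule const, erule c0, rule const, erule c1)
    then show ?case by (simp add: jac_def)
  next
    case (Suc k)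
    then show ?case using step[OF t, of k] by simp
  qed
  then show "((\<lambda>r. c r k) has_real_derivative - jac q_DG (c t) k) (at t within {0..T})" if "t \<in> {0..T}" for t k
    using that by blast
qed

lemma regular_odd_solution_unique:
  assumes sol: "regular_odd_solution m T \<eta>\<^sub>0 \<xi>" "regular_odd_solution m T \<eta>\<^sub>0 \<eta>" and m: "m > 3" and t: "t \<in> {0..T}"
  shows "\<xi> t = \<eta> t"
proof -
  define c where "c t = fcoef 0 (weighted_deriv (\<xi> t))" for t
  define d where "d t = fcoef 0 (weighted_deriv (\<eta> t))" for t
  note 1 = regular_odd_solution_coefficients[OF sol(1) m, folded c_def]
  note 2 = regular_odd_solution_coefficients[OF sol(2) m, folded d_def]
  have T0: "0 \<le> T" using t by simp
  have "\<xi> 0 = \<eta> 0" using sol unfolding regular_odd_solution_def classical_solution_def by (intro ext) simp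
  \<comment> \<open>The two functions at time 0 are equal, so even their chosen weak derivatives
    coincide.\<close>
  then have init: "c 0 = d 0" by (simp add: c_def d_def)
  obtain B1 where B1: "\<And>t. t \<in> {0..T} \<Longrightarrow> (\<Sum>k. wsq m (c t) k) \<le> B1" using hcont_bounded[OF 1(1) T0] by blast
  obtain B2 where B2: "\<And>t. t \<in> {0..T} \<Longrightarrow> (\<Sum>k. wsq m (d t) k) \<le> B2" using hcont_bounded[OF 2(1) T0] by blast
  define z where "z = (\<lambda>t k. c t k - d t k)"
  have "z t k = 0" for k
  proof (rule jac_solution_unique[OF jac_coupling_q_DG t])
    show "z t 0 = 0" "z t 1 = 0" if "t \<in> {0..T}" for t using 1(3,4)[OF that] 2(3,4)[OF that] by (simp_all add: z_def)
    show "z 0 k = 0" for k by (simp add: z_def init)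
    show "((\<lambda>r. z r k) has_real_derivative - jac q_DG (z t) k) (at t within {0..T})" if "t \<in> {0..T}" for t k
      using DERIV_diff[OF 1(5)[OF that] 2(5)[OF that], of k k] unfolding z_def jac_diff by simp
    show "(real k + 1) * \<bar>z t k\<bar> \<le> sqrt (2 * B1 + 2 * B2)" if t: "t \<in> {0..T}" for t k
    proof -
      have s: "summable (wsq m (c t))" "summable (wsq m (d t))" using 1(1) 2(1) t unfolding hcont_def by auto
      have "((real k + 1) * \<bar>z t k\<bar>)\<^sup>2 = wsq 1 (z t) k" by (simp add: wsq_def power_mult_distrib)
      also have "\<dots> \<le> wsq m (z t) k" using m by (intro wsq_mono) simp
      also have "\<dots> \<le> (\<Sum>k. wsq m (z t) k)"
        using sum_le_suminf[OF summable_wsq_diff(1)[OF s], of "{k}"] by (simp add: z_def)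
      also have "\<dots> \<le> 2 * (\<Sum>k. wsq m (c t) k) + 2 * (\<Sum>k. wsq m (d t) k)" unfolding z_def by (rule summable_wsq_diff(2)[OF s])
      also have "\<dots> \<le> 2 * B1 + 2 * B2" using B1[OF t] B2[OF t] by simp
      finally show ?thesis by (rule real_le_rsqrt)
    qed
  qed
  then have "c t = d t" by (intro ext) (simp add: z_def)
  then show ?thesis using 1(2)[OF t] 2(2)[OF t] by simp
qed

theorem theorem1p1:
  fixes m :: nat and \<eta>\<^sub>0 :: "real \<Rightarrow> real" and T :: real
  assumes "m > 3"
    and "\<eta>\<^sub>0 \<in> H_DW"
    and "weighted_deriv \<eta>\<^sub>0 \<in> Sob m"
    and "T > 0"
  shows "\<exists>\<eta>. regular_odd_solution m T \<eta>\<^sub>0 \<eta> \<and>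
           (\<forall>\<xi>. regular_odd_solution m T \<eta>\<^sub>0 \<xi> \<longrightarrow> (\<forall>t\<in>{0..T}. \<forall>\<theta>. \<xi> t \<theta> = \<eta> t \<theta>))"
proof -
  have "m \<ge> 1" using assms(1) by simp
  \<comment> \<open>The datum satisfies the same conditions as every time slice of a regular
    solution, so one expansion serves for both.\<close>
  note e = H_DW_expansion[OF assms(2,3) this]
  obtain \<eta> where "regular_odd_solution m T \<eta>\<^sub>0 \<eta>"
    using regular_odd_solution_exists[OF assms(1,4) e(4,2,3,5)] by blast
  then show ?thesis using regular_odd_solution_unique assms(1) by metis
qed

end
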